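(* Let $(M,g,J)$ be a Hermitian manifold of real dimension $2m+2$ such that $Hol(\nabla^a)\subset U(m)\times U(1)$, with corresponding splitting $TM=\mathcal{H}\oplus\mathcal{V}$, $$T^a\in\Lambda^{2,0}\mathcal{H}^*\otimes\Lambda^{0,1}\mathcal{V}^*\oplus\Lambda^{0,2}\mathcal{H}^*\otimes\Lambda^{1,0}\mathcal{V}^*,$$ and $T^a$ is non-degenerate (so that $m=2n$ is even). Then the Ricci tensor $Ric^a$ and scalar curvature $s^a$ of $\nabla^a$ and the Ricci tensor $Ric$ and scalar curvature $s$ of the Levi-Civita connection are $$Ric^a=\frac{|T^a|^2}{12n}\big((n+1)g_{|\mathcal{H}}+2g_{|\mathcal{V}}\big),\qquad s^a=\frac{(n^2+n+1)|T^a|^2}{3n},$$ $$Ric=\frac{|T^a|^2}{24n}\big((2n+3)g_{|\mathcal{H}}+(n+4)g_{|\mathcal{V}}\big),\qquad s=\frac{(4n^2+7n+4)|T^a|^2}{12n}.$$ In particular, $Ric^a$ and $Ric$ are positive definite and $\nabla^a$-parallel, and $(M,g)$ is Einstein only if $n=1$.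
   Context: Manifolds are smooth and connected. A Hermitian manifold is $(M,g,J)$ with $J$ an integrable $g$-orthogonal almost complex structure. $\nabla^a$ is the unique connection with $\nabla^a g=0$, $\nabla^a J=0$ whose torsion $T^a$, viewed as $T^a(X,Y,Z)=g(T^a(X,Y),Z)$, is a 3-form; $\nabla^a=\nabla+\frac12T^a$ with $\nabla$ the Levi-Civita connection. $T^a$ is non-degenerate if $T^a(X,\cdot)\ne0$ for every tangent vector $X\neq0$. $Hol(\nabla^a)\subset U(m)\times U(1)\subset U(m+1)$ means that there is a (fixed) $\nabla^a$-parallel, $g$-orthogonal, $J$-invariant splitting $TM=\mathcal{H}\oplus\mathcal{V}$ with real ranks $2m$ and $2$. $\Lambda^{p,q}\mathcal{H}^*$, $\Lambda^{p,q}\mathcal{V}^*$ are the complex $(p,q)$-forms on $\mathcal{H}$, $\mathcal{V}$ with respect to $J$ (extended by zero), and tensor products of them are embedded in $\Lambda^3T^*M\otimes\mathbb{C}$ by the wedge product. $g_{|\mathcal{H}}$, $g_{|\mathcal{V}}$ denote the restrictions of $g$ extended by zero to $TM$ using the splitting. $|T^a|^2=\sum_{i,j,k}T^a(e_i,e_j,e_k)^2$ (tensorial norm, $\{e_i\}$ a $g$-orthonormal frame of $TM$). Curvature convention: $R(X,Y)=[\nabla_X,\nabla_Y]-\nabla_{[X,Y]}$, $R(X,Y,Z,W)=g(R(X,Y)Z,W)$, $Ric(Y,Z)=\sum_iR(e_i,Y,Z,e_i)$ (the round sphere has positive Ricci tensor), $s=\mathrm{tr}_g Ric$, and likewise for $\nabla^a$.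 *)

theory Defs
  imports "HOL-Analysis.Analysis"
begin

section \<open>Smooth manifolds\<close>

text \<open>
  Smoothness on open subsets of Euclidean spaces. The predicate is only used for open sets.
\<close>

primrec Ck_on :: "nat \<Rightarrow> 'e::euclidean_space set \<Rightarrow> ('e \<Rightarrow> 'f::real_normed_vector) \<Rightarrow> bool" where
  "Ck_on 0 S f \<longleftrightarrow> continuous_on S f"
| "Ck_on (Suc k) S f \<longleftrightarrow>
     (\<forall>x\<in>S. f differentiable (at x)) \<and> (\<forall>v. Ck_on k S (\<lambda>x. frechet_derivative f (at x) v))"

definition smooth_on :: "'e::euclidean_space set \<Rightarrow> ('e \<Rightarrow> 'f::real_normed_vector) \<Rightarrow> bool" where
  "smooth_on S f \<longleftrightarrow> (\<forall>k. Ck_on k S f)"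

text \<open>
  The underlying space of the manifold is the whole type \<open>'a\<close>; charts take values in a
  Euclidean space \<open>'e\<close> whose dimension is the dimension of the manifold. A chart is a pair
  of an open domain and a coordinate map, of which only the values on the domain matter.
\<close>

type_synonym ('a, 'e) chart = "'a set \<times> ('a \<Rightarrow> 'e)"

abbreviation dom_of :: "('a, 'e) chart \<Rightarrow> 'a set" where
  "dom_of c \<equiv> fst c"

abbreviation coords :: "('a, 'e) chart \<Rightarrow> 'a \<Rightarrow> 'e" where
  "coords c \<equiv> snd c"

definition inv_coords :: "('a, 'e) chart \<Rightarrow> 'e \<Rightarrow> 'a" where
  "inv_coords c = inv_into (dom_of c) (coords c)"

definition is_chart :: "('a::topological_space, 'e::euclidean_space) chart \<Rightarrow> bool" where
  "is_chart c \<longleftrightarrow> open (dom_of c) \<and> open (coords c ` dom_of c) \<and>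
     homeomorphism (dom_of c) (coords c ` dom_of c) (coords c) (inv_coords c)"

definition smooth_atlas :: "('a::topological_space, 'e::euclidean_space) chart set \<Rightarrow> bool" where
  "smooth_atlas A \<longleftrightarrow>
     (\<forall>c\<in>A. is_chart c) \<and> (\<Union>c\<in>A. dom_of c) = UNIV \<and>
     (\<forall>c\<in>A. \<forall>d\<in>A. smooth_on (coords c ` (dom_of c \<inter> dom_of d)) (coords d \<circ> inv_coords c))"

definition smooth_manifold ::
  "('a::{t2_space,second_countable_topology}, 'e::euclidean_space) chart set \<Rightarrow> bool" where
  "smooth_manifold A \<longleftrightarrow> smooth_atlas A \<and> connected (UNIV :: 'a set)"

definition smooth_fun ::
  "('a::topological_space, 'e::euclidean_space) chart set \<Rightarrow> 'a set \<Rightarrow> ('a \<Rightarrow> real) \<Rightarrow> bool" where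
  "smooth_fun A W f \<longleftrightarrow> (\<forall>c\<in>A. smooth_on (coords c ` (W \<inter> dom_of c)) (f \<circ> inv_coords c))"


section \<open>Tangent vectors and vector fields\<close>

text \<open>
  A preferred chart of the atlas is selected around each point \<open>p\<close>, and the tangent space at
  \<open>p\<close> is the copy of \<open>'e\<close> given by the components with respect to that preferred chart. So a
  vector field is a function \<open>'a \<Rightarrow> 'e\<close>, but its components at different points may refer to
  different charts; \<open>to_chart A c p\<close> is the change to components with respect to the chart \<open>c\<close>,
  and notions involving several points are expressed through it.
\<close>

definition chart_at :: "('a, 'e) chart set \<Rightarrow> 'a \<Rightarrow> ('a, 'e) chart" where
  "chart_at A p = (SOME c. c \<in> A \<and> p \<in> dom_of c)"

definition to_chart ::
  "('a, 'e::euclidean_space) chart set \<Rightarrow> ('a, 'e) chart \<Rightarrow> 'a \<Rightarrow> 'e \<Rightarrow> 'e" where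
  "to_chart A c p =
     frechet_derivative (coords c \<circ> inv_coords (chart_at A p)) (at (coords (chart_at A p) p))"

definition field_in_chart ::
  "('a, 'e::euclidean_space) chart set \<Rightarrow> ('a, 'e) chart \<Rightarrow> ('a \<Rightarrow> 'e) \<Rightarrow> 'e \<Rightarrow> 'e" where
  "field_in_chart A c X x = to_chart A c (inv_coords c x) (X (inv_coords c x))"

definition smooth_vf ::
  "('a::topological_space, 'e::euclidean_space) chart set \<Rightarrow> 'a set \<Rightarrow> ('a \<Rightarrow> 'e) \<Rightarrow> bool" where
  "smooth_vf A W X \<longleftrightarrow>
     (\<forall>c\<in>A. smooth_on (coords c ` (W \<inter> dom_of c)) (field_in_chart A c X))"

text \<open>The derivative of the function \<open>f\<close> at \<open>p\<close> in the direction of the tangent vector \<open>v\<close>.\<close>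

definition dir_deriv ::
  "('a, 'e::euclidean_space) chart set \<Rightarrow> 'a \<Rightarrow> 'e \<Rightarrow> ('a \<Rightarrow> real) \<Rightarrow> real" where
  "dir_deriv A p v f =
     frechet_derivative (f \<circ> inv_coords (chart_at A p)) (at (coords (chart_at A p) p)) v"

text \<open>
  The Lie bracket at \<open>p\<close>, computed in the preferred chart at \<open>p\<close>, where \<open>X p\<close> and \<open>Y p\<close> are
  the components of the fields at \<open>p\<close>: \<open>[X,Y] = DY(X) - DX(Y)\<close>.
\<close>

definition lie_bracket ::
  "('a, 'e::euclidean_space) chart set \<Rightarrow> ('a \<Rightarrow> 'e) \<Rightarrow> ('a \<Rightarrow> 'e) \<Rightarrow> 'a \<Rightarrow> 'e" where
  "lie_bracket A X Y p =
     (let c = chart_at A p in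
        frechet_derivative (field_in_chart A c Y) (at (coords c p)) (X p)
        - frechet_derivative (field_in_chart A c X) (at (coords c p)) (Y p))"

text \<open>
  The local vector field extending the tangent vector \<open>u\<close> at \<open>p\<close> that has constant components
  in the preferred chart at \<open>p\<close>. It is meaningful on the domain of that chart, and is used to
  evaluate tensorial expressions in vector fields on tangent vectors at \<open>p\<close>.
\<close>

definition extend ::
  "('a, 'e::euclidean_space) chart set \<Rightarrow> 'a \<Rightarrow> 'e \<Rightarrow> ('a \<Rightarrow> 'e)" where
  "extend A p u q =
     frechet_derivative (coords (chart_at A q) \<circ> inv_coords (chart_at A p))
       (at (coords (chart_at A p) q)) u"


section \<open>Affine connections, torsion and curvature\<close>

text \<open>
  For a connection \<open>D\<close>, the term \<open>D p v Y\<close> is the covariant derivative at \<open>p\<close> of the local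
  vector field \<open>Y\<close> in the direction of the tangent vector \<open>v\<close> at \<open>p\<close>; so \<open>\<nabla>\<^sub>X Y\<close> is
  \<open>\<lambda>p. D p (X p) Y\<close>. As usual, a connection acts on vector fields defined on any open set,
  compatibly with restriction, which is the locality condition below.
\<close>

type_synonym ('a, 'e) conn = "'a \<Rightarrow> 'e \<Rightarrow> ('a \<Rightarrow> 'e) \<Rightarrow> 'e"

definition affine_connection ::
  "('a::topological_space, 'e::euclidean_space) chart set \<Rightarrow> ('a, 'e) conn \<Rightarrow> bool" where
  "affine_connection A D \<longleftrightarrow>
     (\<forall>W Y Y' p v. open W \<and> p \<in> W \<and> smooth_vf A W Y \<and> (\<forall>q\<in>W. Y' q = Y q) \<longrightarrow>
        D p v Y' = D p v Y) \<and>
     (\<forall>W X Y. open W \<and> smooth_vf A W X \<and> smooth_vf A W Y \<longrightarrow>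
        smooth_vf A W (\<lambda>p. D p (X p) Y)) \<and>
     (\<forall>W Y p. open W \<and> p \<in> W \<and> smooth_vf A W Y \<longrightarrow> linear (\<lambda>v. D p v Y)) \<and>
     (\<forall>W Y Z p v. open W \<and> p \<in> W \<and> smooth_vf A W Y \<and> smooth_vf A W Z \<longrightarrow>
        D p v (\<lambda>q. Y q + Z q) = D p v Y + D p v Z) \<and>
     (\<forall>W f Y p v. open W \<and> p \<in> W \<and> smooth_fun A W f \<and> smooth_vf A W Y \<longrightarrow>
        D p v (\<lambda>q. f q *\<^sub>R Y q) = dir_deriv A p v f *\<^sub>R Y p + f p *\<^sub>R D p v Y)"

definition torsion ::
  "('a, 'e::euclidean_space) chart set \<Rightarrow> ('a, 'e) conn \<Rightarrow> 'a \<Rightarrow> 'e \<Rightarrow> 'e \<Rightarrow> 'e" where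
  "torsion A D p u v =
     (let X = extend A p u; Y = extend A p v in
        D p (X p) Y - D p (Y p) X - lie_bracket A X Y p)"

definition torsion_form ::
  "('a, 'e::euclidean_space) chart set \<Rightarrow> ('a \<Rightarrow> 'e \<Rightarrow> 'e \<Rightarrow> real) \<Rightarrow> ('a, 'e) conn
     \<Rightarrow> 'a \<Rightarrow> 'e \<Rightarrow> 'e \<Rightarrow> 'e \<Rightarrow> real" where
  "torsion_form A g D p u v w = g p (torsion A D p u v) w"

definition curvature ::
  "('a, 'e::euclidean_space) chart set \<Rightarrow> ('a, 'e) conn \<Rightarrow> 'a \<Rightarrow> 'e \<Rightarrow> 'e \<Rightarrow> 'e \<Rightarrow> 'e" where
  "curvature A D p u v w =
     (let X = extend A p u; Y = extend A p v; Z = extend A p w in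
        D p (X p) (\<lambda>q. D q (Y q) Z) - D p (Y p) (\<lambda>q. D q (X q) Z)
        - D p (lie_bracket A X Y p) Z)"

definition curvature4 ::
  "('a, 'e::euclidean_space) chart set \<Rightarrow> ('a \<Rightarrow> 'e \<Rightarrow> 'e \<Rightarrow> real) \<Rightarrow> ('a, 'e) conn
     \<Rightarrow> 'a \<Rightarrow> 'e \<Rightarrow> 'e \<Rightarrow> 'e \<Rightarrow> 'e \<Rightarrow> real" where
  "curvature4 A g D p u v w z = g p (curvature A D p u v w) z"


section \<open>Metrics, orthonormal frames, Ricci and scalar curvature\<close>

definition positive_definite :: "('e::real_vector \<Rightarrow> 'e \<Rightarrow> real) \<Rightarrow> bool" where
  "positive_definite b \<longleftrightarrow>
     (\<forall>u. linear (b u)) \<and> (\<forall>u v. b u v = b v u) \<and> (\<forall>v. v \<noteq> 0 \<longrightarrow> b v v > 0)"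

definition smooth_form2 ::
  "('a::topological_space, 'e::euclidean_space) chart set \<Rightarrow> ('a \<Rightarrow> 'e \<Rightarrow> 'e \<Rightarrow> real) \<Rightarrow> bool" where
  "smooth_form2 A b \<longleftrightarrow>
     (\<forall>W X Y. open W \<and> smooth_vf A W X \<and> smooth_vf A W Y \<longrightarrow>
        smooth_fun A W (\<lambda>p. b p (X p) (Y p)))"

definition riemannian_metric ::
  "('a::topological_space, 'e::euclidean_space) chart set \<Rightarrow> ('a \<Rightarrow> 'e \<Rightarrow> 'e \<Rightarrow> real) \<Rightarrow> bool" where
  "riemannian_metric A g \<longleftrightarrow> (\<forall>p. positive_definite (g p)) \<and> smooth_form2 A g"

text \<open>A smooth bilinear form \<open>b\<close> with \<open>\<nabla>b = 0\<close>.\<close>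

definition parallel_form2 ::
  "('a::topological_space, 'e::euclidean_space) chart set \<Rightarrow> ('a, 'e) conn
     \<Rightarrow> ('a \<Rightarrow> 'e \<Rightarrow> 'e \<Rightarrow> real) \<Rightarrow> bool" where
  "parallel_form2 A D b \<longleftrightarrow> smooth_form2 A b \<and>
     (\<forall>W Y Z p v. open W \<and> p \<in> W \<and> smooth_vf A W Y \<and> smooth_vf A W Z \<longrightarrow>
        dir_deriv A p v (\<lambda>q. b q (Y q) (Z q)) = b p (D p v Y) (Z p) + b p (Y p) (D p v Z))"

definition levi_civita ::
  "('a::topological_space, 'e::euclidean_space) chart set \<Rightarrow> ('a \<Rightarrow> 'e \<Rightarrow> 'e \<Rightarrow> real)
     \<Rightarrow> ('a, 'e) conn \<Rightarrow> bool" where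
  "levi_civita A g D \<longleftrightarrow>
     affine_connection A D \<and> parallel_form2 A D g \<and> (\<forall>p u v. torsion A D p u v = 0)"

definition orthonormal_frame :: "('e::real_vector \<Rightarrow> 'e \<Rightarrow> real) \<Rightarrow> 'e set \<Rightarrow> bool" where
  "orthonormal_frame b E \<longleftrightarrow> finite E \<and> span E = UNIV \<and>
     (\<forall>x\<in>E. \<forall>y\<in>E. b x y = (if x = y then 1 else 0))"

text \<open>
  Metric traces and norms do not depend on the orthonormal frame; an arbitrary one is selected.
\<close>

definition frame :: "('e::real_vector \<Rightarrow> 'e \<Rightarrow> real) \<Rightarrow> 'e set" where
  "frame b = (SOME E. orthonormal_frame b E)"

definition norm_sq3 ::
  "('e::real_vector \<Rightarrow> 'e \<Rightarrow> real) \<Rightarrow> ('e \<Rightarrow> 'e \<Rightarrow> 'e \<Rightarrow> real) \<Rightarrow> real" where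
  "norm_sq3 b t = (\<Sum>x\<in>frame b. \<Sum>y\<in>frame b. \<Sum>z\<in>frame b. (t x y z)\<^sup>2)"

definition Ricci ::
  "('a, 'e::euclidean_space) chart set \<Rightarrow> ('a \<Rightarrow> 'e \<Rightarrow> 'e \<Rightarrow> real) \<Rightarrow> ('a, 'e) conn
     \<Rightarrow> 'a \<Rightarrow> 'e \<Rightarrow> 'e \<Rightarrow> real" where
  "Ricci A g D p u v = (\<Sum>e\<in>frame (g p). curvature4 A g D p e u v e)"

definition scalar_curvature ::
  "('a, 'e::euclidean_space) chart set \<Rightarrow> ('a \<Rightarrow> 'e \<Rightarrow> 'e \<Rightarrow> real) \<Rightarrow> ('a, 'e) conn
     \<Rightarrow> 'a \<Rightarrow> real" where
  "scalar_curvature A g D p = (\<Sum>e\<in>frame (g p). Ricci A g D p e e)"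

text \<open>For the Levi-Civita connection \<open>D\<close> of \<open>g\<close>, this says that \<open>g\<close> is an Einstein metric.\<close>

definition einstein ::
  "('a, 'e::euclidean_space) chart set \<Rightarrow> ('a \<Rightarrow> 'e \<Rightarrow> 'e \<Rightarrow> real) \<Rightarrow> ('a, 'e) conn \<Rightarrow> bool" where
  "einstein A g D \<longleftrightarrow> (\<exists>k. \<forall>p u v. Ricci A g D p u v = k * g p u v)"


section \<open>Hermitian manifolds and the characteristic connection\<close>

definition almost_complex_structure ::
  "('a::topological_space, 'e::euclidean_space) chart set \<Rightarrow> ('a \<Rightarrow> 'e \<Rightarrow> 'e) \<Rightarrow> bool" where
  "almost_complex_structure A J \<longleftrightarrow>
     (\<forall>p. linear (J p)) \<and> (\<forall>p v. J p (J p v) = - v) \<and>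
     (\<forall>W X. open W \<and> smooth_vf A W X \<longrightarrow> smooth_vf A W (\<lambda>p. J p (X p)))"

text \<open>Integrability is the vanishing of the Nijenhuis tensor.\<close>

definition integrable_acs ::
  "('a::topological_space, 'e::euclidean_space) chart set \<Rightarrow> ('a \<Rightarrow> 'e \<Rightarrow> 'e) \<Rightarrow> bool" where
  "integrable_acs A J \<longleftrightarrow>
     (\<forall>W X Y p. open W \<and> p \<in> W \<and> smooth_vf A W X \<and> smooth_vf A W Y \<longrightarrow>
        (let JX = (\<lambda>q. J q (X q)); JY = (\<lambda>q. J q (Y q)) in
           lie_bracket A JX JY p - J p (lie_bracket A JX Y p) - J p (lie_bracket A X JY p)
           - lie_bracket A X Y p = 0))"

definition hermitian_manifold ::
  "('a::{t2_space,second_countable_topology}, 'e::euclidean_space) chart set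
     \<Rightarrow> ('a \<Rightarrow> 'e \<Rightarrow> 'e \<Rightarrow> real) \<Rightarrow> ('a \<Rightarrow> 'e \<Rightarrow> 'e) \<Rightarrow> bool" where
  "hermitian_manifold A g J \<longleftrightarrow>
     smooth_manifold A \<and> riemannian_metric A g \<and>
     almost_complex_structure A J \<and> integrable_acs A J \<and>
     (\<forall>p u v. g p (J p u) (J p v) = g p u v)"

definition alternating3 :: "('e::real_vector \<Rightarrow> 'e \<Rightarrow> 'e \<Rightarrow> real) \<Rightarrow> bool" where
  "alternating3 t \<longleftrightarrow>
     (\<forall>u v. linear (t u v)) \<and> (\<forall>u v w. t u v w = - t v u w) \<and> (\<forall>u v w. t u v w = - t u w v)"

text \<open>The metric, complex connection with totally skew-symmetric torsion.\<close>

definition characteristic_connection ::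
  "('a::topological_space, 'e::euclidean_space) chart set \<Rightarrow> ('a \<Rightarrow> 'e \<Rightarrow> 'e \<Rightarrow> real)
     \<Rightarrow> ('a \<Rightarrow> 'e \<Rightarrow> 'e) \<Rightarrow> ('a, 'e) conn \<Rightarrow> bool" where
  "characteristic_connection A g J D \<longleftrightarrow>
     affine_connection A D \<and> parallel_form2 A D g \<and>
     (\<forall>W Y p v. open W \<and> p \<in> W \<and> smooth_vf A W Y \<longrightarrow>
        D p v (\<lambda>q. J q (Y q)) = J p (D p v Y)) \<and>
     (\<forall>p. alternating3 (torsion_form A g D p))"

definition nondegenerate_torsion ::
  "('a, 'e::euclidean_space) chart set \<Rightarrow> ('a, 'e) conn \<Rightarrow> bool" where
  "nondegenerate_torsion A D \<longleftrightarrow> (\<forall>p u. u \<noteq> 0 \<longrightarrow> (\<exists>v. torsion A D p u v \<noteq> 0))"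


section \<open>Parallel splittings of the tangent bundle\<close>

text \<open>The projection onto \<open>S\<close> along a complementary subspace \<open>S'\<close>.\<close>

definition proj_along :: "'e::real_vector set \<Rightarrow> 'e set \<Rightarrow> 'e \<Rightarrow> 'e" where
  "proj_along S S' v = (THE x. x \<in> S \<and> v - x \<in> S')"

definition smooth_splitting ::
  "('a::topological_space, 'e::euclidean_space) chart set \<Rightarrow> ('a \<Rightarrow> 'e set) \<Rightarrow> ('a \<Rightarrow> 'e set)
     \<Rightarrow> bool" where
  "smooth_splitting A H V \<longleftrightarrow>
     (\<forall>p. subspace (H p) \<and> subspace (V p) \<and> (\<forall>v. \<exists>!x. x \<in> H p \<and> v - x \<in> V p)) \<and>
     (\<forall>W X. open W \<and> smooth_vf A W X \<longrightarrow>
        smooth_vf A W (\<lambda>p. proj_along (H p) (V p) (X p)) \<and>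
        smooth_vf A W (\<lambda>p. proj_along (V p) (H p) (X p)))"

definition parallel_subbundle ::
  "('a::topological_space, 'e::euclidean_space) chart set \<Rightarrow> ('a, 'e) conn \<Rightarrow> ('a \<Rightarrow> 'e set)
     \<Rightarrow> bool" where
  "parallel_subbundle A D H \<longleftrightarrow>
     (\<forall>W Y p v. open W \<and> p \<in> W \<and> smooth_vf A W Y \<and> (\<forall>q\<in>W. Y q \<in> H q) \<longrightarrow> D p v Y \<in> H p)"

text \<open>
  The splitting expressing that the holonomy of \<open>D\<close> is contained in \<open>U(m) \<times> U(1)\<close>.
\<close>

definition parallel_unitary_splitting ::
  "('a::topological_space, 'e::euclidean_space) chart set \<Rightarrow> ('a \<Rightarrow> 'e \<Rightarrow> 'e \<Rightarrow> real)
     \<Rightarrow> ('a \<Rightarrow> 'e \<Rightarrow> 'e) \<Rightarrow> ('a, 'e) conn \<Rightarrow> nat \<Rightarrow> ('a \<Rightarrow> 'e set) \<Rightarrow> ('a \<Rightarrow> 'e set) \<Rightarrow> bool" where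
  "parallel_unitary_splitting A g J D m H V \<longleftrightarrow>
     smooth_splitting A H V \<and>
     (\<forall>p. dim (H p) = 2 * m \<and> dim (V p) = 2) \<and>
     (\<forall>p. \<forall>u\<in>H p. \<forall>v\<in>V p. g p u v = 0) \<and>
     (\<forall>p. J p ` H p \<subseteq> H p \<and> J p ` V p \<subseteq> V p) \<and>
     parallel_subbundle A D H \<and> parallel_subbundle A D V"

text \<open>The restriction of the bilinear form \<open>b\<close> to \<open>S\<close>, extended by zero on \<open>S'\<close>.\<close>

definition restrict_form ::
  "('e::real_vector \<Rightarrow> 'e \<Rightarrow> real) \<Rightarrow> 'e set \<Rightarrow> 'e set \<Rightarrow> 'e \<Rightarrow> 'e \<Rightarrow> real" where
  "restrict_form b S S' u v = b (proj_along S S' u) (proj_along S S' v)"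


section \<open>Complex forms on the summands of a splitting\<close>

text \<open>
  Complex forms on a real vector space are represented as complex-valued real-multilinear
  functions. The complex structure \<open>j\<close> preserves the summands \<open>S\<close> and \<open>S'\<close>; the spaces
  \<open>forms10 j S S'\<close> and \<open>forms01 j S S'\<close> are \<open>\<Lambda>\<^sup>1\<^sup>,\<^sup>0S\<^sup>*\<close> and \<open>\<Lambda>\<^sup>0\<^sup>,\<^sup>1S\<^sup>*\<close>, extended by zero on \<open>S'\<close>.
\<close>

definition forms10 :: "('e::real_vector \<Rightarrow> 'e) \<Rightarrow> 'e set \<Rightarrow> 'e set \<Rightarrow> ('e \<Rightarrow> complex) set" where
  "forms10 j S S' =
     {a. linear a \<and> (\<forall>v\<in>S'. a v = 0) \<and> (\<forall>v\<in>S. a (j v) = \<i> * a v)}"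

definition forms01 :: "('e::real_vector \<Rightarrow> 'e) \<Rightarrow> 'e set \<Rightarrow> 'e set \<Rightarrow> ('e \<Rightarrow> complex) set" where
  "forms01 j S S' =
     {a. linear a \<and> (\<forall>v\<in>S'. a v = 0) \<and> (\<forall>v\<in>S. a (j v) = - \<i> * a v)}"

definition wedge11 :: "('e \<Rightarrow> complex) \<Rightarrow> ('e \<Rightarrow> complex) \<Rightarrow> 'e \<Rightarrow> 'e \<Rightarrow> complex" where
  "wedge11 a b u v = a u * b v - a v * b u"

definition wedge21 :: "('e \<Rightarrow> 'e \<Rightarrow> complex) \<Rightarrow> ('e \<Rightarrow> complex) \<Rightarrow> 'e \<Rightarrow> 'e \<Rightarrow> 'e \<Rightarrow> complex" where
  "wedge21 h c u v w = h u v * c w + h v w * c u + h w u * c v"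

text \<open>
  The second exterior power of a complex vector space \<open>K\<close> of 1-forms, and the tensor product of
  complex vector spaces \<open>K2\<close> of 2-forms and \<open>K1\<close> of 1-forms, embedded in the 3-forms by the
  wedge product. Scalars are absorbed in the factors, so the complex linear span of the
  decomposable elements consists of their finite sums. In particular \<open>\<Lambda>\<^sup>2\<^sup>,\<^sup>0\<close> and \<open>\<Lambda>\<^sup>0\<^sup>,\<^sup>2\<close> are
  the second exterior powers of \<open>\<Lambda>\<^sup>1\<^sup>,\<^sup>0\<close> and \<open>\<Lambda>\<^sup>0\<^sup>,\<^sup>1\<close>.
\<close>

definition ext_square :: "('e \<Rightarrow> complex) set \<Rightarrow> ('e \<Rightarrow> 'e \<Rightarrow> complex) set" where
  "ext_square K =
     {h. \<exists>(N::nat) a b. (\<forall>i<N. a i \<in> K \<and> b i \<in> K) \<and>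
           h = (\<lambda>u v. \<Sum>i<N. wedge11 (a i) (b i) u v)}"

definition wedge_tensor ::
  "('e \<Rightarrow> 'e \<Rightarrow> complex) set \<Rightarrow> ('e \<Rightarrow> complex) set \<Rightarrow> ('e \<Rightarrow> 'e \<Rightarrow> 'e \<Rightarrow> complex) set" where
  "wedge_tensor K2 K1 =
     {t. \<exists>(N::nat) h c. (\<forall>i<N. h i \<in> K2 \<and> c i \<in> K1) \<and>
           t = (\<lambda>u v w. \<Sum>i<N. wedge21 (h i) (c i) u v w)}"

text \<open>
  \<open>\<Lambda>\<^sup>2\<^sup>,\<^sup>0S\<^sup>* \<otimes> \<Lambda>\<^sup>0\<^sup>,\<^sup>1S'\<^sup>* \<oplus> \<Lambda>\<^sup>0\<^sup>,\<^sup>2S\<^sup>* \<otimes> \<Lambda>\<^sup>1\<^sup>,\<^sup>0S'\<^sup>*\<close>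
\<close>

definition forms_20_01_02_10 ::
  "('e::real_vector \<Rightarrow> 'e) \<Rightarrow> 'e set \<Rightarrow> 'e set \<Rightarrow> ('e \<Rightarrow> 'e \<Rightarrow> 'e \<Rightarrow> complex) set" where
  "forms_20_01_02_10 j S S' =
     {t. \<exists>r \<in> wedge_tensor (ext_square (forms10 j S S')) (forms01 j S' S).
         \<exists>s \<in> wedge_tensor (ext_square (forms01 j S S')) (forms10 j S' S).
           t = (\<lambda>u v w. r u v w + s u v w)}"

end

theory Submission
  imports Defs
begin

text \<open>
  Changing the sign of \<open>J\<close> on \<open>\<V>\<close> gives a parallel orthogonal almost complex structure \<open>I\<close> for
  which the torsion has type \<open>(3,0) + (0,3)\<close>; the first Bianchi identity, decomposed into types
  with respect to \<open>I\<close>, then forces \<open>\<nabla>\<^sup>aT\<^sup>a = 0\<close>. For a unit vector \<open>v\<close> of \<open>\<V>\<close> the endomorphism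
  \<open>a = T\<^sup>a(v,\<cdot>)\<close> of \<open>\<H>\<close> is skew, anticommutes with \<open>J\<close> and is injective by non-degeneracy. The
  Bianchi identity determines \<open>R\<^sup>a(v, J v)\<close> on \<open>\<H>\<close> in terms of \<open>a\<^sup>2\<close>, and since this operator annihilates
  the parallel torsion, \<open>a\<^sup>2 = - \<lambda>\<close> with \<open>12 m \<lambda> = |T\<^sup>a|\<^sup>2\<close>. So \<open>J\<close> and \<open>a\<close> make \<open>\<H>\<close> a
  quaternionic space, and \<open>[R\<^sup>a(X,Y), a] = \<rho>(X,Y) J a\<close> together with a contraction of the Bianchi
  identity gives \<open>Ric\<^sup>a\<close> on \<open>\<H>\<close>. Finally \<open>Ric\<close> differs from \<open>Ric\<^sup>a\<close> by the quadratic torsion term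
  \<open>1/4 \<Sum>\<^sub>i g(T\<^sup>a(e\<^sub>i,\<cdot>), T\<^sup>a(e\<^sub>i,\<cdot>))\<close>.
\<close>


section \<open>Smooth functions on open sets\<close>

text \<open>Torsion and curvature are defined through the fields \<open>extend A p u\<close>,
  constant in one chart, and norms and traces through an arbitrarily selected frame. The analytic
  part removes the first choice: the expressions depend only on the values of the fields at the
  point, and the chosen fields commute, so bracket terms drop out. What remains is linear algebra in
  one tangent space, with one exception: parallel Ricci tensors need |T|^2 to be smooth with zero
  derivative, which a sum over selected frames does not show. So \<lambda> is recovered as
  |T(Y,X)|^2 / (|Y|^2 |X|^2) for local sections X of \<H> and Y of \<V>, to which the product rule
  applies. Constants: |T(x,.)|^2 is 4 \<lambda> |x|^2 on \<H> and 2 m \<lambda> |x|^2 on \<V>, so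
  the traces 2m and 2 give 12 m \<lambda>. The Levi-Civita Ricci tensor gains a quarter of these
  numbers, which turns the eigenvalues (m+2) \<lambda> and 4 \<lambda> of Ric^a into (m+3) \<lambda>
  and (4 + m/2) \<lambda>; they agree only for m = 2.\<close>

lemma Ck_on_cong:
  assumes "open S" "\<And>x. x \<in> S \<Longrightarrow> f x = g x"
  shows "Ck_on k S f \<longleftrightarrow> Ck_on k S g"
  using assms(2)
proof (induction k arbitrary: f g)
  case 0
  then show ?case by (simp cong: continuous_on_cong)
next
  case (Suc k)
  have d: "f differentiable (at x) \<longleftrightarrow> g differentiable (at x)" if "x \<in> S" for x
    using has_derivative_transform_within_open[OF _ assms(1) that, of f _ UNIV g]
      has_derivative_transform_within_open[OF _ assms(1) that, of g _ UNIV f] Suc.prems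
    by (auto simp: differentiable_def)
  have e: "frechet_derivative f (at x) = frechet_derivative g (at x)"
    if "x \<in> S" "f differentiable (at x)" for x
    using frechet_derivative_transform_within_open[OF that(2) assms(1) that(1)] Suc.prems by blast
  show ?case
  proof (cases "\<forall>x\<in>S. f differentiable (at x)")
    case True
    have "Ck_on k S (\<lambda>x. frechet_derivative f (at x) v) \<longleftrightarrow>
        Ck_on k S (\<lambda>x. frechet_derivative g (at x) v)" for v
      by (rule Suc.IH) (use True e in auto)
    then show ?thesis using True d by auto
  next
    case False
    then show ?thesis using d by auto
  qed
qed

lemma Ck_on_local:
  assumes "open S" "\<And>x. x \<in> S \<Longrightarrow> \<exists>T. open T \<and> x \<in> T \<and> Ck_on k (S \<inter> T) f"
  shows "Ck_on k S f"
  using assms(2)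
proof (induction k arbitrary: f)
  case 0
  then show ?case
    using assms(1) by (simp add: continuous_on_eq_continuous_at) (metis IntI continuous_on_eq_continuous_at open_Int)
next
  case (Suc k)
  then show ?case by simp (meson IntI)
qed

lemma Ck_on_subset: "Ck_on k S f \<Longrightarrow> T \<subseteq> S \<Longrightarrow> Ck_on k T f"
  by (induction k arbitrary: f) (auto intro: continuous_on_subset)

lemma Ck_on_Suc_imp: "Ck_on (Suc k) S f \<Longrightarrow> Ck_on k S f"
proof (induction k arbitrary: f)
  case 0
  then show ?case
    by (auto intro!: continuous_at_imp_continuous_on differentiable_imp_continuous_within)
qed auto

text \<open>Shifting the order by one in both directions gives a form in which smooth functions can
  be differentiated repeatedly without keeping track of \<open>k\<close>.\<close>

lemma smooth_on_iff:
  "smooth_on S f \<longleftrightarrow> (\<forall>x\<in>S. f differentiable (at x)) \<and>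
     (\<forall>v. smooth_on S (\<lambda>x. frechet_derivative f (at x) v))" (is "_ \<longleftrightarrow> ?R")
proof
  assume "smooth_on S f"
  then have "Ck_on (Suc k) S f" for k
    unfolding smooth_on_def by blast
  then show ?R
    unfolding smooth_on_def by auto
next
  assume R: ?R
  have "Ck_on k S f" for k
    by (rule Ck_on_Suc_imp) (use R in \<open>simp add: smooth_on_def\<close>)
  then show "smooth_on S f"
    unfolding smooth_on_def by blast
qed

lemma smooth_on_differentiable: "smooth_on S f \<Longrightarrow> x \<in> S \<Longrightarrow> f differentiable (at x)"
  using smooth_on_iff by blast

lemma smooth_on_frechet_derivative:
  "smooth_on S f \<Longrightarrow> smooth_on S (\<lambda>x. frechet_derivative f (at x) v)"
  using smooth_on_iff by blast

lemma smooth_on_continuous_on: "smooth_on S f \<Longrightarrow> continuous_on S f"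
  unfolding smooth_on_def using Ck_on.simps(1) by blast

lemma smooth_on_cong:
  "open S \<Longrightarrow> (\<And>x. x \<in> S \<Longrightarrow> f x = g x) \<Longrightarrow> smooth_on S f \<longleftrightarrow> smooth_on S g"
  unfolding smooth_on_def using Ck_on_cong[of S f g] by blast

lemma smooth_on_subset: "smooth_on S f \<Longrightarrow> T \<subseteq> S \<Longrightarrow> smooth_on T f"
  unfolding smooth_on_def using Ck_on_subset by blast

lemma smooth_on_local:
  assumes "open S" "\<And>x. x \<in> S \<Longrightarrow> \<exists>T. open T \<and> x \<in> T \<and> smooth_on (S \<inter> T) f"
  shows "smooth_on S f"
  using assms Ck_on_local[OF assms(1)] unfolding smooth_on_def by meson

section \<open>Algebraic operations on smooth functions and composition\<close>

lemma Ck_on_const: "Ck_on k S (\<lambda>x. c)"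
  by (induction k arbitrary: c) auto

lemma smooth_on_const: "smooth_on S (\<lambda>x. c)"
  by (simp add: smooth_on_def Ck_on_const)

lemma Ck_on_bounded_linear_comp:
  assumes L: "bounded_linear L" and S: "open S"
  shows "Ck_on k S f \<Longrightarrow> Ck_on k S (\<lambda>x. L (f x))"
proof (induction k arbitrary: f)
  case 0
  then show ?case using bounded_linear.continuous_on[OF L] by simp
next
  case (Suc k)
  have h: "((\<lambda>y. L (f y)) has_derivative (\<lambda>v. L (frechet_derivative f (at x) v))) (at x)" if "x \<in> S" for x
    using Suc.prems that
    by (intro bounded_linear.has_derivative[OF L]) (simp flip: frechet_derivative_works)
  have "Ck_on k S (\<lambda>x. frechet_derivative (\<lambda>x. L (f x)) (at x) v)" for v
  proof (subst Ck_on_cong[OF S])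
    show "frechet_derivative (\<lambda>x. L (f x)) (at x) v = L (frechet_derivative f (at x) v)" if "x \<in> S" for x
      using frechet_derivative_at[OF h[OF that]] by metis
    show "Ck_on k S (\<lambda>x. L (frechet_derivative f (at x) v))"
      by (rule Suc.IH) (use Suc.prems in simp)
  qed
  then show ?case using h by (auto simp: differentiable_def)
qed

lemma Ck_on_add:
  assumes S: "open S"
  shows "Ck_on k S f \<Longrightarrow> Ck_on k S g \<Longrightarrow> Ck_on k S (\<lambda>x. f x + g x)"
proof (induction k arbitrary: f g)
  case 0
  then show ?case by (simp add: continuous_on_add)
next
  case (Suc k)
  have h: "((\<lambda>y. f y + g y) has_derivative
      (\<lambda>v. frechet_derivative f (at x) v + frechet_derivative g (at x) v)) (at x)" if "x \<in> S" for x
    using Suc.prems that by (intro has_derivative_add) (simp_all flip: frechet_derivative_works)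
  have "Ck_on k S (\<lambda>x. frechet_derivative (\<lambda>y. f y + g y) (at x) v)" for v
  proof (subst Ck_on_cong[OF S])
    show "frechet_derivative (\<lambda>y. f y + g y) (at x) v =
        frechet_derivative f (at x) v + frechet_derivative g (at x) v" if "x \<in> S" for x
      using frechet_derivative_at[OF h[OF that]] by metis
    show "Ck_on k S (\<lambda>x. frechet_derivative f (at x) v + frechet_derivative g (at x) v)"
      by (rule Suc.IH) (use Suc.prems in simp_all)
  qed
  then show ?case using h by (auto simp: differentiable_def)
qed

lemma Ck_on_bilinear:
  assumes B: "bounded_bilinear B" and S: "open S"
  shows "Ck_on k S f \<Longrightarrow> Ck_on k S g \<Longrightarrow> Ck_on k S (\<lambda>x. B (f x) (g x))"
proof (induction k arbitrary: f g)
  case 0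
  then show ?case using bounded_bilinear.continuous_on[OF B] by simp
next
  case (Suc k)
  have h: "((\<lambda>y. B (f y) (g y)) has_derivative
      (\<lambda>v. B (f x) (frechet_derivative g (at x) v) + B (frechet_derivative f (at x) v) (g x))) (at x)"
    if "x \<in> S" for x
    using Suc.prems that
    by (intro bounded_bilinear.FDERIV[OF B]) (simp_all flip: frechet_derivative_works)
  have "Ck_on k S (\<lambda>x. frechet_derivative (\<lambda>y. B (f y) (g y)) (at x) v)" for v
  proof (subst Ck_on_cong[OF S])
    show "frechet_derivative (\<lambda>y. B (f y) (g y)) (at x) v =
        B (f x) (frechet_derivative g (at x) v) + B (frechet_derivative f (at x) v) (g x)"
      if "x \<in> S" for x
      using frechet_derivative_at[OF h[OF that]] by metis
    \<comment> \<open>Each summand pairs a derivative, of order \<open>k\<close>, with an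
      undifferentiated factor, of order \<open>Suc k\<close>, which \<open>Ck_on_Suc_imp\<close>
      lowers to \<open>k\<close>.\<close>
    show "Ck_on k S (\<lambda>x. B (f x) (frechet_derivative g (at x) v) + B (frechet_derivative f (at x) v) (g x))"
      by (rule Ck_on_add[OF S]; rule Suc.IH)
        (use Suc.prems Ck_on_Suc_imp[OF Suc.prems(1)] Ck_on_Suc_imp[OF Suc.prems(2)] in simp_all)
  qed
  then show ?case using h by (auto simp: differentiable_def)
qed

lemma smooth_on_bounded_linear_comp:
  "bounded_linear L \<Longrightarrow> open S \<Longrightarrow> smooth_on S f \<Longrightarrow> smooth_on S (\<lambda>x. L (f x))"
  by (simp add: smooth_on_def Ck_on_bounded_linear_comp)

lemma smooth_on_add:
  "open S \<Longrightarrow> smooth_on S f \<Longrightarrow> smooth_on S g \<Longrightarrow> smooth_on S (\<lambda>x. f x + g x)"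
  by (simp add: smooth_on_def Ck_on_add)

lemma smooth_on_bilinear:
  "bounded_bilinear B \<Longrightarrow> open S \<Longrightarrow> smooth_on S f \<Longrightarrow> smooth_on S g \<Longrightarrow>
    smooth_on S (\<lambda>x. B (f x) (g x))"
  by (simp add: smooth_on_def Ck_on_bilinear)

lemmas smooth_on_scaleR = smooth_on_bilinear[OF bounded_bilinear_scaleR]
lemmas smooth_on_mult = smooth_on_bilinear[OF bounded_bilinear_mult]

lemma smooth_on_sum:
  "open S \<Longrightarrow> (\<And>i. i \<in> I \<Longrightarrow> smooth_on S (f i)) \<Longrightarrow> smooth_on S (\<lambda>x. \<Sum>i\<in>I. f i x)"
  by (induction I rule: infinite_finite_induct) (auto simp: smooth_on_const intro!: smooth_on_add)

text \<open>The derivative of 1/f is a product of the derivative of f and two copies of 1/f. With f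
  smooth to all orders, the induction hypothesis for the same function 1/f covers both
  copies.\<close>

lemma Ck_on_inverse:
  fixes f :: "'e::euclidean_space \<Rightarrow> real"
  assumes S: "open S" and f: "smooth_on S f" and nz: "\<And>x. x \<in> S \<Longrightarrow> f x \<noteq> 0"
  shows "Ck_on k S (\<lambda>x. inverse (f x))"
proof (induction k)
  case 0
  then show ?case
    using smooth_on_continuous_on[OF f] nz by (simp add: continuous_on_inverse)
next
  case (Suc k)
  have h: "((\<lambda>y. inverse (f y)) has_derivative
      (\<lambda>v. - (inverse (f x) * frechet_derivative f (at x) v * inverse (f x)))) (at x)" if "x \<in> S" for x
    using smooth_on_differentiable[OF f that] nz[OF that]
    by (intro Deriv.has_derivative_inverse) (simp_all flip: frechet_derivative_works)
  have "Ck_on k S (\<lambda>x. frechet_derivative (\<lambda>y. inverse (f y)) (at x) v)" for v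
  proof (subst Ck_on_cong[OF S])
    show "frechet_derivative (\<lambda>y. inverse (f y)) (at x) v =
        - (inverse (f x) * frechet_derivative f (at x) v * inverse (f x))" if "x \<in> S" for x
      using frechet_derivative_at[OF h[OF that]] by metis
    show "Ck_on k S (\<lambda>x. - (inverse (f x) * frechet_derivative f (at x) v * inverse (f x)))"
      by (intro Ck_on_bounded_linear_comp[OF bounded_linear_minus[OF bounded_linear_ident] S]
          Ck_on_bilinear[OF bounded_bilinear_mult S] Suc.IH)
        (use smooth_on_frechet_derivative[OF f] in \<open>simp add: smooth_on_def\<close>)
  qed
  then show ?case using h by (auto simp: differentiable_def)
qed

lemma smooth_on_divide:
  fixes f :: "'e::euclidean_space \<Rightarrow> real"
  assumes "open S" "smooth_on S f" "smooth_on S h" "\<And>x. x \<in> S \<Longrightarrow> h x \<noteq> 0"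
  shows "smooth_on S (\<lambda>x. f x / h x)"
proof -
  have "smooth_on S (\<lambda>x. inverse (h x))"
    using Ck_on_inverse[OF assms(1,3,4)] by (simp add: smooth_on_def)
  then show ?thesis
    unfolding divide_inverse by (rule smooth_on_mult[OF assms(1,2)])
qed

lemma linear_Basis_expansion:
  fixes L :: "'e::euclidean_space \<Rightarrow> 'f::real_vector"
  assumes "linear L"
  shows "L w = (\<Sum>b\<in>Basis. (w \<bullet> b) *\<^sub>R L b)"
  using linear_sum[OF assms, of "\<lambda>b. (w \<bullet> b) *\<^sub>R b" Basis]
  by (simp add: linear_scale[OF assms] euclidean_representation)

text \<open>\<open>Ck_on\<close> controls derivatives in fixed directions only, whereas the chain
  rule evaluates the derivative of h in the moving direction Df(x) v. Expanding this direction in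
  \<open>Basis\<close> gives a finite sum of products to which the induction hypothesis
  applies.\<close>

lemma Ck_on_compose:
  fixes f :: "'e::euclidean_space \<Rightarrow> 'f::euclidean_space"
  assumes S: "open S" and T: "open T" and fST: "f ` S \<subseteq> T" and f: "smooth_on S f"
  shows "Ck_on k T h \<Longrightarrow> Ck_on k S (h \<circ> f)"
proof (induction k arbitrary: h)
  case 0
  then show ?case
    using continuous_on_compose[OF smooth_on_continuous_on[OF f] continuous_on_subset[OF _ fST]] by simp
next
  case (Suc k)
  have df: "f differentiable (at x)" if "x \<in> S" for x
    using smooth_on_differentiable[OF f that] .
  have dh: "h differentiable (at (f x))" if "x \<in> S" for x
    using Suc.prems fST that by auto
  have "Ck_on k S (\<lambda>x. frechet_derivative (h \<circ> f) (at x) v)" for v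
  proof (subst Ck_on_cong[OF S])
    show "frechet_derivative (h \<circ> f) (at x) v =
      (\<Sum>b\<in>Basis. (frechet_derivative f (at x) v \<bullet> b) *\<^sub>R ((\<lambda>y. frechet_derivative h (at y) b) \<circ> f) x)"
      if "x \<in> S" for x
    proof -
      have lin: "linear (frechet_derivative h (at (f x)))"
        using dh[OF that] by (simp add: linear_frechet_derivative)
      show ?thesis
        unfolding frechet_derivative_compose[OF df[OF that] dh[OF that]]
        unfolding comp_def by (rule linear_Basis_expansion[OF lin])
    qed
    have "Ck_on k S (\<lambda>x. \<Sum>b\<in>I. (frechet_derivative f (at x) v \<bullet> b) *\<^sub>R ((\<lambda>y. frechet_derivative h (at y) b) \<circ> f) x)"
      if "finite I" for I
      using that
    proof (induction I rule: finite_induct)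
      case empty
      then show ?case by (simp add: Ck_on_const)
    next
      case (insert b I)
      have 1: "Ck_on k S ((\<lambda>y. frechet_derivative h (at y) b) \<circ> f)"
        by (rule Suc.IH) (use Suc.prems in simp)
      have 2: "Ck_on k S (\<lambda>x. frechet_derivative f (at x) v \<bullet> b)"
        by (rule Ck_on_bounded_linear_comp[OF bounded_linear_inner_left S])
          (use smooth_on_frechet_derivative[OF f] in \<open>simp add: smooth_on_def\<close>)
      show ?case
        unfolding sum.insert[OF insert.hyps]
        by (intro Ck_on_add[OF S] Ck_on_bilinear[OF bounded_bilinear_scaleR S] 1 2 insert.IH)
    qed
    then show "Ck_on k S (\<lambda>x. \<Sum>b\<in>Basis. (frechet_derivative f (at x) v \<bullet> b) *\<^sub>R ((\<lambda>y. frechet_derivative h (at y) b) \<circ> f) x)"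
      by simp
  qed
  then show ?case using df dh by (simp del: o_apply add: differentiable_chain_at comp_def[symmetric])
qed

lemma smooth_on_compose:
  fixes f :: "'e::euclidean_space \<Rightarrow> 'f::euclidean_space"
  assumes "open S" "open T" "f ` S \<subseteq> T" "smooth_on S f" "smooth_on T h"
  shows "smooth_on S (h \<circ> f)"
  using assms by (simp add: smooth_on_def Ck_on_compose[OF assms(1-4)])


subsection \<open>Symmetry of second derivatives\<close>

lemma has_derivative_line:
  fixes f :: "'e::euclidean_space \<Rightarrow> real"
  assumes "f differentiable (at (x + t *\<^sub>R u))"
  shows "((\<lambda>t. f (x + t *\<^sub>R u)) has_real_derivative frechet_derivative f (at (x + t *\<^sub>R u)) u) (at t)"
proof -
  have 1: "((\<lambda>t. x + t *\<^sub>R u) has_derivative (\<lambda>s. s *\<^sub>R u)) (at t)"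
    by (auto intro!: derivative_eq_intros)
  have 2: "(f has_derivative frechet_derivative f (at (x + t *\<^sub>R u))) (at (x + t *\<^sub>R u))"
    using assms frechet_derivative_works by blast
  have "((\<lambda>t. f (x + t *\<^sub>R u)) has_derivative
      (\<lambda>s. frechet_derivative f (at (x + t *\<^sub>R u)) (s *\<^sub>R u))) (at t)"
    using diff_chain_at[OF 1 2] by (simp add: comp_def)
  moreover have "linear (frechet_derivative f (at (x + t *\<^sub>R u)))"
    using assms by (simp add: linear_frechet_derivative)
  ultimately show ?thesis
    by (simp add: has_field_derivative_def linear_scale mult_commute_abs)
qed

text \<open>The mean value theorem is used twice: in direction u for the difference of f between two
  parallel segments, then in direction v for the resulting derivative. The left-hand side is
  symmetric in u and v, which is the point of the expression.\<close>

lemma second_difference_mean_value: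
  fixes f :: "'e::euclidean_space \<Rightarrow> real"
  assumes h: "h > 0"
    and S: "\<And>s t. 0 \<le> s \<Longrightarrow> s \<le> h \<Longrightarrow> 0 \<le> t \<Longrightarrow> t \<le> h \<Longrightarrow> x + s *\<^sub>R u + t *\<^sub>R v \<in> S"
    and f: "smooth_on S f"
  shows "\<exists>s t. 0 < s \<and> s < h \<and> 0 < t \<and> t < h \<and>
    f (x + h *\<^sub>R u + h *\<^sub>R v) - f (x + h *\<^sub>R u) - f (x + h *\<^sub>R v) + f x =
      h\<^sup>2 * frechet_derivative (\<lambda>y. frechet_derivative f (at y) u) (at (x + s *\<^sub>R u + t *\<^sub>R v)) v"
proof -
  have df: "f differentiable (at (x + s *\<^sub>R u + t *\<^sub>R v))" if "0 \<le> s" "s \<le> h" "0 \<le> t" "t \<le> h" for s t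
    using smooth_on_differentiable[OF f S[OF that]] .
  have dfu: "(\<lambda>y. frechet_derivative f (at y) u) differentiable (at (x + s *\<^sub>R u + t *\<^sub>R v))"
    if "0 \<le> s" "s \<le> h" "0 \<le> t" "t \<le> h" for s t
    using smooth_on_differentiable[OF smooth_on_frechet_derivative[OF f] S[OF that]] .
  have "\<exists>s. 0 < s \<and> s < h \<and> (f (x + h *\<^sub>R v + h *\<^sub>R u) - f (x + h *\<^sub>R u))
      - (f (x + h *\<^sub>R v + 0 *\<^sub>R u) - f (x + 0 *\<^sub>R u))
      = (h - 0) * (frechet_derivative f (at (x + h *\<^sub>R v + s *\<^sub>R u)) u - frechet_derivative f (at (x + s *\<^sub>R u)) u)"
  proof (rule MVT2[where f = "\<lambda>s. f (x + h *\<^sub>R v + s *\<^sub>R u) - f (x + s *\<^sub>R u)"])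
    fix s :: real assume s: "0 \<le> s" "s \<le> h"
    have "f differentiable (at (x + h *\<^sub>R v + s *\<^sub>R u))" "f differentiable (at (x + s *\<^sub>R u))"
      using df[of s h] df[of s 0] s h by (simp_all add: algebra_simps)
    then show "((\<lambda>s. f (x + h *\<^sub>R v + s *\<^sub>R u) - f (x + s *\<^sub>R u)) has_real_derivative
        frechet_derivative f (at (x + h *\<^sub>R v + s *\<^sub>R u)) u - frechet_derivative f (at (x + s *\<^sub>R u)) u) (at s)"
      by (intro DERIV_diff has_derivative_line)
  qed (use h in auto)
  then obtain s where s: "0 < s" "s < h" and
    es: "f (x + h *\<^sub>R u + h *\<^sub>R v) - f (x + h *\<^sub>R u) - f (x + h *\<^sub>R v) + f x =
      h * (frechet_derivative f (at (x + s *\<^sub>R u + h *\<^sub>R v)) u - frechet_derivative f (at (x + s *\<^sub>R u)) u)"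
    by (auto simp: algebra_simps)
  have "\<exists>t. 0 < t \<and> t < h \<and>
      frechet_derivative f (at (x + s *\<^sub>R u + h *\<^sub>R v)) u - frechet_derivative f (at (x + s *\<^sub>R u + 0 *\<^sub>R v)) u
      = (h - 0) * frechet_derivative (\<lambda>y. frechet_derivative f (at y) u) (at (x + s *\<^sub>R u + t *\<^sub>R v)) v"
    by (rule MVT2[where f = "\<lambda>t. frechet_derivative f (at (x + s *\<^sub>R u + t *\<^sub>R v)) u"])
      (use h s in \<open>auto intro!: has_derivative_line dfu\<close>)
  then obtain t where t: "0 < t" "t < h" and
    et: "frechet_derivative f (at (x + s *\<^sub>R u + h *\<^sub>R v)) u - frechet_derivative f (at (x + s *\<^sub>R u)) u
      = h * frechet_derivative (\<lambda>y. frechet_derivative f (at y) u) (at (x + s *\<^sub>R u + t *\<^sub>R v)) v"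
    by auto
  show ?thesis
    using s t es et by (intro exI[of _ s] exI[of _ t]) (simp add: power2_eq_square)
qed

text \<open>Both mixed derivatives, taken at suitable points near x, equal the same second
  difference divided by h^2. A gap between their values at x would survive near x by
  continuity.\<close>

lemma symmetric_second_derivative_real:
  fixes f :: "'e::euclidean_space \<Rightarrow> real"
  assumes S: "open S" "x \<in> S" and f: "smooth_on S f"
  shows "frechet_derivative (\<lambda>y. frechet_derivative f (at y) u) (at x) v =
    frechet_derivative (\<lambda>y. frechet_derivative f (at y) v) (at x) u"
proof (rule ccontr)
  define F where "F u v = (\<lambda>z. frechet_derivative (\<lambda>y. frechet_derivative f (at y) u) (at z) v)" for u v
  assume "\<not> ?thesis"
  then have ne: "\<bar>F u v x - F v u x\<bar> > 0" by (simp add: F_def)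
  define e where "e = \<bar>F u v x - F v u x\<bar> / 2"
  have e: "e > 0" using ne by (simp add: e_def)
  have "continuous_on S (F u v)" "continuous_on S (F v u)"
    unfolding F_def by (intro smooth_on_continuous_on smooth_on_frechet_derivative f)+
  then have "isCont (F u v) x" "isCont (F v u) x"
    using S continuous_on_eq_continuous_at by blast+
  then obtain d1 d2 where d: "d1 > 0" "d2 > 0"
    and d1: "\<And>z. dist z x < d1 \<Longrightarrow> dist (F u v z) (F u v x) < e"
    and d2: "\<And>z. dist z x < d2 \<Longrightarrow> dist (F v u z) (F v u x) < e"
    unfolding continuous_at_eps_delta using e by (metis dist_commute)
  obtain d3 where d3: "d3 > 0" "ball x d3 \<subseteq> S"
    using S openE by blast
  define \<delta> where "\<delta> = Min {d1, d2, d3}"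
  have \<delta>: "\<delta> > 0" "\<delta> \<le> d1" "\<delta> \<le> d2" "\<delta> \<le> d3"
    using d d3 by (auto simp: \<delta>_def)
  \<comment> \<open>The summand 1 keeps \<open>K\<close> positive when u = v = 0. With
    \<open>h * K < \<delta>\<close> the parallelogram with sides h u and h v stays in the
    \<delta>-ball.\<close>
  define K where "K = norm u + norm v + 1"
  have K: "K > 0" by (simp add: K_def add_nonneg_pos)
  define h where "h = \<delta> / K / 2"
  have h: "h > 0" using \<delta> K by (simp add: h_def)
  have hK: "h * K < \<delta>" using \<delta> K by (simp add: h_def)
  have near: "dist (x + s *\<^sub>R u + t *\<^sub>R v) x < \<delta>" if "0 \<le> s" "s \<le> h" "0 \<le> t" "t \<le> h" for s t
  proof -
    have "dist (x + s *\<^sub>R u + t *\<^sub>R v) x = norm (s *\<^sub>R u + t *\<^sub>R v)"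
      by (simp add: dist_norm)
    also have "\<dots> \<le> norm (s *\<^sub>R u) + norm (t *\<^sub>R v)" by (rule norm_triangle_ineq)
    also have "\<dots> \<le> h * norm u + h * norm v"
      using that by (simp add: add_mono mult_right_mono)
    also have "\<dots> \<le> h * K" using h by (simp add: K_def algebra_simps)
    finally show ?thesis using hK by simp
  qed
  have near': "dist (x + s *\<^sub>R v + t *\<^sub>R u) x < \<delta>" if "0 \<le> s" "s \<le> h" "0 \<le> t" "t \<le> h" for s t
    using near[of t s] that by (simp add: algebra_simps)
  have inS: "z \<in> S" if "dist z x < \<delta>" for z
    using that d3 \<delta> by (auto simp: dist_commute)
  obtain s t where 1: "0 < s" "s < h" "0 < t" "t < h" and
    e1: "f (x + h *\<^sub>R u + h *\<^sub>R v) - f (x + h *\<^sub>R u) - f (x + h *\<^sub>R v) + f x = h\<^sup>2 * F u v (x + s *\<^sub>R u + t *\<^sub>R v)"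
    unfolding F_def using second_difference_mean_value[OF h inS[OF near] f] by blast
  obtain s' t' where 2: "0 < s'" "s' < h" "0 < t'" "t' < h" and
    e2: "f (x + h *\<^sub>R v + h *\<^sub>R u) - f (x + h *\<^sub>R v) - f (x + h *\<^sub>R u) + f x = h\<^sup>2 * F v u (x + s' *\<^sub>R v + t' *\<^sub>R u)"
    unfolding F_def using second_difference_mean_value[OF h inS[OF near'] f] by blast
  have "h\<^sup>2 * F u v (x + s *\<^sub>R u + t *\<^sub>R v) = h\<^sup>2 * F v u (x + s' *\<^sub>R v + t' *\<^sub>R u)"
    unfolding e1[symmetric] e2[symmetric] by (simp add: algebra_simps)
  then have eq: "F u v (x + s *\<^sub>R u + t *\<^sub>R v) = F v u (x + s' *\<^sub>R v + t' *\<^sub>R u)"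
    using h by simp
  have "dist (F u v (x + s *\<^sub>R u + t *\<^sub>R v)) (F u v x) < e"
    by (rule d1) (use near[of s t] 1 \<delta> in auto)
  moreover have "dist (F v u (x + s' *\<^sub>R v + t' *\<^sub>R u)) (F v u x) < e"
    by (rule d2) (use near'[of s' t'] 2 \<delta> in auto)
  ultimately show False
    unfolding eq e_def by (simp add: dist_real_def abs_if split: if_splits)
qed

lemma symmetric_second_derivative:
  fixes f :: "'e::euclidean_space \<Rightarrow> 'f::euclidean_space"
  assumes S: "open S" "x \<in> S" and f: "smooth_on S f"
  shows "frechet_derivative (\<lambda>y. frechet_derivative f (at y) u) (at x) v =
    frechet_derivative (\<lambda>y. frechet_derivative f (at y) v) (at x) u"
proof (rule euclidean_eqI)
  fix b :: 'f
  have D: "frechet_derivative (\<lambda>y. h y \<bullet> b) (at z) w = frechet_derivative h (at z) w \<bullet> b"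
    if "smooth_on S h" "z \<in> S" for h :: "'e \<Rightarrow> 'f" and z w
  proof -
    have "((\<lambda>y. h y \<bullet> b) has_derivative (\<lambda>w. frechet_derivative h (at z) w \<bullet> b)) (at z)"
      using smooth_on_differentiable[OF that] frechet_derivative_works has_derivative_inner_left by blast
    from frechet_derivative_at[OF this] show ?thesis by metis
  qed
  have "frechet_derivative (\<lambda>y. frechet_derivative f (at y) u) (at x) v \<bullet> b =
      frechet_derivative (\<lambda>y. frechet_derivative (\<lambda>y. f y \<bullet> b) (at y) u) (at x) v" for u v
  proof -
    have "frechet_derivative (\<lambda>y. frechet_derivative f (at y) u) (at x) v \<bullet> b =
        frechet_derivative (\<lambda>y. frechet_derivative f (at y) u \<bullet> b) (at x) v"
      by (rule D[symmetric]) (use S smooth_on_frechet_derivative[OF f] in auto)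
    also have "\<dots> = frechet_derivative (\<lambda>y. frechet_derivative (\<lambda>y. f y \<bullet> b) (at y) u) (at x) v"
    proof (rule fun_cong[OF frechet_derivative_transform_within_open])
      show "(\<lambda>y. frechet_derivative f (at y) u \<bullet> b) differentiable at x"
        using smooth_on_differentiable[OF smooth_on_bounded_linear_comp[OF bounded_linear_inner_left S(1)
              smooth_on_frechet_derivative[OF f]] S(2)] .
    qed (use S D[OF f] in auto)
    finally show ?thesis .
  qed
  then show "frechet_derivative (\<lambda>y. frechet_derivative f (at y) u) (at x) v \<bullet> b =
      frechet_derivative (\<lambda>y. frechet_derivative f (at y) v) (at x) u \<bullet> b"
    using symmetric_second_derivative_real[OF S smooth_on_bounded_linear_comp[OF bounded_linear_inner_left S(1) f]]
    by simp
qed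


section \<open>Functions and vector fields on a manifold\<close>

abbreviation chart_deriv :: "('a, 'e::euclidean_space) chart \<Rightarrow> ('a, 'e) chart \<Rightarrow> 'a \<Rightarrow> 'e \<Rightarrow> 'e" where
  "chart_deriv c d p \<equiv> frechet_derivative (coords d \<circ> inv_coords c) (at (coords c p))"

locale atlas =
  fixes A :: "('a::topological_space, 'e::euclidean_space) chart set"
  assumes smooth_atlas: "smooth_atlas A"
begin

lemma chart_at: "chart_at A p \<in> A" "p \<in> dom_of (chart_at A p)"
proof -
  have "\<exists>c. c \<in> A \<and> p \<in> dom_of c"
    using smooth_atlas unfolding smooth_atlas_def by blast
  then have "chart_at A p \<in> A \<and> p \<in> dom_of (chart_at A p)"
    unfolding chart_at_def by (rule someI_ex)
  then show "chart_at A p \<in> A" "p \<in> dom_of (chart_at A p)" by auto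
qed

lemma chart_homeomorphism:
  "c \<in> A \<Longrightarrow> homeomorphism (dom_of c) (coords c ` dom_of c) (coords c) (inv_coords c)"
  using smooth_atlas by (auto simp: smooth_atlas_def is_chart_def)

lemma open_dom: "c \<in> A \<Longrightarrow> open (dom_of c)"
  using smooth_atlas by (auto simp: smooth_atlas_def is_chart_def)

lemma inv_coords_coords [simp]: "c \<in> A \<Longrightarrow> p \<in> dom_of c \<Longrightarrow> inv_coords c (coords c p) = p"
  using chart_homeomorphism homeomorphism_apply1 by blast

lemma open_coords_image:
  assumes "c \<in> A" "open W" "W \<subseteq> dom_of c"
  shows "open (coords c ` W)"
proof -
  have "openin (top_of_set (coords c ` dom_of c)) (coords c ` W)"
    using homeomorphism_imp_open_map[OF chart_homeomorphism[OF assms(1)]] assms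
    by (simp add: openin_open_eq open_dom)
  moreover have "open (coords c ` dom_of c)"
    using smooth_atlas assms(1) by (auto simp: smooth_atlas_def is_chart_def)
  ultimately show ?thesis by (simp add: openin_open_eq)
qed

lemma open_coords_image_Int: "c \<in> A \<Longrightarrow> open W \<Longrightarrow> open (coords c ` (W \<inter> dom_of c))"
  by (rule open_coords_image) (auto simp: open_dom)

lemma smooth_transition:
  "c \<in> A \<Longrightarrow> d \<in> A \<Longrightarrow> smooth_on (coords c ` (dom_of c \<inter> dom_of d)) (coords d \<circ> inv_coords c)"
  using smooth_atlas by (auto simp: smooth_atlas_def)

lemma open_overlap: "c \<in> A \<Longrightarrow> d \<in> A \<Longrightarrow> open (coords c ` (dom_of c \<inter> dom_of d))"
  by (rule open_coords_image) (auto simp: open_dom)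

lemma transition_differentiable:
  "c \<in> A \<Longrightarrow> d \<in> A \<Longrightarrow> p \<in> dom_of c \<Longrightarrow> p \<in> dom_of d \<Longrightarrow>
    (coords d \<circ> inv_coords c) differentiable (at (coords c p))"
  using smooth_on_differentiable[OF smooth_transition] by blast

lemma linear_chart_deriv:
  "c \<in> A \<Longrightarrow> d \<in> A \<Longrightarrow> p \<in> dom_of c \<Longrightarrow> p \<in> dom_of d \<Longrightarrow> linear (chart_deriv c d p)"
  by (rule linear_frechet_derivative[OF transition_differentiable])

text \<open>The one chain rule behind all changes of chart: \<open>h\<close> and \<open>k\<close>
  express the same object in the charts \<open>d\<close> and \<open>c\<close>. Agreement on the
  overlap suffices because its coordinate image is open. It is applied to functions, to components
  of fields and to transition maps.\<close>

lemma chart_deriv_compose: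
  assumes "c \<in> A" "d \<in> A" "p \<in> dom_of c" "p \<in> dom_of d"
    and h: "h differentiable (at (coords d p))"
    and eq: "\<And>q. q \<in> dom_of c \<Longrightarrow> q \<in> dom_of d \<Longrightarrow> k (coords c q) = h (coords d q)"
  shows "k differentiable (at (coords c p))"
    "frechet_derivative k (at (coords c p)) v = frechet_derivative h (at (coords d p)) (chart_deriv c d p v)"
proof -
  let ?t = "coords d \<circ> inv_coords c"
  have t: "?t differentiable (at (coords c p))" "?t (coords c p) = coords d p"
    using assms by (simp_all add: transition_differentiable del: o_apply) simp
  have D: "((h \<circ> ?t) has_derivative frechet_derivative h (at (coords d p)) \<circ> chart_deriv c d p) (at (coords c p))"
    using diff_chain_at[of ?t _ "coords c p" h] t h by (simp flip: frechet_derivative_works)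
  have D: "(k has_derivative frechet_derivative h (at (coords d p)) \<circ> chart_deriv c d p) (at (coords c p))"
    by (rule has_derivative_transform_within_open[OF D open_overlap[OF assms(1,2)]])
      (use assms in auto)
  then show "k differentiable (at (coords c p))" by (auto simp: differentiable_def)
  show "frechet_derivative k (at (coords c p)) v = frechet_derivative h (at (coords d p)) (chart_deriv c d p v)"
    using fun_cong[OF frechet_derivative_at[OF D, symmetric], of v] by simp
qed

lemma chart_deriv_chart_deriv:
  assumes "c \<in> A" "d \<in> A" "e \<in> A" "p \<in> dom_of c" "p \<in> dom_of d" "p \<in> dom_of e"
  shows "chart_deriv d e p (chart_deriv c d p v) = chart_deriv c e p v"
  by (rule chart_deriv_compose(2)[symmetric]) (use assms in \<open>auto simp del: o_apply intro: transition_differentiable\<close>, simp)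

lemma chart_deriv_self [simp]:
  assumes "c \<in> A" "p \<in> dom_of c"
  shows "chart_deriv c c p v = v"
proof -
  have "(coords c \<circ> inv_coords c has_derivative (\<lambda>v. v)) (at (coords c p))"
    by (rule has_derivative_transform_within_open[OF has_derivative_ident open_coords_image[OF assms(1) open_dom[OF assms(1)] order_refl]])
      (use assms in auto)
  from frechet_derivative_at[OF this] show ?thesis by metis
qed

lemma to_chart_eq: "to_chart A c p = chart_deriv (chart_at A p) c p"
  by (simp add: to_chart_def)

lemma extend_eq: "extend A p u q = chart_deriv (chart_at A p) (chart_at A q) q u"
  by (simp add: extend_def)

lemma linear_to_chart: "c \<in> A \<Longrightarrow> p \<in> dom_of c \<Longrightarrow> linear (to_chart A c p)"
  unfolding to_chart_eq by (rule linear_chart_deriv) (auto simp: chart_at)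

lemma to_chart_self [simp]: "to_chart A (chart_at A p) p v = v"
  by (simp add: to_chart_eq chart_at)

lemma to_chart_extend:
  "c \<in> A \<Longrightarrow> q \<in> dom_of c \<Longrightarrow> q \<in> dom_of (chart_at A p) \<Longrightarrow>
    to_chart A c q (extend A p u q) = chart_deriv (chart_at A p) c q u"
  unfolding to_chart_eq extend_eq by (rule chart_deriv_chart_deriv) (auto simp: chart_at)

lemma extend_to_chart:
  "q \<in> dom_of (chart_at A p) \<Longrightarrow> extend A p (to_chart A (chart_at A p) q u) q = u"
  unfolding to_chart_eq extend_eq by (subst chart_deriv_chart_deriv) (auto simp: chart_at)

lemma extend_self [simp]: "extend A p u p = u"
  by (simp add: extend_eq chart_at)

lemma linear_extend: "q \<in> dom_of (chart_at A p) \<Longrightarrow> linear (\<lambda>u. extend A p u q)"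
  unfolding extend_eq by (rule linear_chart_deriv) (auto simp: chart_at)

lemma field_in_chart_coords [simp]:
  "c \<in> A \<Longrightarrow> q \<in> dom_of c \<Longrightarrow> field_in_chart A c X (coords c q) = to_chart A c q (X q)"
  by (simp add: field_in_chart_def)

lemma field_in_chart_change:
  assumes "c \<in> A" "d \<in> A" "q \<in> dom_of c" "q \<in> dom_of d"
  shows "field_in_chart A d X (coords d q) = chart_deriv c d q (field_in_chart A c X (coords c q))"
  using assms by (simp add: to_chart_eq chart_deriv_chart_deriv chart_at)


subsection \<open>Smoothness\<close>

lemma smooth_fun_subset: "smooth_fun A W f \<Longrightarrow> W' \<subseteq> W \<Longrightarrow> smooth_fun A W' f"
  unfolding smooth_fun_def by (blast intro: smooth_on_subset)

lemma smooth_vf_subset: "smooth_vf A W X \<Longrightarrow> W' \<subseteq> W \<Longrightarrow> smooth_vf A W' X"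
  unfolding smooth_vf_def by (blast intro: smooth_on_subset)

lemma smooth_fun_cong:
  assumes "open W" "\<And>q. q \<in> W \<Longrightarrow> f q = h q" "smooth_fun A W f"
  shows "smooth_fun A W h"
  unfolding smooth_fun_def
proof
  fix c assume c: "c \<in> A"
  have "smooth_on (coords c ` (W \<inter> dom_of c)) (f \<circ> inv_coords c)"
    using assms(3) c by (simp add: smooth_fun_def)
  then show "smooth_on (coords c ` (W \<inter> dom_of c)) (h \<circ> inv_coords c)"
    by (subst (asm) smooth_on_cong[OF open_coords_image_Int[OF c assms(1)]]) (use assms(2) c in auto)
qed

lemma smooth_vf_cong:
  assumes "open W" "\<And>q. q \<in> W \<Longrightarrow> X q = Y q" "smooth_vf A W X"
  shows "smooth_vf A W Y"
  unfolding smooth_vf_def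
proof
  fix c assume c: "c \<in> A"
  have "smooth_on (coords c ` (W \<inter> dom_of c)) (field_in_chart A c X)"
    using assms(3) c by (simp add: smooth_vf_def)
  then show "smooth_on (coords c ` (W \<inter> dom_of c)) (field_in_chart A c Y)"
    by (subst (asm) smooth_on_cong[OF open_coords_image_Int[OF c assms(1)]]) (use assms(2) c in auto)
qed

lemma smooth_fun_chartI:
  assumes c: "c \<in> A" and W: "open W" "W \<subseteq> dom_of c"
    and f: "smooth_on (coords c ` W) (f \<circ> inv_coords c)"
  shows "smooth_fun A W f"
  unfolding smooth_fun_def
proof
  fix d assume d: "d \<in> A"
  have Wd: "open (coords d ` (W \<inter> dom_of d))" by (rule open_coords_image_Int[OF d W(1)])
  have "smooth_on (coords d ` (W \<inter> dom_of d)) ((f \<circ> inv_coords c) \<circ> (coords c \<circ> inv_coords d))"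
  proof (rule smooth_on_compose[OF Wd open_coords_image[OF c W] _ _ f])
    show "smooth_on (coords d ` (W \<inter> dom_of d)) (coords c \<circ> inv_coords d)"
      by (rule smooth_on_subset[OF smooth_transition[OF d c]]) (use W in auto)
  qed (use W d in auto)
  then show "smooth_on (coords d ` (W \<inter> dom_of d)) (f \<circ> inv_coords d)"
    by (subst (asm) smooth_on_cong[OF Wd]) (use W c d in auto)
qed

text \<open>Components change by the Jacobian of the transition map, whose entries in fixed
  directions are smooth; hence the expansion in \<open>Basis\<close> before composing with the
  transition.\<close>

lemma smooth_vf_chartI:
  assumes c: "c \<in> A" and W: "open W" "W \<subseteq> dom_of c"
    and X: "smooth_on (coords c ` W) (field_in_chart A c X)"
  shows "smooth_vf A W X"
  unfolding smooth_vf_def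
proof
  fix d assume d: "d \<in> A"
  let ?t = "coords c \<circ> inv_coords d"
  have Wd: "open (coords d ` (W \<inter> dom_of d))" by (rule open_coords_image_Int[OF d W(1)])
  have t: "smooth_on (coords d ` (W \<inter> dom_of d)) ?t"
    by (rule smooth_on_subset[OF smooth_transition[OF d c]]) (use W in auto)
  have sub: "?t ` coords d ` (W \<inter> dom_of d) \<subseteq> coords c ` (W \<inter> dom_of d)"
    using W d by auto
  have sub': "coords c ` (W \<inter> dom_of d) \<subseteq> coords c ` W" "coords c ` (W \<inter> dom_of d) \<subseteq> coords c ` (dom_of c \<inter> dom_of d)"
    using W by auto
  have Wcd: "open (coords c ` (W \<inter> dom_of d))"
    by (rule open_coords_image[OF c open_Int[OF W(1) open_dom[OF d]]]) (use W in auto)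
  let ?F = "\<lambda>x. \<Sum>b\<in>Basis. (field_in_chart A c X x \<bullet> b) *\<^sub>R
      frechet_derivative (coords d \<circ> inv_coords c) (at x) b"
  have "smooth_on (coords c ` (W \<inter> dom_of d)) ?F"
    by (intro smooth_on_sum smooth_on_scaleR Wcd smooth_on_bounded_linear_comp[OF bounded_linear_inner_left]
        smooth_on_frechet_derivative smooth_on_subset[OF X sub'(1)] smooth_on_subset[OF smooth_transition[OF c d] sub'(2)])
  then have "smooth_on (coords d ` (W \<inter> dom_of d)) (?F \<circ> ?t)"
    by (rule smooth_on_compose[OF Wd Wcd sub t])
  moreover have "(?F \<circ> ?t) (coords d q) = field_in_chart A d X (coords d q)" if "q \<in> W \<inter> dom_of d" for q
  proof -
    have q: "q \<in> dom_of c" "q \<in> dom_of d" using that W by auto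
    show ?thesis
      unfolding field_in_chart_change[OF c d q]
      using linear_Basis_expansion[OF linear_chart_deriv[OF c d q], of "field_in_chart A c X (coords c q)"] d q
      by simp
  qed
  ultimately show "smooth_on (coords d ` (W \<inter> dom_of d)) (field_in_chart A d X)"
    by (subst (asm) smooth_on_cong[OF Wd]) (auto simp del: o_apply)
qed

lemma smooth_fun_chartD:
  "smooth_fun A W f \<Longrightarrow> c \<in> A \<Longrightarrow> W \<subseteq> dom_of c \<Longrightarrow> smooth_on (coords c ` W) (f \<circ> inv_coords c)"
  unfolding smooth_fun_def by (metis Int_absorb2)

lemma smooth_vf_chartD:
  "smooth_vf A W X \<Longrightarrow> c \<in> A \<Longrightarrow> W \<subseteq> dom_of c \<Longrightarrow> smooth_on (coords c ` W) (field_in_chart A c X)"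
  unfolding smooth_vf_def by (metis Int_absorb2)

lemma smooth_fun_local:
  assumes W: "open W" and loc: "\<And>p. p \<in> W \<Longrightarrow> \<exists>W'. open W' \<and> p \<in> W' \<and> smooth_fun A W' f"
  shows "smooth_fun A W f"
  unfolding smooth_fun_def
proof
  fix c assume c: "c \<in> A"
  show "smooth_on (coords c ` (W \<inter> dom_of c)) (f \<circ> inv_coords c)"
  proof (rule smooth_on_local[OF open_coords_image_Int[OF c W]])
    fix x assume "x \<in> coords c ` (W \<inter> dom_of c)"
    then obtain p where p: "p \<in> W" "p \<in> dom_of c" "x = coords c p" by auto
    then obtain W' where W': "open W'" "p \<in> W'" "smooth_fun A W' f" using loc by blast
    have "smooth_on (coords c ` (W' \<inter> dom_of c)) (f \<circ> inv_coords c)"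
      using W'(3) c by (simp add: smooth_fun_def)
    then show "\<exists>T. open T \<and> x \<in> T \<and> smooth_on (coords c ` (W \<inter> dom_of c) \<inter> T) (f \<circ> inv_coords c)"
      using open_coords_image_Int[OF c W'(1)] p W'
      by (intro exI[of _ "coords c ` (W' \<inter> dom_of c)"]) (auto intro: smooth_on_subset)
  qed
qed

lemma smooth_vf_local:
  assumes W: "open W" and loc: "\<And>p. p \<in> W \<Longrightarrow> \<exists>W'. open W' \<and> p \<in> W' \<and> smooth_vf A W' X"
  shows "smooth_vf A W X"
  unfolding smooth_vf_def
proof
  fix c assume c: "c \<in> A"
  show "smooth_on (coords c ` (W \<inter> dom_of c)) (field_in_chart A c X)"
  proof (rule smooth_on_local[OF open_coords_image_Int[OF c W]])
    fix x assume "x \<in> coords c ` (W \<inter> dom_of c)"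
    then obtain p where p: "p \<in> W" "p \<in> dom_of c" "x = coords c p" by auto
    then obtain W' where W': "open W'" "p \<in> W'" "smooth_vf A W' X" using loc by blast
    have "smooth_on (coords c ` (W' \<inter> dom_of c)) (field_in_chart A c X)"
      using W'(3) c by (simp add: smooth_vf_def)
    then show "\<exists>T. open T \<and> x \<in> T \<and> smooth_on (coords c ` (W \<inter> dom_of c) \<inter> T) (field_in_chart A c X)"
      using open_coords_image_Int[OF c W'(1)] p W'
      by (intro exI[of _ "coords c ` (W' \<inter> dom_of c)"]) (auto intro: smooth_on_subset)
  qed
qed

lemma continuous_on_smooth_fun:
  assumes "open W" "W \<subseteq> dom_of c" "c \<in> A" "smooth_fun A W f"
  shows "continuous_on W f"
proof -
  have "continuous_on (coords c ` W) (f \<circ> inv_coords c)"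
    by (rule smooth_on_continuous_on[OF smooth_fun_chartD[OF assms(4,3,2)]])
  moreover have "continuous_on W (coords c)"
    using homeomorphism_cont1[OF chart_homeomorphism[OF assms(3)]] assms(2) continuous_on_subset by blast
  ultimately have "continuous_on W ((f \<circ> inv_coords c) \<circ> coords c)"
    by (rule continuous_on_compose[rotated])
  then show ?thesis
    by (rule continuous_on_eq) (use assms in auto)
qed

lemma smooth_fun_const: "smooth_fun A W (\<lambda>q. k)"
  by (simp add: smooth_fun_def comp_def smooth_on_const)

lemma smooth_fun_add:
  "open W \<Longrightarrow> smooth_fun A W f \<Longrightarrow> smooth_fun A W h \<Longrightarrow> smooth_fun A W (\<lambda>q. f q + h q)"
  by (auto simp: smooth_fun_def comp_def intro!: smooth_on_add open_coords_image_Int)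

lemma smooth_fun_mult:
  "open W \<Longrightarrow> smooth_fun A W f \<Longrightarrow> smooth_fun A W h \<Longrightarrow> smooth_fun A W (\<lambda>q. f q * h q)"
  by (auto simp: smooth_fun_def comp_def intro!: smooth_on_mult open_coords_image_Int)

lemma smooth_fun_divide:
  assumes "open W" "smooth_fun A W f" "smooth_fun A W h" "\<And>q. q \<in> W \<Longrightarrow> h q \<noteq> 0"
  shows "smooth_fun A W (\<lambda>q. f q / h q)"
  unfolding smooth_fun_def comp_def
proof
  fix c assume c: "c \<in> A"
  have "(h \<circ> inv_coords c) x \<noteq> 0" if "x \<in> coords c ` (W \<inter> dom_of c)" for x
    using that assms(4) c by auto
  then have "smooth_on (coords c ` (W \<inter> dom_of c)) (\<lambda>x. (f \<circ> inv_coords c) x / (h \<circ> inv_coords c) x)"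
    using assms c by (intro smooth_on_divide open_coords_image_Int) (simp_all add: smooth_fun_def comp_def)
  then show "smooth_on (coords c ` (W \<inter> dom_of c)) (\<lambda>x. f (inv_coords c x) / h (inv_coords c x))"
    by simp
qed

lemma smooth_vf_add:
  assumes "open W" "smooth_vf A W X" "smooth_vf A W Y"
  shows "smooth_vf A W (\<lambda>q. X q + Y q)"
  unfolding smooth_vf_def
proof
  fix c assume c: "c \<in> A"
  note W = open_coords_image_Int[OF c assms(1)]
  have "smooth_on (coords c ` (W \<inter> dom_of c)) (\<lambda>x. field_in_chart A c X x + field_in_chart A c Y x)"
    using assms c by (auto simp: smooth_vf_def intro!: smooth_on_add W)
  then show "smooth_on (coords c ` (W \<inter> dom_of c)) (field_in_chart A c (\<lambda>q. X q + Y q))"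
    by (subst (asm) smooth_on_cong[OF W]) (use c in \<open>auto simp: linear_add[OF linear_to_chart]\<close>)
qed

lemma smooth_vf_scale:
  assumes "open W" "smooth_fun A W f" "smooth_vf A W X"
  shows "smooth_vf A W (\<lambda>q. f q *\<^sub>R X q)"
  unfolding smooth_vf_def
proof
  fix c assume c: "c \<in> A"
  note W = open_coords_image_Int[OF c assms(1)]
  have "smooth_on (coords c ` (W \<inter> dom_of c)) (\<lambda>x. (f \<circ> inv_coords c) x *\<^sub>R field_in_chart A c X x)"
    by (rule smooth_on_scaleR[OF W]) (use assms c in \<open>simp_all add: smooth_vf_def smooth_fun_def comp_def\<close>)
  then show "smooth_on (coords c ` (W \<inter> dom_of c)) (field_in_chart A c (\<lambda>q. f q *\<^sub>R X q))"
    by (subst (asm) smooth_on_cong[OF W]) (use c in \<open>auto simp: linear_scale[OF linear_to_chart]\<close>)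
qed

lemma smooth_vf_const_scale: "open W \<Longrightarrow> smooth_vf A W X \<Longrightarrow> smooth_vf A W (\<lambda>q. k *\<^sub>R X q)"
  by (rule smooth_vf_scale[OF _ smooth_fun_const])

lemma smooth_vf_minus: "open W \<Longrightarrow> smooth_vf A W X \<Longrightarrow> smooth_vf A W (\<lambda>q. - X q)"
  using smooth_vf_const_scale[of W X "-1"] by simp

lemma smooth_vf_diff:
  "open W \<Longrightarrow> smooth_vf A W X \<Longrightarrow> smooth_vf A W Y \<Longrightarrow> smooth_vf A W (\<lambda>q. X q - Y q)"
  using smooth_vf_add[OF _ _ smooth_vf_minus, of W X Y] by simp

lemma smooth_vf_zero: "smooth_vf A W (\<lambda>q. 0)"
  unfolding smooth_vf_def
proof
  fix c assume c: "c \<in> A"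
  have W: "open (coords c ` dom_of c)" using open_coords_image[OF c open_dom[OF c] order_refl] .
  have "smooth_on (coords c ` dom_of c) (field_in_chart A c (\<lambda>q. 0))"
    by (subst smooth_on_cong[OF W, of _ "\<lambda>x. 0"]) (use c in \<open>auto simp: linear_0[OF linear_to_chart] smooth_on_const\<close>)
  then show "smooth_on (coords c ` (W \<inter> dom_of c)) (field_in_chart A c (\<lambda>q. 0))"
    by (rule smooth_on_subset) auto
qed

lemma smooth_vf_sum:
  "open W \<Longrightarrow> (\<And>i. i \<in> I \<Longrightarrow> smooth_vf A W (X i)) \<Longrightarrow> smooth_vf A W (\<lambda>q. \<Sum>i\<in>I. X i q)"
  by (induction I rule: infinite_finite_induct) (auto simp: smooth_vf_zero intro!: smooth_vf_add)

lemma smooth_vf_extend: "smooth_vf A (dom_of (chart_at A p)) (extend A p u)"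
proof (rule smooth_vf_chartI[OF chart_at(1)])
  let ?c = "chart_at A p"
  show o: "open (dom_of ?c)" by (simp add: open_dom chart_at)
  show "smooth_on (coords ?c ` dom_of ?c) (field_in_chart A ?c (extend A p u))"
    by (subst smooth_on_cong[OF open_coords_image[OF chart_at(1) o order_refl], where g = "\<lambda>x. u"])
      (auto simp: chart_at to_chart_extend smooth_on_const)
qed simp

definition component :: "'a \<Rightarrow> ('a \<Rightarrow> 'e) \<Rightarrow> 'e \<Rightarrow> 'a \<Rightarrow> real" where
  "component p X b q = to_chart A (chart_at A p) q (X q) \<bullet> b"

lemma component_expansion:
  assumes "q \<in> dom_of (chart_at A p)"
  shows "X q = (\<Sum>b\<in>Basis. component p X b q *\<^sub>R extend A p b q)"
  using linear_Basis_expansion[OF linear_extend[OF assms], of "to_chart A (chart_at A p) q (X q)"]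
  by (simp add: extend_to_chart[OF assms] component_def)

lemma smooth_fun_component:
  assumes "open W" "W \<subseteq> dom_of (chart_at A p)" "smooth_vf A W X"
  shows "smooth_fun A W (component p X b)"
proof (rule smooth_fun_chartI[OF chart_at(1) assms(1,2)])
  note W = open_coords_image[OF chart_at(1) assms(1,2)]
  have "smooth_on (coords (chart_at A p) ` W) (\<lambda>x. field_in_chart A (chart_at A p) X x \<bullet> b)"
    by (intro smooth_on_bounded_linear_comp[OF bounded_linear_inner_left W] smooth_vf_chartD assms chart_at)
  then show "smooth_on (coords (chart_at A p) ` W) (component p X b \<circ> inv_coords (chart_at A p))"
    by (subst (asm) smooth_on_cong[OF W]) (use assms in \<open>auto simp: component_def chart_at subset_iff\<close>)
qed


subsection \<open>Directional derivatives and Lie brackets\<close>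

lemma smooth_fun_differentiable:
  assumes "open W" "p \<in> W" "smooth_fun A W f" "c \<in> A" "p \<in> dom_of c"
  shows "(f \<circ> inv_coords c) differentiable (at (coords c p))"
proof -
  have "smooth_on (coords c ` (W \<inter> dom_of c)) (f \<circ> inv_coords c)"
    using assms by (simp add: smooth_fun_def)
  then show ?thesis by (rule smooth_on_differentiable) (use assms in auto)
qed

lemma smooth_vf_differentiable:
  assumes "open W" "p \<in> W" "smooth_vf A W X" "c \<in> A" "p \<in> dom_of c"
  shows "field_in_chart A c X differentiable (at (coords c p))"
proof -
  have "smooth_on (coords c ` (W \<inter> dom_of c)) (field_in_chart A c X)"
    using assms by (simp add: smooth_vf_def)
  then show ?thesis by (rule smooth_on_differentiable) (use assms in auto)
qed

lemma has_derivative_dir_deriv: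
  assumes "open W" "p \<in> W" "smooth_fun A W f"
  shows "((f \<circ> inv_coords (chart_at A p)) has_derivative (\<lambda>v. dir_deriv A p v f)) (at (coords (chart_at A p) p))"
  unfolding dir_deriv_def
  using smooth_fun_differentiable[OF assms chart_at] by (simp add: frechet_derivative_works)

lemma dir_derivI:
  assumes "((f \<circ> inv_coords (chart_at A p)) has_derivative F) (at (coords (chart_at A p) p))"
  shows "dir_deriv A p v f = F v"
  unfolding dir_deriv_def using frechet_derivative_at[OF assms] by simp

lemma dir_deriv_cong:
  assumes "open W" "p \<in> W" "smooth_fun A W f" "\<And>q. q \<in> W \<Longrightarrow> h q = f q"
  shows "dir_deriv A p v h = dir_deriv A p v f"
proof (rule dir_derivI)
  show "((h \<circ> inv_coords (chart_at A p)) has_derivative (\<lambda>v. dir_deriv A p v f)) (at (coords (chart_at A p) p))"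
    by (rule has_derivative_transform_within_open[OF has_derivative_dir_deriv[OF assms(1-3)]
          open_coords_image_Int[OF chart_at(1) assms(1)]])
      (use assms chart_at in auto)
qed

lemma dir_deriv_const [simp]: "dir_deriv A p v (\<lambda>q. k) = 0"
  using dir_derivI[of "\<lambda>q. k" p "\<lambda>v. 0" v] by (simp add: comp_def)

lemma dir_deriv_add:
  assumes "open W" "p \<in> W" "smooth_fun A W f" "smooth_fun A W h"
  shows "dir_deriv A p v (\<lambda>q. f q + h q) = dir_deriv A p v f + dir_deriv A p v h"
  by (rule dir_derivI) (use has_derivative_add[OF has_derivative_dir_deriv[OF assms(1-3)]
        has_derivative_dir_deriv[OF assms(1,2,4)]] in \<open>simp add: comp_def\<close>)

lemma dir_deriv_mult:
  assumes "open W" "p \<in> W" "smooth_fun A W f" "smooth_fun A W h"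
  shows "dir_deriv A p v (\<lambda>q. f q * h q) = dir_deriv A p v f * h p + f p * dir_deriv A p v h"
  by (rule dir_derivI) (use has_derivative_mult[OF has_derivative_dir_deriv[OF assms(1-3)]
        has_derivative_dir_deriv[OF assms(1,2,4)]] in \<open>simp add: comp_def chart_at algebra_simps\<close>)

lemma dir_deriv_extend:
  assumes "open W" "q \<in> W" "smooth_fun A W f" "q \<in> dom_of (chart_at A p)"
  shows "dir_deriv A q (extend A p u q) f =
    frechet_derivative (f \<circ> inv_coords (chart_at A p)) (at (coords (chart_at A p) q)) u"
  unfolding dir_deriv_def extend_eq
  by (rule chart_deriv_compose(2)[symmetric])
    (use assms in \<open>auto simp: chart_at comp_def intro!: smooth_fun_differentiable[unfolded comp_def]\<close>)

lemma smooth_fun_dir_deriv_extend: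
  assumes W: "open W" "W \<subseteq> dom_of (chart_at A p)" and f: "smooth_fun A W f"
  shows "smooth_fun A W (\<lambda>q. dir_deriv A q (extend A p u q) f)"
proof (rule smooth_fun_chartI[OF chart_at(1) W])
  note o = open_coords_image[OF chart_at(1) W]
  have "smooth_on (coords (chart_at A p) ` W)
      (\<lambda>x. frechet_derivative (f \<circ> inv_coords (chart_at A p)) (at x) u)"
    by (rule smooth_on_frechet_derivative[OF smooth_fun_chartD[OF f chart_at(1) W(2)]])
  then show "smooth_on (coords (chart_at A p) ` W)
      ((\<lambda>q. dir_deriv A q (extend A p u q) f) \<circ> inv_coords (chart_at A p))"
  proof (subst (asm) smooth_on_cong[OF o])
    fix x assume "x \<in> coords (chart_at A p) ` W"
    then obtain q where q: "q \<in> W" "x = coords (chart_at A p) q" by auto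
    have "q \<in> dom_of (chart_at A p)" using q W by auto
    with dir_deriv_extend[OF W(1) q(1) f this] q show "frechet_derivative (f \<circ> inv_coords (chart_at A p)) (at x) u =
        ((\<lambda>q. dir_deriv A q (extend A p u q) f) \<circ> inv_coords (chart_at A p)) x"
      by (simp add: chart_at)
  qed
qed

text \<open>In the preferred chart at \<open>p\<close> both sides are second partial derivatives of
  the coordinate expression of \<open>f\<close>, taken in opposite orders.\<close>

lemma dir_deriv_extend_commute:
  assumes W: "open W" "p \<in> W" and f: "smooth_fun A W f"
  shows "dir_deriv A p u (\<lambda>q. dir_deriv A q (extend A p v q) f) =
    dir_deriv A p v (\<lambda>q. dir_deriv A q (extend A p u q) f)"
proof -
  let ?c = "chart_at A p"
  let ?W = "W \<inter> dom_of ?c"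
  let ?f = "f \<circ> inv_coords ?c"
  have W': "open ?W" "p \<in> ?W" using W by (simp_all add: open_Int open_dom chart_at)
  note o = open_coords_image_Int[OF chart_at(1) W(1), of p]
  have s: "smooth_on (coords ?c ` ?W) ?f"
    using f chart_at by (simp add: smooth_fun_def)
  have "dir_deriv A p u (\<lambda>q. dir_deriv A q (extend A p v q) f) =
      frechet_derivative (\<lambda>x. frechet_derivative ?f (at x) v) (at (coords ?c p)) u" for u v
  proof (rule dir_derivI)
    have "(\<lambda>x. frechet_derivative ?f (at x) v) differentiable (at (coords ?c p))"
      using smooth_on_differentiable[OF smooth_on_frechet_derivative[OF s]] W' by blast
    then have 1: "((\<lambda>x. frechet_derivative ?f (at x) v) has_derivative
        frechet_derivative (\<lambda>x. frechet_derivative ?f (at x) v) (at (coords ?c p))) (at (coords ?c p))"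
      by (simp add: frechet_derivative_works)
    show "((\<lambda>q. dir_deriv A q (extend A p v q) f) \<circ> inv_coords ?c has_derivative
        frechet_derivative (\<lambda>x. frechet_derivative ?f (at x) v) (at (coords ?c p))) (at (coords ?c p))"
      by (rule has_derivative_transform_within_open[OF 1 o])
        (use W' f in \<open>auto simp: chart_at dir_deriv_extend[OF W(1)] simp del: o_apply simp: o_apply[of _ "inv_coords _"]\<close>)
  qed
  then show ?thesis
    using symmetric_second_derivative[OF o _ s, of "coords ?c p"] W' by simp
qed

lemma lie_bracket_skew: "lie_bracket A X Y q = - lie_bracket A Y X q"
  by (simp add: lie_bracket_def Let_def)

lemma lie_bracket_cong:
  assumes W: "open W" "q \<in> W" and X: "smooth_vf A W X" and eq: "\<And>q. q \<in> W \<Longrightarrow> X' q = X q"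
  shows "lie_bracket A X' Y q = lie_bracket A X Y q"
proof -
  have "frechet_derivative (field_in_chart A (chart_at A q) X) (at (coords (chart_at A q) q)) =
      frechet_derivative (field_in_chart A (chart_at A q) X') (at (coords (chart_at A q) q))"
    by (rule frechet_derivative_transform_within_open[OF smooth_vf_differentiable[OF W X chart_at]
          open_coords_image_Int[OF chart_at(1) W(1)]])
      (use W eq chart_at in auto)
  then show ?thesis
    using W eq by (simp add: lie_bracket_def Let_def)
qed

lemma lie_bracket_add:
  assumes W: "open W" "q \<in> W" and X: "smooth_vf A W X" "smooth_vf A W X'" "smooth_vf A W Y"
  shows "lie_bracket A (\<lambda>q. X q + X' q) Y q = lie_bracket A X Y q + lie_bracket A X' Y q"
proof -
  let ?c = "chart_at A q"
  let ?x = "coords ?c q"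
  have d: "(field_in_chart A ?c Z has_derivative frechet_derivative (field_in_chart A ?c Z) (at ?x)) (at ?x)"
    if "smooth_vf A W Z" for Z
    using smooth_vf_differentiable[OF W that chart_at] by (simp add: frechet_derivative_works)
  have "(field_in_chart A ?c (\<lambda>q. X q + X' q) has_derivative
      (\<lambda>v. frechet_derivative (field_in_chart A ?c X) (at ?x) v + frechet_derivative (field_in_chart A ?c X') (at ?x) v)) (at ?x)"
    by (rule has_derivative_transform_within_open[OF has_derivative_add[OF d[OF X(1)] d[OF X(2)]]
          open_coords_image_Int[OF chart_at(1) W(1)]])
      (use W chart_at in \<open>auto simp: linear_add[OF linear_to_chart]\<close>)
  from frechet_derivative_at[OF this, symmetric] d[OF X(3)] show ?thesis
    by (auto simp: lie_bracket_def Let_def linear_add[OF has_derivative_linear])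
qed

lemma lie_bracket_scale:
  assumes W: "open W" "q \<in> W" and X: "smooth_fun A W f" "smooth_vf A W X" "smooth_vf A W Y"
  shows "lie_bracket A (\<lambda>q. f q *\<^sub>R X q) Y q = f q *\<^sub>R lie_bracket A X Y q - dir_deriv A q (Y q) f *\<^sub>R X q"
proof -
  let ?c = "chart_at A q"
  let ?x = "coords ?c q"
  have d: "(field_in_chart A ?c Z has_derivative frechet_derivative (field_in_chart A ?c Z) (at ?x)) (at ?x)"
    if "smooth_vf A W Z" for Z
    using smooth_vf_differentiable[OF W that chart_at] by (simp add: frechet_derivative_works)
  have "(field_in_chart A ?c (\<lambda>q. f q *\<^sub>R X q) has_derivative
      (\<lambda>v. (f \<circ> inv_coords ?c) ?x *\<^sub>R frechet_derivative (field_in_chart A ?c X) (at ?x) v +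
         dir_deriv A q v f *\<^sub>R field_in_chart A ?c X ?x)) (at ?x)"
    by (rule has_derivative_transform_within_open[OF has_derivative_scaleR[OF has_derivative_dir_deriv[OF W X(1)] d[OF X(2)]]
          open_coords_image_Int[OF chart_at(1) W(1)]])
      (use W chart_at in \<open>auto simp: linear_scale[OF linear_to_chart]\<close>)
  from frechet_derivative_at[OF this, symmetric] d[OF X(3)] show ?thesis
    by (auto simp: lie_bracket_def Let_def linear_scale[OF has_derivative_linear] chart_at algebra_simps)
qed

text \<open>Seen in the preferred chart at \<open>q\<close>, the fields have components Dt(.) u and
  Dt(.) v, with t the transition map from the chart at \<open>p\<close>. The bracket is therefore
  the antisymmetrized second derivative of t, which vanishes.\<close>

lemma lie_bracket_extend:
  assumes q: "q \<in> dom_of (chart_at A p)"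
  shows "lie_bracket A (extend A p u) (extend A p v) q = 0"
proof -
  let ?c = "chart_at A p" and ?d = "chart_at A q"
  let ?S = "coords ?c ` (dom_of ?c \<inter> dom_of ?d)"
  let ?t = "coords ?d \<circ> inv_coords ?c"
  note t = smooth_transition[OF chart_at(1) chart_at(1), of p q]
  have o: "open ?S" by (rule open_overlap[OF chart_at(1) chart_at(1)])
  have qS: "coords ?c q \<in> ?S" using q chart_at by auto
  have "frechet_derivative (field_in_chart A ?d (extend A p v)) (at (coords ?d q)) (extend A p u q)
      = frechet_derivative (\<lambda>x. frechet_derivative ?t (at x) v) (at (coords ?c q)) u" for u v
  proof -
    have h: "(\<lambda>x. frechet_derivative ?t (at x) v) differentiable (at (coords ?c q))"
      by (rule smooth_on_differentiable[OF smooth_on_frechet_derivative[OF t] qS])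
    have eq: "field_in_chart A ?d (extend A p v) (coords ?d r) = frechet_derivative ?t (at (coords ?c r)) v"
      if "r \<in> dom_of ?d" "r \<in> dom_of ?c" for r
      using that by (simp add: chart_at to_chart_extend)
    have "frechet_derivative (field_in_chart A ?d (extend A p v)) (at (coords ?d q)) (extend A p u q) =
        frechet_derivative (\<lambda>x. frechet_derivative ?t (at x) v) (at (coords ?c q)) (chart_deriv ?d ?c q (extend A p u q))"
      by (rule chart_deriv_compose(2)[where h = "\<lambda>x. frechet_derivative ?t (at x) v"])
        (use q h eq in \<open>simp_all add: chart_at del: o_apply\<close>)
    also have "chart_deriv ?d ?c q (extend A p u q) = u"
      unfolding extend_eq using q by (subst chart_deriv_chart_deriv) (auto simp: chart_at)
    finally show ?thesis .
  qed
  then show ?thesis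
    using symmetric_second_derivative[OF o qS t, of u v] by (simp add: lie_bracket_def Let_def)
qed


subsection \<open>Tensoriality\<close>

text \<open>Fields are total functions that mean something only near \<open>p\<close>, so locality
  is a separate clause; it also gives access to the coordinate frame, which exists only on a chart
  domain.\<close>

definition tensorial :: "'a \<Rightarrow> (('a \<Rightarrow> 'e) \<Rightarrow> 'f::real_vector) \<Rightarrow> bool" where
  "tensorial p \<Phi> \<longleftrightarrow>
    (\<forall>W X Y. open W \<and> p \<in> W \<and> smooth_vf A W X \<and> (\<forall>q\<in>W. Y q = X q) \<longrightarrow> \<Phi> Y = \<Phi> X) \<and>
    (\<forall>W X Y. open W \<and> p \<in> W \<and> smooth_vf A W X \<and> smooth_vf A W Y \<longrightarrow> \<Phi> (\<lambda>q. X q + Y q) = \<Phi> X + \<Phi> Y) \<and>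
    (\<forall>W f X. open W \<and> p \<in> W \<and> smooth_fun A W f \<and> smooth_vf A W X \<longrightarrow>
       \<Phi> (\<lambda>q. f q *\<^sub>R X q) = f p *\<^sub>R \<Phi> X)"

lemma tensorialI:
  assumes "\<And>W X Y. open W \<Longrightarrow> p \<in> W \<Longrightarrow> smooth_vf A W X \<Longrightarrow> (\<And>q. q \<in> W \<Longrightarrow> Y q = X q) \<Longrightarrow> \<Phi> Y = \<Phi> X"
    and "\<And>W X Y. open W \<Longrightarrow> p \<in> W \<Longrightarrow> smooth_vf A W X \<Longrightarrow> smooth_vf A W Y \<Longrightarrow> \<Phi> (\<lambda>q. X q + Y q) = \<Phi> X + \<Phi> Y"
    and "\<And>W f X. open W \<Longrightarrow> p \<in> W \<Longrightarrow> smooth_fun A W f \<Longrightarrow> smooth_vf A W X \<Longrightarrow>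
       \<Phi> (\<lambda>q. f q *\<^sub>R X q) = f p *\<^sub>R \<Phi> X"
  shows "tensorial p \<Phi>"
  unfolding tensorial_def
proof (intro conjI allI impI)
  fix W X Y assume "open W \<and> p \<in> W \<and> smooth_vf A W X \<and> (\<forall>q\<in>W. Y q = X q)"
  then show "\<Phi> Y = \<Phi> X" by (intro assms(1)[of W]) auto
next
  fix W X Y assume "open W \<and> p \<in> W \<and> smooth_vf A W X \<and> smooth_vf A W Y"
  then show "\<Phi> (\<lambda>q. X q + Y q) = \<Phi> X + \<Phi> Y" by (intro assms(2)[of W]) auto
next
  fix W f X assume "open W \<and> p \<in> W \<and> smooth_fun A W f \<and> smooth_vf A W X"
  then show "\<Phi> (\<lambda>q. f q *\<^sub>R X q) = f p *\<^sub>R \<Phi> X" by (intro assms(3)[of W]) auto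
qed

lemma tensorial_cong:
  assumes "tensorial p \<Phi>" "open W" "p \<in> W" "smooth_vf A W X" "\<And>q. q \<in> W \<Longrightarrow> Y q = X q"
  shows "\<Phi> Y = \<Phi> X"
  using assms(1)[unfolded tensorial_def, THEN conjunct1, rule_format, of W X Y] assms(2-5) by simp

lemma tensorial_add:
  assumes "tensorial p \<Phi>" "open W" "p \<in> W" "smooth_vf A W X" "smooth_vf A W Y"
  shows "\<Phi> (\<lambda>q. X q + Y q) = \<Phi> X + \<Phi> Y"
  using assms(1)[unfolded tensorial_def, THEN conjunct2, THEN conjunct1, rule_format, of W X Y] assms(2-5)
  by simp

lemma tensorial_scale:
  assumes "tensorial p \<Phi>" "open W" "p \<in> W" "smooth_fun A W f" "smooth_vf A W X"
  shows "\<Phi> (\<lambda>q. f q *\<^sub>R X q) = f p *\<^sub>R \<Phi> X"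
  using assms(1)[unfolded tensorial_def, THEN conjunct2, THEN conjunct2, rule_format, of W f X] assms(2-5)
  by simp

text \<open>Near \<open>p\<close> a field is a combination of the coordinate fields with smooth
  coefficients. Locality, additivity and linearity over functions then leave only the values of the
  coefficients at \<open>p\<close>.\<close>

lemma tensorial_expansion:
  assumes \<Phi>: "tensorial p \<Phi>" and W: "open W" "p \<in> W" and X: "smooth_vf A W X"
  shows "\<Phi> X = (\<Sum>b\<in>Basis. (X p \<bullet> b) *\<^sub>R \<Phi> (extend A p b))"
proof -
  let ?W = "W \<inter> dom_of (chart_at A p)"
  have W': "open ?W" "p \<in> ?W" "?W \<subseteq> dom_of (chart_at A p)" using W by (auto simp: open_Int open_dom chart_at)
  have XW: "smooth_vf A ?W X" by (rule smooth_vf_subset[OF X]) auto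
  have EW: "smooth_vf A ?W (extend A p b)" for b by (rule smooth_vf_subset[OF smooth_vf_extend]) auto
  note c = smooth_fun_component[OF W'(1,3) XW]
  have sm: "smooth_vf A ?W (\<lambda>q. component p X b q *\<^sub>R extend A p b q)" for b
    by (rule smooth_vf_scale[OF W'(1) c EW])
  have z: "\<Phi> (\<lambda>q. 0) = 0"
    using tensorial_scale[OF \<Phi> W smooth_fun_const[of W 0] smooth_vf_zero[of W]] by simp
  have s: "\<Phi> (\<lambda>q. \<Sum>b\<in>I. component p X b q *\<^sub>R extend A p b q) = (\<Sum>b\<in>I. component p X b p *\<^sub>R \<Phi> (extend A p b))"
    if "finite I" for I
    using that
  proof (induction I rule: finite_induct)
    case (insert b I)
    have "\<Phi> (\<lambda>q. component p X b q *\<^sub>R extend A p b q + (\<Sum>b\<in>I. component p X b q *\<^sub>R extend A p b q)) =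
        \<Phi> (\<lambda>q. component p X b q *\<^sub>R extend A p b q) + \<Phi> (\<lambda>q. \<Sum>b\<in>I. component p X b q *\<^sub>R extend A p b q)"
      by (rule tensorial_add[OF \<Phi> W'(1,2) sm smooth_vf_sum[OF W'(1) sm]])
    also have "\<Phi> (\<lambda>q. component p X b q *\<^sub>R extend A p b q) = component p X b p *\<^sub>R \<Phi> (extend A p b)"
      by (rule tensorial_scale[OF \<Phi> W'(1,2) c EW])
    finally show ?case using insert by simp
  qed (simp add: z)
  have "\<Phi> X = \<Phi> (\<lambda>q. \<Sum>b\<in>Basis. component p X b q *\<^sub>R extend A p b q)"
    by (rule tensorial_cong[OF \<Phi> W'(1,2) smooth_vf_sum[OF W'(1) sm]]) (rule component_expansion, simp)
  then show ?thesis unfolding s[OF finite_Basis] by (simp add: component_def)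
qed

lemma tensorial_eq:
  assumes "tensorial p \<Phi>" "open W" "p \<in> W" "smooth_vf A W X"
    and "open W'" "p \<in> W'" "smooth_vf A W' Y" "X p = Y p"
  shows "\<Phi> X = \<Phi> Y"
  using tensorial_expansion[OF assms(1-4)] tensorial_expansion[OF assms(1,5-7)] assms(8) by simp

lemma extend_nbhd: "open (dom_of (chart_at A p))" "p \<in> dom_of (chart_at A p)"
  by (auto simp: open_dom chart_at)

lemma tensorial_extend:
  assumes "tensorial p \<Phi>" "open W" "p \<in> W" "smooth_vf A W X"
  shows "\<Phi> X = \<Phi> (extend A p (X p))"
  by (rule tensorial_eq[OF assms extend_nbhd smooth_vf_extend]) simp

lemma linear_tensorial:
  assumes "tensorial p \<Phi>"
  shows "linear (\<lambda>u. \<Phi> (extend A p u))"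
proof -
  have "(\<lambda>u. \<Phi> (extend A p u)) = (\<lambda>u. \<Sum>b\<in>Basis. (u \<bullet> b) *\<^sub>R \<Phi> (extend A p b))"
    using tensorial_expansion[OF assms extend_nbhd smooth_vf_extend, unfolded extend_self] by (rule ext)
  moreover have "linear (\<lambda>u. \<Sum>b\<in>Basis. (u \<bullet> b) *\<^sub>R \<Phi> (extend A p b))"
    by (rule linearI) (simp_all add: inner_simps scaleR_add_left sum.distrib scaleR_sum_right)
  ultimately show ?thesis by simp
qed

end


section \<open>Connections, torsion and curvature\<close>

locale connection = atlas A for A :: "('a::topological_space, 'e::euclidean_space) chart set" +
  fixes D :: "('a, 'e) conn"
  assumes affine_connection: "affine_connection A D"
begin

lemma conn_cong:
  assumes "open W" "p \<in> W" "smooth_vf A W Y" "\<And>q. q \<in> W \<Longrightarrow> Y' q = Y q"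
  shows "D p v Y' = D p v Y"
  using affine_connection[unfolded affine_connection_def, THEN conjunct1, rule_format, of W p Y Y' v] assms
  by simp

lemma smooth_vf_conn: "open W \<Longrightarrow> smooth_vf A W X \<Longrightarrow> smooth_vf A W Y \<Longrightarrow> smooth_vf A W (\<lambda>p. D p (X p) Y)"
  using affine_connection[unfolded affine_connection_def, THEN conjunct2, THEN conjunct1] by simp

lemma linear_conn: "open W \<Longrightarrow> p \<in> W \<Longrightarrow> smooth_vf A W Y \<Longrightarrow> linear (\<lambda>v. D p v Y)"
  using affine_connection[unfolded affine_connection_def, THEN conjunct2, THEN conjunct2, THEN conjunct1] by simp

lemma conn_add:
  "open W \<Longrightarrow> p \<in> W \<Longrightarrow> smooth_vf A W Y \<Longrightarrow> smooth_vf A W Z \<Longrightarrow>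
    D p v (\<lambda>q. Y q + Z q) = D p v Y + D p v Z"
  using affine_connection[unfolded affine_connection_def, THEN conjunct2, THEN conjunct2, THEN conjunct2, THEN conjunct1]
  by simp

lemma conn_scale:
  "open W \<Longrightarrow> p \<in> W \<Longrightarrow> smooth_fun A W f \<Longrightarrow> smooth_vf A W Y \<Longrightarrow>
    D p v (\<lambda>q. f q *\<^sub>R Y q) = dir_deriv A p v f *\<^sub>R Y p + f p *\<^sub>R D p v Y"
  using affine_connection[unfolded affine_connection_def, THEN conjunct2, THEN conjunct2, THEN conjunct2, THEN conjunct2]
  by simp

lemma conn_const_scale: "open W \<Longrightarrow> p \<in> W \<Longrightarrow> smooth_vf A W Y \<Longrightarrow> D p v (\<lambda>q. k *\<^sub>R Y q) = k *\<^sub>R D p v Y"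
  using conn_scale[OF _ _ smooth_fun_const] by simp

lemma conn_minus: "open W \<Longrightarrow> p \<in> W \<Longrightarrow> smooth_vf A W Y \<Longrightarrow> D p v (\<lambda>q. - Y q) = - D p v Y"
  using conn_const_scale[of W p Y v "-1"] by simp

lemma conn_diff:
  "open W \<Longrightarrow> p \<in> W \<Longrightarrow> smooth_vf A W Y \<Longrightarrow> smooth_vf A W Z \<Longrightarrow>
    D p v (\<lambda>q. Y q - Z q) = D p v Y - D p v Z"
  using conn_add[OF _ _ _ smooth_vf_minus, of W p Y Z v] conn_minus[of W p Z v] by simp

lemma conn_vec_add: "open W \<Longrightarrow> p \<in> W \<Longrightarrow> smooth_vf A W Y \<Longrightarrow> D p (u + v) Y = D p u Y + D p v Y"
  using linear_add[OF linear_conn] .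

lemma conn_vec_scale: "open W \<Longrightarrow> p \<in> W \<Longrightarrow> smooth_vf A W Y \<Longrightarrow> D p (k *\<^sub>R v) Y = k *\<^sub>R D p v Y"
  using linear_scale[OF linear_conn] .

text \<open>On f X, the derivative of f enters through the covariant derivative of X along Y and
  through the bracket, and the two contributions cancel.\<close>

lemma tensorial_torsion:
  assumes W: "open W" "p \<in> W" and Y: "smooth_vf A W Y"
  shows "tensorial p (\<lambda>X. D p (X p) Y - D p (Y p) X - lie_bracket A X Y p)"
proof (rule tensorialI)
  fix W' X X' assume W': "open W'" "p \<in> W'" and X: "smooth_vf A W' X" and eq: "\<And>q. q \<in> W' \<Longrightarrow> X' q = X q"
  show "D p (X' p) Y - D p (Y p) X' - lie_bracket A X' Y p = D p (X p) Y - D p (Y p) X - lie_bracket A X Y p"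
    using lie_bracket_cong[OF W' X eq] conn_cong[OF W' X eq] eq[OF W'(2)] by simp
next
  fix W' X X' assume W': "open W'" "p \<in> W'" and X: "smooth_vf A W' X" "smooth_vf A W' X'"
  have 1: "open (W \<inter> W')" "p \<in> W \<inter> W'" using W W' by auto
  have 2: "smooth_vf A (W \<inter> W') X" "smooth_vf A (W \<inter> W') X'" "smooth_vf A (W \<inter> W') Y"
    using X Y by (auto intro: smooth_vf_subset)
  show "D p (X p + X' p) Y - D p (Y p) (\<lambda>q. X q + X' q) - lie_bracket A (\<lambda>q. X q + X' q) Y p =
      D p (X p) Y - D p (Y p) X - lie_bracket A X Y p + (D p (X' p) Y - D p (Y p) X' - lie_bracket A X' Y p)"
    using lie_bracket_add[OF 1 2] conn_add[OF 1 2(1,2)] conn_vec_add[OF W Y] by simp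
next
  fix W' f X assume W': "open W'" "p \<in> W'" and f: "smooth_fun A W' f" and X: "smooth_vf A W' X"
  have 1: "open (W \<inter> W')" "p \<in> W \<inter> W'" using W W' by auto
  have 2: "smooth_fun A (W \<inter> W') f" "smooth_vf A (W \<inter> W') X" "smooth_vf A (W \<inter> W') Y"
    using f X Y by (auto intro: smooth_vf_subset smooth_fun_subset)
  show "D p (f p *\<^sub>R X p) Y - D p (Y p) (\<lambda>q. f q *\<^sub>R X q) - lie_bracket A (\<lambda>q. f q *\<^sub>R X q) Y p =
      f p *\<^sub>R (D p (X p) Y - D p (Y p) X - lie_bracket A X Y p)"
    using lie_bracket_scale[OF 1 2] conn_scale[OF 1 2(1,2)] conn_vec_scale[OF W Y]
    by (simp add: algebra_simps)
qed

lemma torsion_skew: "torsion A D p u v = - torsion A D p v u"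
  using lie_bracket_skew[of "extend A p u" "extend A p v" p] by (simp add: torsion_def Let_def)

text \<open>Tensoriality is known in the first argument; skew-symmetry of the expression transfers
  it to the second, so both fields may be replaced by constant extensions one after the
  other.\<close>

lemma torsion_eq_fields:
  assumes W: "open W" "p \<in> W" and X: "smooth_vf A W X" and Y: "smooth_vf A W Y"
  shows "torsion A D p (X p) (Y p) = D p (X p) Y - D p (Y p) X - lie_bracket A X Y p"
proof -
  let ?T = "\<lambda>X Y. D p (X p) Y - D p (Y p) X - lie_bracket A X Y p"
  have skew: "?T X Y = - ?T Y X" for X Y
    using lie_bracket_skew[of X Y p] by simp
  have "?T X Y = ?T (extend A p (X p)) Y"
    by (rule tensorial_extend[OF tensorial_torsion[OF W Y] W X])
  also have "\<dots> = - ?T Y (extend A p (X p))" by (rule skew)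
  also have "?T Y (extend A p (X p)) = ?T (extend A p (Y p)) (extend A p (X p))"
    by (rule tensorial_extend[OF tensorial_torsion[OF extend_nbhd smooth_vf_extend] W Y])
  also have "- \<dots> = ?T (extend A p (X p)) (extend A p (Y p))" by (simp only: skew[of "extend A p (X p)"])
  also have "\<dots> = torsion A D p (X p) (Y p)" by (simp add: torsion_def Let_def)
  finally show ?thesis by simp
qed

lemma linear_torsion_left: "linear (\<lambda>u. torsion A D p u v)"
  using linear_tensorial[OF tensorial_torsion[OF extend_nbhd smooth_vf_extend, of p v]]
  by (simp add: torsion_def Let_def)

lemma linear_torsion_right: "linear (torsion A D p u)"
proof -
  have "linear (\<lambda>v. - torsion A D p v u)"
    by (rule linear_compose_neg[OF linear_torsion_left])
  then show ?thesis using torsion_skew[of p u] by presburger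
qed

lemmas torsion_simps = linear_add[OF linear_torsion_left] linear_add[OF linear_torsion_right]
  linear_scale[OF linear_torsion_left] linear_scale[OF linear_torsion_right]
  linear_diff[OF linear_torsion_left] linear_diff[OF linear_torsion_right]
  linear_neg[OF linear_torsion_left] linear_neg[OF linear_torsion_right]

lemma torsion_extend:
  assumes "q \<in> dom_of (chart_at A p)"
  shows "torsion A D q (extend A p u q) (extend A p v q) =
    D q (extend A p u q) (extend A p v) - D q (extend A p v q) (extend A p u)"
  using torsion_eq_fields[OF extend_nbhd(1) assms smooth_vf_extend smooth_vf_extend, of u v]
    lie_bracket_extend[OF assms] by simp

text \<open>The definition extends vectors by different fields at each point, which hides
  smoothness. Near \<open>p\<close> one coordinate frame serves all points, and its brackets vanish,
  so the torsion of two frame fields is a difference of covariant derivatives.\<close>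

lemma smooth_vf_torsion:
  assumes W: "open W" and X: "smooth_vf A W X" and Y: "smooth_vf A W Y"
  shows "smooth_vf A W (\<lambda>q. torsion A D q (X q) (Y q))"
proof (rule smooth_vf_local[OF W])
  fix p assume p: "p \<in> W"
  let ?W = "W \<inter> dom_of (chart_at A p)"
  have W': "open ?W" "?W \<subseteq> dom_of (chart_at A p)" using W extend_nbhd(1) by auto
  have X': "smooth_vf A ?W X" and Y': "smooth_vf A ?W Y" using X Y by (auto intro: smooth_vf_subset)
  have E: "smooth_vf A ?W (extend A p u)" for u by (rule smooth_vf_subset[OF smooth_vf_extend]) auto
  have "smooth_vf A ?W (\<lambda>q. \<Sum>b\<in>Basis. \<Sum>c\<in>Basis. component p X b q *\<^sub>R component p Y c q *\<^sub>R
      (D q (extend A p b q) (extend A p c) - D q (extend A p c q) (extend A p b)))"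
    by (intro smooth_vf_sum smooth_vf_scale smooth_fun_component smooth_vf_diff smooth_vf_conn W' X' Y' E)
  then have "smooth_vf A ?W (\<lambda>q. torsion A D q (X q) (Y q))"
  proof (rule smooth_vf_cong[OF W'(1), rotated])
    fix q assume "q \<in> ?W"
    then have q: "q \<in> dom_of (chart_at A p)" by auto
    have "torsion A D q (X q) (Y q) = torsion A D q (\<Sum>b\<in>Basis. component p X b q *\<^sub>R extend A p b q)
        (\<Sum>b\<in>Basis. component p Y b q *\<^sub>R extend A p b q)"
      unfolding component_expansion[OF q, symmetric] ..
    also have "\<dots> = (\<Sum>b\<in>Basis. \<Sum>c\<in>Basis. component p X b q *\<^sub>R component p Y c q *\<^sub>R
      (D q (extend A p b q) (extend A p c) - D q (extend A p c q) (extend A p b)))"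
      unfolding linear_sum[OF linear_torsion_left]
      unfolding linear_sum[OF linear_torsion_right]
      by (simp add: torsion_simps torsion_extend[OF q] mult.commute)
    finally show "(\<Sum>b\<in>Basis. \<Sum>c\<in>Basis. component p X b q *\<^sub>R component p Y c q *\<^sub>R
      (D q (extend A p b q) (extend A p c) - D q (extend A p c q) (extend A p b))) = torsion A D q (X q) (Y q)" ..
  qed
  then show "\<exists>W'. open W' \<and> p \<in> W' \<and> smooth_vf A W' (\<lambda>q. torsion A D q (X q) (Y q))"
    using W' p extend_nbhd(2) by blast
qed


subsection \<open>Curvature\<close>

abbreviation second_deriv :: "'a \<Rightarrow> 'e \<Rightarrow> 'e \<Rightarrow> ('a \<Rightarrow> 'e) \<Rightarrow> 'e" where
  "second_deriv p u v Z \<equiv> D p u (\<lambda>q. D q (extend A p v q) Z)"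

lemma smooth_vf_conn_extend:
  "open W \<Longrightarrow> W \<subseteq> dom_of (chart_at A p) \<Longrightarrow> smooth_vf A W Z \<Longrightarrow>
    smooth_vf A W (\<lambda>q. D q (extend A p v q) Z)"
  by (rule smooth_vf_conn[OF _ smooth_vf_subset[OF smooth_vf_extend]])

lemma curvature_eq:
  "curvature A D p u v w = second_deriv p u v (extend A p w) - second_deriv p v u (extend A p w)"
  using lie_bracket_extend[OF chart_at(2), of p u v] linear_0[OF linear_conn[OF extend_nbhd smooth_vf_extend]]
  by (simp add: curvature_def Let_def)

lemma second_deriv_add:
  assumes W: "open W" "p \<in> W" and Z: "smooth_vf A W Z" "smooth_vf A W Z'"
  shows "second_deriv p u v (\<lambda>q. Z q + Z' q) = second_deriv p u v Z + second_deriv p u v Z'"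
proof -
  let ?W = "W \<inter> dom_of (chart_at A p)"
  have W': "open ?W" "p \<in> ?W" "?W \<subseteq> dom_of (chart_at A p)" using W extend_nbhd by auto
  have Z': "smooth_vf A ?W Z" "smooth_vf A ?W Z'" using Z by (auto intro: smooth_vf_subset)
  note s = smooth_vf_conn_extend[OF W'(1,3)]
  have "second_deriv p u v (\<lambda>q. Z q + Z' q) =
      D p u (\<lambda>q. D q (extend A p v q) Z + D q (extend A p v q) Z')"
    by (rule conn_cong[OF W'(1,2) smooth_vf_add[OF W'(1) s s]]) (use Z' W' in \<open>auto intro: conn_add\<close>)
  also have "\<dots> = second_deriv p u v Z + second_deriv p u v Z'"
    by (rule conn_add[OF W'(1,2) s s]) (fact Z')+
  finally show ?thesis .
qed

lemma second_deriv_scale: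
  assumes W: "open W" "p \<in> W" and f: "smooth_fun A W f" and Z: "smooth_vf A W Z"
  shows "second_deriv p u v (\<lambda>q. f q *\<^sub>R Z q) =
    dir_deriv A p u (\<lambda>q. dir_deriv A q (extend A p v q) f) *\<^sub>R Z p + dir_deriv A p v f *\<^sub>R D p u Z
    + dir_deriv A p u f *\<^sub>R D p v Z + f p *\<^sub>R second_deriv p u v Z"
proof -
  let ?W = "W \<inter> dom_of (chart_at A p)"
  have W': "open ?W" "p \<in> ?W" "?W \<subseteq> dom_of (chart_at A p)" using W extend_nbhd by auto
  have Z': "smooth_vf A ?W Z" "smooth_fun A ?W f" using Z f by (auto intro: smooth_vf_subset smooth_fun_subset)
  note s = smooth_vf_conn_extend[OF W'(1,3) Z'(1)] smooth_fun_dir_deriv_extend[OF W'(1,3) Z'(2)]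
  have "second_deriv p u v (\<lambda>q. f q *\<^sub>R Z q) =
      D p u (\<lambda>q. dir_deriv A q (extend A p v q) f *\<^sub>R Z q + f q *\<^sub>R D q (extend A p v q) Z)"
    by (rule conn_cong[OF W'(1,2) smooth_vf_add[OF W'(1) smooth_vf_scale[OF W'(1) s(2) Z'(1)] smooth_vf_scale[OF W'(1) Z'(2) s(1)]]])
      (use Z' W' in \<open>auto intro: conn_scale\<close>)
  also have "\<dots> = D p u (\<lambda>q. dir_deriv A q (extend A p v q) f *\<^sub>R Z q) + D p u (\<lambda>q. f q *\<^sub>R D q (extend A p v q) Z)"
    by (rule conn_add[OF W'(1,2) smooth_vf_scale[OF W'(1) s(2) Z'(1)] smooth_vf_scale[OF W'(1) Z'(2) s(1)]])
  finally show ?thesis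
    using conn_scale[OF W'(1,2) s(2) Z'(1)] conn_scale[OF W'(1,2) Z'(2) s(1)] by simp
qed

text \<open>In the second derivative of f Z, the terms with first derivatives of f are symmetric in
  u and v, and so is the term with the second derivative of f since coordinate fields commute. Only
  f times the curvature term survives.\<close>

lemma tensorial_curvature: "tensorial p (\<lambda>Z. second_deriv p u v Z - second_deriv p v u Z)"
proof (rule tensorialI)
  fix W X X' assume W: "open W" "p \<in> W" and X: "smooth_vf A W X" and eq: "\<And>q. q \<in> W \<Longrightarrow> X' q = X q"
  let ?W = "W \<inter> dom_of (chart_at A p)"
  have W': "open ?W" "p \<in> ?W" "?W \<subseteq> dom_of (chart_at A p)" using W extend_nbhd by auto
  have "second_deriv p u v X' = second_deriv p u v X" for u v
    by (rule conn_cong[OF W'(1,2) smooth_vf_conn_extend[OF W'(1,3) smooth_vf_subset[OF X]]])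
      (use W eq X in \<open>auto intro: conn_cong\<close>)
  then show "second_deriv p u v X' - second_deriv p v u X' = second_deriv p u v X - second_deriv p v u X"
    by simp
next
  fix W X Y assume W: "open W" "p \<in> W" and X: "smooth_vf A W X" "smooth_vf A W Y"
  show "second_deriv p u v (\<lambda>q. X q + Y q) - second_deriv p v u (\<lambda>q. X q + Y q) =
    second_deriv p u v X - second_deriv p v u X + (second_deriv p u v Y - second_deriv p v u Y)"
    by (simp add: second_deriv_add[OF W X])
next
  fix W f X assume W: "open W" "p \<in> W" and f: "smooth_fun A W f" and X: "smooth_vf A W X"
  show "second_deriv p u v (\<lambda>q. f q *\<^sub>R X q) - second_deriv p v u (\<lambda>q. f q *\<^sub>R X q) =
     f p *\<^sub>R (second_deriv p u v X - second_deriv p v u X)"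
    using dir_deriv_extend_commute[OF W f, of u v]
    by (simp add: second_deriv_scale[OF W f X] algebra_simps)
qed

lemma curvature_eq_field:
  assumes "open W" "p \<in> W" "smooth_vf A W Z"
  shows "curvature A D p u v (Z p) = second_deriv p u v Z - second_deriv p v u Z"
  unfolding curvature_eq by (rule tensorial_extend[OF tensorial_curvature assms, symmetric])

lemma linear_curvature: "linear (curvature A D p u v)"
  using linear_tensorial[OF tensorial_curvature] unfolding curvature_eq .

lemma curvature_skew: "curvature A D p u v w = - curvature A D p v u w"
  unfolding curvature_eq by simp

text \<open>The constant extension is itself linear in the vector, so linearity follows from that of
  the connection in its direction.\<close>

lemma linear_curvature_middle: "linear (\<lambda>v. curvature A D p u v w)"
proof (rule linearI)
  let ?W = "dom_of (chart_at A p)"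
  note W = extend_nbhd[of p]
  note s = smooth_vf_conn_extend[OF W(1) order_refl smooth_vf_extend]
  fix v v' :: 'e and k :: real
  have "second_deriv p u (v + v') (extend A p w) =
      D p u (\<lambda>q. D q (extend A p v q) (extend A p w) + D q (extend A p v' q) (extend A p w))"
    by (rule conn_cong[OF W smooth_vf_add[OF W(1) s s]])
      (auto simp: linear_add[OF linear_extend] intro!: conn_vec_add[OF W(1) _ smooth_vf_extend])
  then show "curvature A D p u (v + v') w = curvature A D p u v w + curvature A D p u v' w"
    unfolding curvature_eq using conn_add[OF W s s] conn_vec_add[OF W s] by simp
  have "second_deriv p u (k *\<^sub>R v) (extend A p w) =
      D p u (\<lambda>q. k *\<^sub>R D q (extend A p v q) (extend A p w))"
    by (rule conn_cong[OF W smooth_vf_const_scale[OF W(1) s]])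
      (auto simp: linear_scale[OF linear_extend] intro!: conn_vec_scale[OF W(1) _ smooth_vf_extend])
  then show "curvature A D p u (k *\<^sub>R v) w = k *\<^sub>R curvature A D p u v w"
    unfolding curvature_eq using conn_const_scale[OF W s] conn_vec_scale[OF W s] by (simp add: algebra_simps)
qed

lemma linear_curvature_left: "linear (\<lambda>u. curvature A D p u v w)"
proof -
  have "linear (\<lambda>u. - curvature A D p v u w)"
    by (rule linear_compose_neg[OF linear_curvature_middle])
  then show ?thesis using curvature_skew[of p _ v w] by presburger
qed


subsection \<open>Parallel endomorphisms\<close>

definition parallel_endo :: "('a \<Rightarrow> 'e \<Rightarrow> 'e) \<Rightarrow> bool" where
  "parallel_endo F \<longleftrightarrow> (\<forall>p. linear (F p)) \<and>
    (\<forall>W X. open W \<and> smooth_vf A W X \<longrightarrow> smooth_vf A W (\<lambda>q. F q (X q))) \<and>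
    (\<forall>W X p v. open W \<and> p \<in> W \<and> smooth_vf A W X \<longrightarrow> D p v (\<lambda>q. F q (X q)) = F p (D p v X))"

lemma linear_parallel_endo: "parallel_endo F \<Longrightarrow> linear (F p)"
  by (simp add: parallel_endo_def)

lemma smooth_vf_parallel_endo:
  "parallel_endo F \<Longrightarrow> open W \<Longrightarrow> smooth_vf A W X \<Longrightarrow> smooth_vf A W (\<lambda>q. F q (X q))"
  by (simp add: parallel_endo_def)

lemma conn_parallel_endo:
  "parallel_endo F \<Longrightarrow> open W \<Longrightarrow> p \<in> W \<Longrightarrow> smooth_vf A W X \<Longrightarrow>
    D p v (\<lambda>q. F q (X q)) = F p (D p v X)"
  by (auto simp: parallel_endo_def)

lemma parallel_endo_curvature:
  assumes F: "parallel_endo F"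
  shows "curvature A D p u v (F p w) = F p (curvature A D p u v w)"
proof -
  let ?W = "dom_of (chart_at A p)" and ?X = "extend A p w"
  note W = extend_nbhd[of p]
  note lin = linear_parallel_endo[OF F, of p] and sF = smooth_vf_parallel_endo[OF F] and DF = conn_parallel_endo[OF F]
  note s = smooth_vf_conn_extend[OF W(1) order_refl]
  have "second_deriv p u v (\<lambda>q. F q (?X q)) = F p (second_deriv p u v ?X)" for u v
  proof -
    have "second_deriv p u v (\<lambda>q. F q (?X q)) = D p u (\<lambda>q. F q (D q (extend A p v q) ?X))"
      by (rule conn_cong[OF W sF[OF W(1) s[OF smooth_vf_extend]]]) (rule DF[OF W(1) _ smooth_vf_extend])
    also have "\<dots> = F p (second_deriv p u v ?X)"
      by (rule DF[OF W s[OF smooth_vf_extend]])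
    finally show ?thesis .
  qed
  then show ?thesis
    using curvature_eq_field[OF W sF[OF W(1) smooth_vf_extend], of u v w]
    by (simp add: curvature_eq linear_diff[OF lin])
qed


subsection \<open>The covariant derivative of the torsion\<close>

definition torsion_deriv :: "'a \<Rightarrow> 'e \<Rightarrow> ('a \<Rightarrow> 'e) \<Rightarrow> ('a \<Rightarrow> 'e) \<Rightarrow> 'e" where
  "torsion_deriv p u Y Z = D p u (\<lambda>q. torsion A D q (Y q) (Z q))
     - torsion A D p (D p u Y) (Z p) - torsion A D p (Y p) (D p u Z)"

text \<open>The tensor on vectors is kept apart from \<open>torsion_deriv\<close> on fields, because
  an endomorphism or projection applied to a constant extension is in general no longer such an
  extension.\<close>

definition nabla_torsion :: "'a \<Rightarrow> 'e \<Rightarrow> 'e \<Rightarrow> 'e \<Rightarrow> 'e" where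
  "nabla_torsion p u v w = torsion_deriv p u (extend A p v) (extend A p w)"

lemma torsion_deriv_skew:
  assumes "open W" "p \<in> W" "smooth_vf A W Y" "smooth_vf A W Z"
  shows "torsion_deriv p u Y Z = - torsion_deriv p u Z Y"
proof -
  have "D p u (\<lambda>q. torsion A D q (Y q) (Z q)) = D p u (\<lambda>q. - torsion A D q (Z q) (Y q))"
    by (subst torsion_skew) simp
  also have "\<dots> = - D p u (\<lambda>q. torsion A D q (Z q) (Y q))"
    by (rule conn_minus) (use assms smooth_vf_torsion in auto)
  finally show ?thesis
    using torsion_skew[of p "Y p"] torsion_skew[of p "D p u Y"] by (simp add: torsion_deriv_def)
qed

lemma tensorial_torsion_deriv:
  assumes W: "open W" "p \<in> W" and Z: "smooth_vf A W Z"
  shows "tensorial p (\<lambda>Y. torsion_deriv p u Y Z)"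
proof (rule tensorialI)
  fix W' X X' assume W': "open W'" "p \<in> W'" and X: "smooth_vf A W' X" and eq: "\<And>q. q \<in> W' \<Longrightarrow> X' q = X q"
  have 1: "open (W \<inter> W')" "p \<in> W \<inter> W'" using W W' by auto
  have 2: "smooth_vf A (W \<inter> W') X" "smooth_vf A (W \<inter> W') Z" using X Z by (auto intro: smooth_vf_subset)
  have "D p u (\<lambda>q. torsion A D q (X' q) (Z q)) = D p u (\<lambda>q. torsion A D q (X q) (Z q))"
    by (rule conn_cong[OF 1 smooth_vf_torsion[OF 1(1) 2]]) (simp add: eq)
  then show "torsion_deriv p u X' Z = torsion_deriv p u X Z"
    using conn_cong[OF W' X eq] eq[OF W'(2)] by (simp add: torsion_deriv_def)
next
  fix W' X Y assume W': "open W'" "p \<in> W'" and X: "smooth_vf A W' X" "smooth_vf A W' Y"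
  have 1: "open (W \<inter> W')" "p \<in> W \<inter> W'" using W W' by auto
  have 2: "smooth_vf A (W \<inter> W') X" "smooth_vf A (W \<inter> W') Y" "smooth_vf A (W \<inter> W') Z"
    using X Z by (auto intro: smooth_vf_subset)
  show "torsion_deriv p u (\<lambda>q. X q + Y q) Z = torsion_deriv p u X Z + torsion_deriv p u Y Z"
    using conn_add[OF 1 smooth_vf_torsion[OF 1(1) 2(1,3)] smooth_vf_torsion[OF 1(1) 2(2,3)]] conn_add[OF 1 2(1,2)]
    by (simp add: torsion_deriv_def torsion_simps)
next
  fix W' f X assume W': "open W'" "p \<in> W'" and f: "smooth_fun A W' f" and X: "smooth_vf A W' X"
  have 1: "open (W \<inter> W')" "p \<in> W \<inter> W'" using W W' by auto
  have 2: "smooth_fun A (W \<inter> W') f" "smooth_vf A (W \<inter> W') X" "smooth_vf A (W \<inter> W') Z"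
    using X Z f by (auto intro: smooth_vf_subset smooth_fun_subset)
  show "torsion_deriv p u (\<lambda>q. f q *\<^sub>R X q) Z = f p *\<^sub>R torsion_deriv p u X Z"
    using conn_scale[OF 1 2(1) smooth_vf_torsion[OF 1(1) 2(2,3)]] conn_scale[OF 1 2(1,2)]
    by (simp add: torsion_deriv_def torsion_simps algebra_simps)
qed

lemma torsion_deriv_eq_nabla:
  assumes W: "open W" "p \<in> W" and Y: "smooth_vf A W Y" and Z: "smooth_vf A W Z"
  shows "torsion_deriv p u Y Z = nabla_torsion p u (Y p) (Z p)"
proof -
  let ?E = "extend A p (Y p)"
  let ?W = "W \<inter> dom_of (chart_at A p)"
  have W': "open ?W" "p \<in> ?W" using W extend_nbhd by auto
  have sm: "smooth_vf A ?W Z" "smooth_vf A ?W ?E"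
    using Z smooth_vf_extend by (auto intro: smooth_vf_subset)
  have "torsion_deriv p u Y Z = torsion_deriv p u ?E Z"
    by (rule tensorial_extend[OF tensorial_torsion_deriv[OF W Z] W Y])
  also have "\<dots> = - torsion_deriv p u Z ?E"
    by (rule torsion_deriv_skew[OF W' sm(2,1)])
  also have "torsion_deriv p u Z ?E = torsion_deriv p u (extend A p (Z p)) ?E"
    by (rule tensorial_extend[OF tensorial_torsion_deriv[OF extend_nbhd smooth_vf_extend] W Z])
  also have "- \<dots> = torsion_deriv p u ?E (extend A p (Z p))"
    using torsion_deriv_skew[OF extend_nbhd smooth_vf_extend smooth_vf_extend, of p u "Y p" "Z p"] by simp
  finally show ?thesis by (simp add: nabla_torsion_def)
qed

lemma nabla_torsion_skew: "nabla_torsion p u v w = - nabla_torsion p u w v"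
  unfolding nabla_torsion_def by (rule torsion_deriv_skew[OF extend_nbhd smooth_vf_extend smooth_vf_extend])

text \<open>For commuting fields T(Y,Z) is the covariant derivative of Z along Y minus that of Y
  along Z. Differentiating this along X and summing cyclically gives the curvature on one side; on
  the other, the product rule gives the derivative of T and terms T(D Y, Z), which recombine to
  T(T(.,.),.) by the same formula.\<close>

lemma first_bianchi:
  "curvature A D p x y z + curvature A D p y z x + curvature A D p z x y =
    torsion A D p (torsion A D p x y) z + torsion A D p (torsion A D p y z) x + torsion A D p (torsion A D p z x) y
    + nabla_torsion p x y z + nabla_torsion p y z x + nabla_torsion p z x y"
proof -
  let ?E = "extend A p" and ?T = "torsion A D p"
  note W = extend_nbhd[of p] and E = smooth_vf_extend[of p]
  have s: "smooth_vf A (dom_of (chart_at A p)) (\<lambda>q. D q (?E v q) (?E w))" for v w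
    by (rule smooth_vf_conn[OF W(1) E E])
  have 1: "second_deriv p u v (?E w) - second_deriv p u w (?E v) =
      nabla_torsion p u v w + ?T (D p u (?E v)) w + ?T v (D p u (?E w))" for u v w
  proof -
    have "second_deriv p u v (?E w) - second_deriv p u w (?E v) =
        D p u (\<lambda>q. D q (?E v q) (?E w) - D q (?E w q) (?E v))"
      by (rule conn_diff[OF W s s, symmetric])
    also have "\<dots> = D p u (\<lambda>q. torsion A D q (?E v q) (?E w q))"
      by (rule conn_cong[OF W smooth_vf_torsion[OF W(1) E E]]) (simp add: torsion_extend)
    finally show ?thesis by (simp add: nabla_torsion_def torsion_deriv_def)
  qed
  have 2: "?T u v = D p u (?E v) - D p v (?E u)" for u v
    using torsion_extend[OF W(2), of u v] by simp
  have 3: "?T (?T u v) w = ?T (D p u (?E v)) w + ?T w (D p v (?E u))" for u v w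
    unfolding 2[of u v] by (simp add: torsion_simps torsion_skew[of p w])
  show ?thesis
    unfolding curvature_eq 3 using 1[of x y z] 1[of y z x] 1[of z x y] by (simp add: algebra_simps)
qed

text \<open>Two derivatives of T(W,Z) fall on W and Z alone when T is parallel. The terms with one
  derivative on each factor are symmetric in u and v and drop out, so the curvature acts on T as a
  derivation.\<close>

lemma curvature_torsion:
  assumes par: "\<And>q u v w. nabla_torsion q u v w = 0"
  shows "curvature A D p u v (torsion A D p w z) =
    torsion A D p (curvature A D p u v w) z + torsion A D p w (curvature A D p u v z)"
proof -
  let ?W = "dom_of (chart_at A p)" and ?E = "extend A p"
  note W = extend_nbhd[of p] and E = smooth_vf_extend[of p]
  let ?t = "\<lambda>Y Z q. torsion A D q (Y q) (Z q)"
  have DT: "D q u (?t Y Z) = torsion A D q (D q u Y) (Z q) + torsion A D q (Y q) (D q u Z)"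
    if "q \<in> ?W" "smooth_vf A ?W Y" "smooth_vf A ?W Z" for q u Y Z
    using torsion_deriv_eq_nabla[OF W(1) that] par by (simp add: torsion_deriv_def algebra_simps)
  have sT: "smooth_vf A ?W (?t Y Z)" if "smooth_vf A ?W Y" "smooth_vf A ?W Z" for Y Z
    by (rule smooth_vf_torsion[OF W(1) that])
  have s: "smooth_vf A ?W (\<lambda>q. D q (?E v q) (?E w))" for v w
    by (rule smooth_vf_conn[OF W(1) E E])
  have 1: "second_deriv p u v (?t (?E w) (?E z)) =
      torsion A D p (second_deriv p u v (?E w)) z + torsion A D p (D p v (?E w)) (D p u (?E z))
      + torsion A D p (D p u (?E w)) (D p v (?E z)) + torsion A D p w (second_deriv p u v (?E z))" for u v
  proof -
    have "second_deriv p u v (?t (?E w) (?E z)) =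
        D p u (\<lambda>q. torsion A D q (D q (?E v q) (?E w)) (?E z q) + torsion A D q (?E w q) (D q (?E v q) (?E z)))"
      by (rule conn_cong[OF W smooth_vf_add[OF W(1) sT[OF s E] sT[OF E s]]]) (rule DT[OF _ E E])
    also have "\<dots> = D p u (?t (\<lambda>q. D q (?E v q) (?E w)) (?E z)) + D p u (?t (?E w) (\<lambda>q. D q (?E v q) (?E z)))"
      by (rule conn_add[OF W sT[OF s E] sT[OF E s]])
    finally show ?thesis
      unfolding DT[OF W(2) s E] DT[OF W(2) E s] by simp
  qed
  show ?thesis
    using curvature_eq_field[OF W sT[OF E E], of u v w z]
    unfolding curvature_eq 1 by (simp add: torsion_simps)
qed

text \<open>An algebraic identity between the torsion and a parallel endomorphism passes to the
  derivative of the torsion, since the endomorphism commutes with the derivative.\<close>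

lemma nabla_torsion_endo:
  assumes F: "parallel_endo F" and TF: "\<And>q u v. torsion A D q (F q u) v = torsion A D q u (F q v)"
  shows "nabla_torsion p u (F p v) w = nabla_torsion p u v (F p w)"
proof -
  note W = extend_nbhd[of p] and E = smooth_vf_extend[of p]
  note sF = smooth_vf_parallel_endo[OF F W(1) E] and DF = conn_parallel_endo[OF F W E]
  show ?thesis
    using torsion_deriv_eq_nabla[OF W sF E, of u v w] torsion_deriv_eq_nabla[OF W E sF, of u v w]
    by (simp add: torsion_deriv_def DF TF)
qed

lemma nabla_torsion_endo_neg:
  assumes F: "parallel_endo F" and TF: "\<And>q u v. torsion A D q u (F q v) = - F q (torsion A D q u v)"
  shows "nabla_torsion p u v (F p w) = - F p (nabla_torsion p u v w)"
proof -
  note W = extend_nbhd[of p] and E = smooth_vf_extend[of p]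
  note lin = linear_parallel_endo[OF F, of p] and sF = smooth_vf_parallel_endo[OF F] and DF = conn_parallel_endo[OF F]
  have sT: "smooth_vf A (dom_of (chart_at A p)) (\<lambda>q. torsion A D q (extend A p v q) (extend A p w q))"
    by (rule smooth_vf_torsion[OF W(1) E E])
  have "nabla_torsion p u v (F p w) = torsion_deriv p u (extend A p v) (\<lambda>q. F q (extend A p w q))"
    using torsion_deriv_eq_nabla[OF W E sF[OF W(1) E], of u v w] by simp
  also have "\<dots> = - F p (torsion_deriv p u (extend A p v) (extend A p w))"
    using conn_minus[OF W sF[OF W(1) sT], of u] DF[OF W sT, of u]
    by (simp add: torsion_deriv_def DF[OF W E] TF linear_diff[OF lin])
  finally show ?thesis by (simp add: nabla_torsion_def)
qed

end


section \<open>Metric connections\<close>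

locale metric_connection = connection A D
  for A :: "('a::topological_space, 'e::euclidean_space) chart set" and D :: "('a, 'e) conn" +
  fixes g :: "'a \<Rightarrow> 'e \<Rightarrow> 'e \<Rightarrow> real"
  assumes riemannian_metric: "riemannian_metric A g"
    and parallel_metric: "parallel_form2 A D g"
begin

lemma metric_commute: "g p u v = g p v u"
  using riemannian_metric by (simp add: riemannian_metric_def positive_definite_def)

lemma linear_metric_right: "linear (g p u)"
  using riemannian_metric by (simp add: riemannian_metric_def positive_definite_def)

lemma linear_metric_left: "linear (\<lambda>u. g p u v)"
  by (subst metric_commute) (rule linear_metric_right)

lemmas metric_simps = linear_add[OF linear_metric_left] linear_add[OF linear_metric_right]
  linear_scale[OF linear_metric_left] linear_scale[OF linear_metric_right]
  linear_diff[OF linear_metric_left] linear_diff[OF linear_metric_right]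
  linear_neg[OF linear_metric_left] linear_neg[OF linear_metric_right]
  linear_0[OF linear_metric_left] linear_0[OF linear_metric_right]

lemma metric_pos: "v \<noteq> 0 \<Longrightarrow> g p v v > 0"
  using riemannian_metric by (simp add: riemannian_metric_def positive_definite_def)

lemma metric_eqI:
  assumes "\<And>w. g p u w = g p v w"
  shows "u = v"
proof (rule ccontr)
  assume "u \<noteq> v"
  then have "g p (u - v) (u - v) > 0" by (intro metric_pos) simp
  then show False using assms[of "u - v"] by (simp add: metric_simps)
qed

lemma smooth_fun_metric:
  "open W \<Longrightarrow> smooth_vf A W X \<Longrightarrow> smooth_vf A W Y \<Longrightarrow> smooth_fun A W (\<lambda>q. g q (X q) (Y q))"
  using riemannian_metric by (simp add: riemannian_metric_def smooth_form2_def)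

lemma dir_deriv_metric:
  assumes "open W" "p \<in> W" "smooth_vf A W Y" "smooth_vf A W Z"
  shows "dir_deriv A p v (\<lambda>q. g q (Y q) (Z q)) = g p (D p v Y) (Z p) + g p (Y p) (D p v Z)"
  using parallel_metric[unfolded parallel_form2_def, THEN conjunct2] assms by blast

text \<open>The second derivatives of the function g(W,Z) along coordinate fields commute; expanding
  both orders with the parallel metric leaves exactly the two curvature terms.\<close>

lemma curvature_metric_skew: "g p (curvature A D p u v w) z = - g p (curvature A D p u v z) w"
proof -
  let ?W = "dom_of (chart_at A p)" and ?E = "extend A p"
  note W = extend_nbhd[of p] and E = smooth_vf_extend[of p]
  have s: "smooth_vf A ?W (\<lambda>q. D q (?E v q) (?E w))" for v w
    by (rule smooth_vf_conn[OF W(1) E E])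
  have "dir_deriv A p u (\<lambda>q. dir_deriv A q (?E v q) (\<lambda>q. g q (?E w q) (?E z q))) =
      g p (second_deriv p u v (?E w)) z + g p (D p v (?E w)) (D p u (?E z))
      + (g p (D p u (?E w)) (D p v (?E z)) + g p w (second_deriv p u v (?E z)))" for u v
  proof -
    have 1: "smooth_fun A ?W (\<lambda>q. g q (D q (?E v q) (?E w)) (?E z q))"
      "smooth_fun A ?W (\<lambda>q. g q (?E w q) (D q (?E v q) (?E z)))"
      by (rule smooth_fun_metric[OF W(1) s E] smooth_fun_metric[OF W(1) E s])+
    have "dir_deriv A p u (\<lambda>q. dir_deriv A q (?E v q) (\<lambda>q. g q (?E w q) (?E z q))) =
        dir_deriv A p u (\<lambda>q. g q (D q (?E v q) (?E w)) (?E z q) + g q (?E w q) (D q (?E v q) (?E z)))"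
      by (rule dir_deriv_cong[OF W smooth_fun_add[OF W(1) 1]]) (rule dir_deriv_metric[OF W(1) _ E E])
    also have "\<dots> = dir_deriv A p u (\<lambda>q. g q (D q (?E v q) (?E w)) (?E z q))
        + dir_deriv A p u (\<lambda>q. g q (?E w q) (D q (?E v q) (?E z)))"
      by (rule dir_deriv_add[OF W 1])
    finally show ?thesis
      unfolding dir_deriv_metric[OF W s E] dir_deriv_metric[OF W E s] by simp
  qed
  moreover have "dir_deriv A p u (\<lambda>q. dir_deriv A q (?E v q) (\<lambda>q. g q (?E w q) (?E z q))) =
      dir_deriv A p v (\<lambda>q. dir_deriv A q (?E u q) (\<lambda>q. g q (?E w q) (?E z q)))"
    by (rule dir_deriv_extend_commute[OF W smooth_fun_metric[OF W(1) E E]])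
  ultimately show ?thesis
    unfolding curvature_eq by (simp add: metric_simps metric_commute[of p w])
qed

end

locale skew_torsion_connection = metric_connection +
  assumes alternating_torsion: "alternating3 (torsion_form A g D p)"
begin

lemma torsion_form_skew_right: "g p (torsion A D p u v) w = - g p (torsion A D p u w) v"
  using alternating_torsion[of p] unfolding alternating3_def torsion_form_def by blast

lemma torsion_form_cyclic: "g p (torsion A D p u v) w = g p (torsion A D p v w) u"
  using torsion_form_skew_right[of p v u w] torsion_skew[of p u v] by (simp add: metric_simps)

lemma nabla_torsion_metric_skew: "g p (nabla_torsion p u v w) z = - g p (nabla_torsion p u v z) w"
proof -
  let ?W = "dom_of (chart_at A p)" and ?E = "extend A p"
  note W = extend_nbhd[of p] and E = smooth_vf_extend[of p]
  have sT: "smooth_vf A ?W (\<lambda>q. torsion A D q (?E v q) (?E w q))" for w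
    by (rule smooth_vf_torsion[OF W(1) E E])
  have 1: "dir_deriv A p u (\<lambda>q. g q (torsion A D q (?E v q) (?E w q)) (?E z q)) =
      g p (nabla_torsion p u v w) z + g p (torsion A D p (D p u (?E v)) w) z
      + g p (torsion A D p v (D p u (?E w))) z + g p (torsion A D p v w) (D p u (?E z))" for w z
    using dir_deriv_metric[OF W sT E] by (simp add: nabla_torsion_def torsion_deriv_def metric_simps)
  have "dir_deriv A p u (\<lambda>q. g q (torsion A D q (?E v q) (?E w q)) (?E z q)) =
      dir_deriv A p u (\<lambda>q. (- 1) * g q (torsion A D q (?E v q) (?E z q)) (?E w q))"
    unfolding mult_minus1 by (subst torsion_form_skew_right) (rule refl)
  also have "\<dots> = - dir_deriv A p u (\<lambda>q. g q (torsion A D q (?E v q) (?E z q)) (?E w q))"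
    by (subst dir_deriv_mult[OF W smooth_fun_const smooth_fun_metric[OF W(1) sT E]]) simp
  finally show ?thesis
    unfolding 1
    using torsion_form_skew_right[of p "D p u (?E v)" w z] torsion_form_skew_right[of p v "D p u (?E w)" z]
      torsion_form_skew_right[of p v w "D p u (?E z)"] by simp
qed

text \<open>The difference b of the two connections is a tensor. Both preserve g, so b is skew in
  its last two slots; comparing torsions fixes its skew part in the first two. The permutation
  argument of the Koszul formula then determines b, and the total skew-symmetry of the torsion
  leaves -1/2 T.\<close>

lemma levi_civita_eq:
  assumes LC: "levi_civita A g D'" and W: "open W" "p \<in> W" and Y: "smooth_vf A W Y"
  shows "D' p u Y = D p u Y - (1 / 2) *\<^sub>R torsion A D p u (Y p)"
proof -
  interpret lc: metric_connection A D' g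
    using LC riemannian_metric by unfold_locales (auto simp: levi_civita_def)
  have torsion0: "torsion A D' p u v = 0" for u v
    using LC by (simp add: levi_civita_def)
  let ?E = "extend A p"
  note Wp = extend_nbhd[of p] and E = smooth_vf_extend[of p]
  have tens: "tensorial p (\<lambda>Y. D' p u Y - D p u Y)"
  proof (rule tensorialI)
    fix W X X' assume W: "open W" "p \<in> W" and X: "smooth_vf A W X" and eq: "\<And>q. q \<in> W \<Longrightarrow> X' q = X q"
    show "D' p u X' - D p u X' = D' p u X - D p u X"
      using conn_cong[OF W X eq] lc.conn_cong[OF W X eq] by simp
  next
    fix W X Y assume W: "open W" "p \<in> W" and X: "smooth_vf A W X" "smooth_vf A W Y"
    show "D' p u (\<lambda>q. X q + Y q) - D p u (\<lambda>q. X q + Y q) = D' p u X - D p u X + (D' p u Y - D p u Y)"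
      using conn_add[OF W X] lc.conn_add[OF W X] by simp
  next
    fix W f X assume W: "open W" "p \<in> W" and f: "smooth_fun A W f" and X: "smooth_vf A W X"
    show "D' p u (\<lambda>q. f q *\<^sub>R X q) - D p u (\<lambda>q. f q *\<^sub>R X q) = f p *\<^sub>R (D' p u X - D p u X)"
      using conn_scale[OF W f X] lc.conn_scale[OF W f X] by (simp add: algebra_simps)
  qed
  define b where "b u v w = g p (D' p u (?E v) - D p u (?E v)) w" for u v w
  define t where "t u v w = g p (torsion A D p u v) w" for u v w
  have skew: "b u v w = - b u w v" for u v w
    using dir_deriv_metric[OF Wp E E, of u v w] lc.dir_deriv_metric[OF Wp E E, of u v w]
    by (simp add: b_def metric_simps metric_commute[of p v])
  have tor: "b u v w = b v u w - t u v w" for u v w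
    using torsion_extend[OF Wp(2), of u v] lc.torsion_extend[OF Wp(2), of u v] torsion0[of u v]
    by (simp add: b_def t_def metric_simps)
  have cyc: "t u v w = t v w u" for u v w
    unfolding t_def by (rule torsion_form_cyclic)
  have "b u v w = - (1 / 2) * t u v w" for u v w
    using tor[of u v w] skew[of v u w] tor[of v w u] skew[of w v u] tor[of w u v] skew[of u w v]
      cyc[of u v w] cyc[of v w u] by linarith
  then have "D' p u (?E v) - D p u (?E v) = (- (1 / 2)) *\<^sub>R torsion A D p u v" for v
    by (intro metric_eqI[of p]) (simp add: b_def t_def metric_simps)
  from this[of "Y p"] have "D' p u Y - D p u Y = (- (1 / 2)) *\<^sub>R torsion A D p u (Y p)"
    unfolding tensorial_extend[OF tens W Y] .
  then show ?thesis by (simp add: algebra_simps)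
qed

text \<open>With parallel torsion, differentiating T(v,w) only differentiates the fields. After
  antisymmetrizing in u and v, the terms with derivatives of W cancel and those with derivatives of
  the other two fields combine to T(T(u,v),w).\<close>

lemma levi_civita_curvature:
  assumes LC: "levi_civita A g D'" and par: "\<And>q u v w. nabla_torsion q u v w = 0"
  shows "curvature A D' p u v w = curvature A D p u v w
    - (1 / 2) *\<^sub>R torsion A D p (torsion A D p u v) w
    + (1 / 4) *\<^sub>R (torsion A D p u (torsion A D p v w) - torsion A D p v (torsion A D p u w))"
proof -
  interpret lc: metric_connection A D' g
    using LC riemannian_metric by unfold_locales (auto simp: levi_civita_def)
  let ?W = "dom_of (chart_at A p)" and ?E = "extend A p" and ?T = "torsion A D p"
  note W = extend_nbhd[of p] and E = smooth_vf_extend[of p]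
  have s: "smooth_vf A ?W (\<lambda>q. D q (?E v q) (?E w))" for v w
    by (rule smooth_vf_conn[OF W(1) E E])
  have sT: "smooth_vf A ?W (\<lambda>q. torsion A D q (?E v q) (?E w q))" for v w
    by (rule smooth_vf_torsion[OF W(1) E E])
  note sT' = smooth_vf_const_scale[OF W(1) sT, where k = "1/2"]
  have 1: "lc.second_deriv p u v (?E w) = second_deriv p u v (?E w)
      - (1 / 2) *\<^sub>R (?T (D p u (?E v)) w + ?T v (D p u (?E w)))
      - (1 / 2) *\<^sub>R ?T u (D p v (?E w)) + (1 / 4) *\<^sub>R ?T u (?T v w)" for u v
  proof -
    have "lc.second_deriv p u v (?E w) =
        D' p u (\<lambda>q. D q (?E v q) (?E w) - (1 / 2) *\<^sub>R torsion A D q (?E v q) (?E w q))"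
      by (rule lc.conn_cong[OF W smooth_vf_diff[OF W(1) s sT']]) (rule levi_civita_eq[OF LC W(1) _ E])
    also have "\<dots> = D p u (\<lambda>q. D q (?E v q) (?E w) - (1 / 2) *\<^sub>R torsion A D q (?E v q) (?E w q))
        - (1 / 2) *\<^sub>R ?T u (D p v (?E w) - (1 / 2) *\<^sub>R ?T v w)"
      using levi_civita_eq[OF LC W smooth_vf_diff[OF W(1) s sT'], of u] by simp
    also have "D p u (\<lambda>q. D q (?E v q) (?E w) - (1 / 2) *\<^sub>R torsion A D q (?E v q) (?E w q)) =
        second_deriv p u v (?E w) - (1 / 2) *\<^sub>R D p u (\<lambda>q. torsion A D q (?E v q) (?E w q))"
      using conn_diff[OF W s sT'] conn_const_scale[OF W sT] by simp
    also have "D p u (\<lambda>q. torsion A D q (?E v q) (?E w q)) = ?T (D p u (?E v)) w + ?T v (D p u (?E w))"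
      using par[of p u v w] by (simp add: nabla_torsion_def torsion_deriv_def algebra_simps)
    finally show ?thesis by (simp add: torsion_simps algebra_simps)
  qed
  have 2: "?T (?T u v) w = ?T (D p u (?E v)) w - ?T (D p v (?E u)) w"
    using torsion_extend[OF W(2), of u v] by (simp add: torsion_simps)
  show ?thesis
    unfolding curvature_eq lc.curvature_eq 1 2 by (simp add: algebra_simps)
qed

end


section \<open>Pointwise algebra\<close>

text \<open>Adding the cyclic identity to the one with \<open>z\<close> and \<open>w\<close>
  exchanged shows that U also changes sign when its first and last arguments are exchanged. So U is
  a 4-form, and the cyclic sum of a 4-form is 3 U.\<close>

lemma cyclic_alternating_zero:
  fixes U :: "'e \<Rightarrow> 'e \<Rightarrow> 'e \<Rightarrow> 'e \<Rightarrow> real"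
  assumes skew: "\<And>x y z w. U x z y w = - U x y z w" "\<And>x y z w. U x y w z = - U x y z w"
    and cyc: "\<And>x y z w. U x y z w + U y z x w + U z x y w = 0"
  shows "U x y z w = 0"
proof -
  have swap: "U z x y w = - U w x y z" for x y z w
    using cyc[of x y z w] cyc[of x y w z] skew(2)[of x y z w] skew(2)[of y w x z] skew(1)[of y w x z]
      skew(2)[of y x w z] skew(1)[of y x z w] by linarith
  have rot: "U x y z w = U y z x w" for x y z w
    using swap[of x z w y] skew(1)[of x z y w] skew(2)[of x z w y] skew(2)[of y z w x] by linarith
  show ?thesis
    using cyc[of x y z w] rot[of x y z w] rot[of y z x w] by linarith
qed

text \<open>
  Kirichenko's theorem: the canonical Hermitian connection of a nearly Kaehler manifold has
  parallel torsion. Each step projects the first Bianchi identity to one type with respect to \<open>I\<close>;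
  the projection to the type where arguments \<open>1\<close> and \<open>j\<close> agree (differ) is the operator
  \<open>1 - I\<^sub>1 I\<^sub>j\<close> (\<open>1 + I\<^sub>1 I\<^sub>j\<close>), where \<open>I\<^sub>k\<close> applies \<open>I\<close> to argument \<open>k\<close>.
\<close>

lemma nearly_kaehler_parallel_torsion:
  fixes R N G :: "'e \<Rightarrow> 'e \<Rightarrow> 'e \<Rightarrow> 'e \<Rightarrow> real" and I :: "'e \<Rightarrow> 'e"
  assumes R34: "\<And>x y z w. R x y w z = - R x y z w"
    and RI: "\<And>x y z w. R x y (I z) w = - R x y z (I w)"
    and N: "\<And>x y z w. N x z y w = - N x y z w" "\<And>x y z w. N x y w z = - N x y z w"
    and NI: "\<And>x y z w. N x (I y) z w = N x y z (I w)" "\<And>x y z w. N x y (I z) w = N x y z (I w)"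
    and GI: "\<And>x y z w. G (I x) y z w = - G x y z (I w)" "\<And>x y z w. G x (I y) z w = - G x y z (I w)"
      "\<And>x y z w. G x y (I z) w = G x y z (I w)"
    and II: "\<And>x y z w. R x y z (I (I w)) = - R x y z w" "\<And>x y z w. N x y z (I (I w)) = - N x y z w"
      "\<And>x y z w. G x y z (I (I w)) = - G x y z w"
    and bianchi: "\<And>x y z w. R x y z w + R y z x w + R z x y w =
      G x y z w + G y z x w + G z x y w + N x y z w + N y z x w + N z x y w"
  shows "N x y z w = 0"
proof -
  note rules = RI NI GI II minus_minus
  \<comment> \<open>\<open>U\<close> is twice the part of N in which all four arguments have one
    type. In that type no R or G term exists: R has opposite types in its last two slots, and the
    two pairs of G have opposite types. So the cyclic sum of \<open>U\<close> vanishes.\<close>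
  have A: "N (I x) y z (I w) = N x y z w" for x y z w
  proof -
    define U where "U x y z w = N x y z w - N (I x) y z (I w)" for x y z w
    have "U x y z w + U y z x w + U z x y w = 0" for x y z w
      using bianchi[of x y z w] bianchi[of "I x" "I y" z w] bianchi[of "I x" y "I z" w] bianchi[of "I x" y z "I w"]
        bianchi[of x "I y" "I z" w] bianchi[of x "I y" z "I w"] bianchi[of x y "I z" "I w"]
        bianchi[of "I x" "I y" "I z" "I w"]
      unfolding U_def rules by linarith
    moreover have "U x z y w = - U x y z w" "U x y w z = - U x y z w" for x y z w
      unfolding U_def using N(1)[of x y z w] N(1)[of "I x" y z "I w"] N(2)[of x y z w]
        N(2)[of "I x" y z "I w"] NI(2)[of "I x" y w z] by simp_all
    ultimately have "U x y z w = 0" by (rule cyclic_alternating_zero[rotated 2])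
    then show ?thesis by (simp add: U_def)
  qed
  \<comment> \<open>Projection to the type where y, z, w agree and x is opposite. Of the R terms
    only R(y,z,x,w) has such a part, of the N terms only N(x,y,z,w) by \<open>A\<close>, and G has
    none.\<close>
  have B: "R y z x w + R (I y) z x (I w) * (- 1) + - R y (I z) x (I w) - R (I y) (I z) x w = 4 * N x y z w"
    for x y z w
    using bianchi[of x y z w] bianchi[of "I x" "I y" z w] bianchi[of "I x" y "I z" w] bianchi[of "I x" y z "I w"]
      bianchi[of x "I y" "I z" w] bianchi[of x "I y" z "I w"] bianchi[of x y "I z" "I w"]
      bianchi[of "I x" "I y" "I z" "I w"] A[of x y z w] A[of x y z "I w"] A[of y z x w] A[of y z x "I w"]
      A[of z x y w] A[of z x y "I w"]
    unfolding rules by linarith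
  {
  fix x y z w
  have C: "R x y z w + R (I x) y z (I w) + R x (I y) z (I w) - R (I x) (I y) z w = - 4 * N w x y z" for x y z w
    using B[of x y w z] R34[of x y z w] R34[of "I x" y w "I z"] R34[of x "I y" w "I z"] R34[of "I x" "I y" z w]
    unfolding rules by linarith
  \<comment> \<open>Projection to the type where x, y, z agree and w is opposite. All three R terms
    survive and the right-hand side vanishes, so \<open>C\<close> turns the identity into a cyclic
    sum of N; N is alternating in these slots, hence zero.\<close>
  have D: "N w x y z + N w y z x + N w z x y = 0"
    using bianchi[of x y z w] bianchi[of "I x" "I y" z w] bianchi[of "I x" y "I z" w] bianchi[of "I x" y z "I w"]
      bianchi[of x "I y" "I z" w] bianchi[of x "I y" z "I w"] bianchi[of x y "I z" "I w"]
      bianchi[of "I x" "I y" "I z" "I w"] A[of x y z w] A[of x y z "I w"] A[of y z x w] A[of y z x "I w"]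
      A[of z x y w] A[of z x y "I w"] C[of x y z w] C[of y z x w] C[of z x y w]
    unfolding rules by linarith
  note D
  }
  then have "N x y z w + N x z w y + N x w y z = 0" .
  then show ?thesis
    using N(1)[of x y z w] N(2)[of x z y w] N(1)[of x y w z] N(2)[of x y z w] by linarith
qed

text \<open>The symmetries of G make the right-hand side of the Bianchi identity a 4-form. In the
  sum of the first two cyclic shifts minus the other two, the 4-form cancels because a 4-cycle is
  odd, and twice the desired difference remains.\<close>

lemma curvature_pair_symmetry:
  fixes R G :: "'e \<Rightarrow> 'e \<Rightarrow> 'e \<Rightarrow> 'e \<Rightarrow> real"
  assumes R12: "\<And>x y z w. R y x z w = - R x y z w" and R34: "\<And>x y z w. R x y w z = - R x y z w"
    and G12: "\<And>x y z w. G y x z w = - G x y z w" and Gsym: "\<And>x y z w. G z w x y = G x y z w"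
    and bianchi: "\<And>x y z w. R x y z w + R y z x w + R z x y w = G x y z w + G y z x w + G z x y w"
  shows "R x y z w = R z w x y"
proof -
  have G34: "G x y w z = - G x y z w" for x y z w
    using G12[of w z x y] Gsym[of x y z w] Gsym[of x y w z] by simp
  show ?thesis
  using bianchi[of x y z w] bianchi[of y z w x] bianchi[of z w x y] bianchi[of w x y z]
    R34[of y z x w] R34[of z w x y] R12[of y w z x] R34[of y w x z] R34[of w x y z] R12[of z x w y]
    R34[of z x y w] R34[of x y z w]
    G34[of y z x w] G34[of z w x y] G12[of y w z x] G34[of y w x z] G34[of w x y z] G12[of z x w y]
    G34[of z x y w] G34[of x y z w] Gsym[of x y z w] Gsym[of y z x w] Gsym[of x z y w]
    G12[of x w y z] G12[of x z y w]
  by linarith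
qed


subsection \<open>Orthonormal frames and quaternionic subspaces\<close>

lemma orthonormal_independent:
  fixes b :: "'e::real_vector \<Rightarrow> 'e \<Rightarrow> real"
  assumes b: "positive_definite b" and E: "\<And>x y. x \<in> E \<Longrightarrow> y \<in> E \<Longrightarrow> b x y = (if x = y then 1 else 0)"
  shows "independent E"
proof
  assume "dependent E"
  then obtain e where e: "e \<in> E" "e \<in> span (E - {e})"
    unfolding dependent_def by blast
  have lin: "linear (b e)" using b by (simp add: positive_definite_def)
  have "b e e = 0"
    by (rule linear_eq_0_on_span[OF lin _ e(2)]) (use E e in auto)
  then show False using E[OF e(1) e(1)] by simp
qed

text \<open>An orthonormal set of largest cardinality spans, since one Gram-Schmidt step would
  enlarge it otherwise.\<close>

lemma orthonormal_frame_exists: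
  fixes b :: "'e::euclidean_space \<Rightarrow> 'e \<Rightarrow> real"
  assumes b: "positive_definite b"
  shows "\<exists>E. orthonormal_frame b E"
proof -
  let ?O = "\<lambda>E. \<forall>x\<in>E. \<forall>y\<in>E. b x y = (if x = y then 1 else 0)"
  have lin: "linear (b u)" and sym: "b u v = b v u" and pos: "v \<noteq> 0 \<Longrightarrow> b v v > 0" for u v
    using b by (auto simp: positive_definite_def)
  have lin': "linear (\<lambda>u. b u v)" for v by (subst sym) (rule lin)
  have ind: "finite E \<and> card E \<le> DIM('e)" if "?O E" for E
    by (rule independent_bound[OF orthonormal_independent[OF b]]) (use that in auto)
  have "\<exists>E. ?O E \<and> (\<forall>E'. ?O E' \<longrightarrow> card E' \<le> card E)"
    by (rule ex_has_greatest_nat[of _ "{}" _ "DIM('e) + 1"]) (use ind in \<open>auto simp: less_Suc_eq_le\<close>)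
  then obtain E where E: "?O E" and max: "\<And>E'. ?O E' \<Longrightarrow> card E' \<le> card E" by blast
  have fin: "finite E" using ind[OF E] by simp
  have "x \<in> span E" for x
  proof (rule ccontr)
    assume x: "x \<notin> span E"
    define y where "y = x - (\<Sum>e\<in>E. b x e *\<^sub>R e)"
    have "y \<noteq> 0"
    proof
      assume "y = 0"
      then have "x = (\<Sum>e\<in>E. b x e *\<^sub>R e)" by (simp add: y_def)
      also have "\<dots> \<in> span E" by (intro span_sum span_scale span_base)
      finally show False using x by simp
    qed
    then have y: "b y y > 0" by (rule pos)
    have ye: "b y e = 0" if "e \<in> E" for e
    proof -
      have "(\<Sum>f\<in>E. b x f * b f e) = (\<Sum>f\<in>E. if f = e then b x e else 0)"
        by (rule sum.cong) (use E that in auto)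
      then show ?thesis
        using that fin by (simp add: y_def linear_diff[OF lin'] linear_sum[OF lin'] linear_scale[OF lin'])
    qed
    define z where "z = (1 / sqrt (b y y)) *\<^sub>R y"
    have z: "b z z = 1" "b z e = 0" "b e z = 0" if "e \<in> E" for e
      using y ye[OF that] sym[of e y]
      by (simp_all add: z_def linear_scale[OF lin] linear_scale[OF lin'] field_simps)
    have zz: "b z z = 1"
      using y by (simp add: z_def linear_scale[OF lin] linear_scale[OF lin'] field_simps)
    have "z \<notin> E" using z(2) zz by force
    moreover have "?O (insert z E)" using E z zz by auto
    ultimately show False using max[of "insert z E"] fin by simp
  qed
  then show ?thesis using E fin unfolding orthonormal_frame_def by blast
qed

text \<open>The span of \<open>x, J x, a x, J a x\<close> is a line over the quaternion algebra generated by \<open>J\<close> and \<open>a\<close>.\<close>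

lemma quaternionic_dim:
  fixes J a :: "'e::euclidean_space \<Rightarrow> 'e"
  assumes S: "subspace S" and J: "linear J" and a: "linear a"
    and JJ: "\<And>x. J (J x) = - x" and aJ: "\<And>x. a (J x) = - J (a x)"
    and aa: "\<And>x. x \<in> S \<Longrightarrow> a (a x) = - k *\<^sub>R x" and k: "k > 0"
    and inv: "\<And>x. x \<in> S \<Longrightarrow> J x \<in> S" "\<And>x. x \<in> S \<Longrightarrow> a x \<in> S"
  shows "4 dvd dim S"
proof -
  let ?I = "\<lambda>U. subspace U \<and> U \<subseteq> S \<and> (\<forall>x\<in>U. J x \<in> U \<and> a x \<in> U) \<and> 4 dvd dim U"
  note simps = linear_add[OF J] linear_add[OF a] linear_scale[OF J] linear_scale[OF a] linear_neg[OF J]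
    linear_neg[OF a] linear_diff[OF J] linear_diff[OF a] linear_0[OF J] linear_0[OF a]
  \<comment> \<open>An invariant subspace of largest dimension divisible by 4 is chosen. If it
    misses a vector of \<open>S\<close>, the quaternionic line of that vector can be added to
    it.\<close>
  have "\<exists>U. ?I U \<and> (\<forall>U'. ?I U' \<longrightarrow> dim U' \<le> dim U)"
    by (rule ex_has_greatest_nat[of _ "{0}" _ "DIM('e) + 1"])
      (use S in \<open>auto simp: simps subspace_0 less_Suc_eq_le dim_subset_UNIV\<close>)
  then obtain U where U: "?I U" and max: "\<And>U'. ?I U' \<Longrightarrow> dim U' \<le> dim U" by blast
  have sU: "subspace U" and US: "U \<subseteq> S" using U by auto
  have "S \<subseteq> U"
  proof (rule ccontr)
    assume "\<not> S \<subseteq> U"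
    then obtain x where x: "x \<in> S" "x \<notin> U" by blast
    define f where "f q = fst q *\<^sub>R x + fst (snd q) *\<^sub>R J x + fst (snd (snd q)) *\<^sub>R a x
      + snd (snd (snd q)) *\<^sub>R J (a x)" for q :: "real \<times> real \<times> real \<times> real"
    have f: "linear f" by (rule linearI) (simp_all add: f_def algebra_simps)
    have aax: "a (a x) = - k *\<^sub>R x" by (rule aa[OF x(1)])
    have zero: "q = 0" if "f q \<in> U" for q
    proof (rule ccontr)
      assume "q \<noteq> 0"
      obtain \<alpha> \<beta> \<gamma> \<delta> where q: "q = (\<alpha>, \<beta>, \<gamma>, \<delta>)" by (metis prod.exhaust)
      \<comment> \<open>Applying the conjugate quaternion \<alpha> - \<beta> J - \<gamma> a -
        \<delta> J a to \<open>f q\<close> gives the quaternionic norm \<open>?N\<close> times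
        \<open>x\<close>. So a nonzero element of the line inside the invariant \<open>U\<close>
        would force \<open>x\<close> into \<open>U\<close>.\<close>
      let ?y = "f q" and ?N = "\<alpha> * \<alpha> + \<beta> * \<beta> + k * (\<gamma> * \<gamma>) + k * (\<delta> * \<delta>)"
      have "\<alpha> *\<^sub>R ?y + (- \<beta>) *\<^sub>R J ?y + (- \<gamma>) *\<^sub>R a ?y + (- \<delta>) *\<^sub>R J (a ?y) = ?N *\<^sub>R x"
        by (simp add: q f_def simps JJ aJ aax algebra_simps)
      moreover have "\<alpha> *\<^sub>R ?y + (- \<beta>) *\<^sub>R J ?y + (- \<gamma>) *\<^sub>R a ?y + (- \<delta>) *\<^sub>R J (a ?y) \<in> U"
        using U that by (intro subspace_add[OF sU] subspace_scale[OF sU]) auto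
      ultimately have "inverse ?N *\<^sub>R ?N *\<^sub>R x \<in> U"
        using subspace_scale[OF sU] by metis
      moreover have "?N \<noteq> 0"
      proof
        assume N: "?N = 0"
        have nn: "\<alpha> * \<alpha> \<ge> 0" "\<beta> * \<beta> \<ge> 0" "k * (\<gamma> * \<gamma>) \<ge> 0" "k * (\<delta> * \<delta>) \<ge> 0"
          using k by auto
        then have "\<alpha> * \<alpha> = 0" "\<beta> * \<beta> = 0" "k * (\<gamma> * \<gamma>) = 0" "k * (\<delta> * \<delta>) = 0"
          using N by linarith+
        then show False using \<open>q \<noteq> 0\<close> k by (auto simp: q zero_prod_def)
      qed
      ultimately show False using x by simp
    qed
    have inj: "inj f"
      using zero sU f by (auto simp: linear_injective_0 subspace_0)
    let ?F = "range f" and ?U = "{y + z |y z. y \<in> U \<and> z \<in> range f}"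
    have sF: "subspace ?F" using linear_subspace_image[OF f subspace_UNIV] .
    have dF: "dim ?F = 4"
      using dim_image_eq[OF f, of UNIV] inj by simp
    have "f q = 0" if "f q \<in> U" for q
      using zero[OF that] linear_0[OF f] by simp
    then have "U \<inter> ?F = {0}"
      using subspace_0[OF sU] subspace_0[OF sF] by blast
    then have dU: "dim ?U = dim U + 4"
      using dim_sums_Int[OF sU sF] dF by simp
    have JF: "J (f q) \<in> ?F" "a (f q) \<in> ?F" for q
    proof -
      have "J (f q) = f (- fst (snd q), fst q, - snd (snd (snd q)), fst (snd (snd q)))"
        "a (f q) = f (- k * fst (snd (snd q)), k * snd (snd (snd q)), fst q, - fst (snd q))"
        by (simp_all add: f_def simps JJ aJ aax algebra_simps)
      then show "J (f q) \<in> ?F" "a (f q) \<in> ?F" by simp_all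
    qed
    have "?I ?U"
    proof (intro conjI)
      show "subspace ?U" by (rule subspace_sums[OF sU sF])
      have "f q \<in> S" for q
        unfolding f_def using x inv by (intro subspace_add[OF S] subspace_scale[OF S]) auto
      then show "?U \<subseteq> S" using US subspace_add[OF S] by auto
      show "\<forall>x\<in>?U. J x \<in> ?U \<and> a x \<in> ?U"
        using JF U by (auto simp: simps) blast+
      show "4 dvd dim ?U" using U by (simp add: dU)
    qed
    from max[OF this] show False by (simp add: dU)
  qed
  then show ?thesis using U US by auto
qed

locale framed_space =
  fixes b :: "'e::real_vector \<Rightarrow> 'e \<Rightarrow> real" and E :: "'e set"
  assumes positive_definite: "positive_definite b" and orthonormal_frame: "orthonormal_frame b E"
begin

lemma b_commute: "b u v = b v u"
  using positive_definite by (simp add: positive_definite_def)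

lemma linear_b_right: "linear (b u)"
  using positive_definite by (simp add: positive_definite_def)

lemma linear_b_left: "linear (\<lambda>u. b u v)"
  by (subst b_commute) (rule linear_b_right)

lemmas b_simps = linear_add[OF linear_b_left] linear_add[OF linear_b_right]
  linear_scale[OF linear_b_left] linear_scale[OF linear_b_right]
  linear_diff[OF linear_b_left] linear_diff[OF linear_b_right]
  linear_neg[OF linear_b_left] linear_neg[OF linear_b_right]
  linear_0[OF linear_b_left] linear_0[OF linear_b_right]

lemma b_pos: "v \<noteq> 0 \<Longrightarrow> b v v > 0"
  using positive_definite by (simp add: positive_definite_def)

lemma b_nonneg: "b v v \<ge> 0"
  using b_pos[of v] by (cases "v = 0") (auto simp: b_simps)

lemma b_eqI:
  assumes "\<And>w. b u w = b v w"
  shows "u = v"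
proof (rule ccontr)
  assume "u \<noteq> v"
  then have "b (u - v) (u - v) > 0" by (intro b_pos) simp
  then show False using assms[of "u - v"] by (simp add: b_simps)
qed

lemma finite_E: "finite E" and span_E: "span E = UNIV"
  and orthonormal_E: "x \<in> E \<Longrightarrow> y \<in> E \<Longrightarrow> b x y = (if x = y then 1 else 0)"
  using orthonormal_frame by (auto simp: orthonormal_frame_def)

lemma frame_expansion: "x = (\<Sum>e\<in>E. b x e *\<^sub>R e)"
proof -
  have "x \<in> span E" by (simp add: span_E)
  then show ?thesis
  proof (induction rule: span_induct_alt)
    case base
    show ?case by (simp add: b_simps)
  next
    case (step c u y)
    have "(\<Sum>e\<in>E. b u e *\<^sub>R e) = (\<Sum>e\<in>E. if e = u then u else 0)"
      by (rule sum.cong) (use step.hyps orthonormal_E in auto)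
    also have "\<dots> = u" using step.hyps finite_E by simp
    finally have "(\<Sum>e\<in>E. b u e *\<^sub>R e) = u" .
    moreover have "(\<Sum>e\<in>E. b (c *\<^sub>R u + y) e *\<^sub>R e) = c *\<^sub>R (\<Sum>e\<in>E. b u e *\<^sub>R e) + (\<Sum>e\<in>E. b y e *\<^sub>R e)"
      by (simp add: b_simps scaleR_add_left sum.distrib scaleR_sum_right)
    ultimately show ?case using step.IH by simp
  qed
qed

lemma frame_functional:
  assumes "linear (f :: 'e \<Rightarrow> real)"
  shows "(\<Sum>e\<in>E. b x e * f e) = f x"
  using linear_sum[OF assms, of "\<lambda>e. b x e *\<^sub>R e" E] frame_expansion[of x]
  by (simp add: linear_scale[OF assms])

lemma parseval: "(\<Sum>e\<in>E. b x e * b y e) = b x y"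
  using frame_functional[OF linear_b_right, of x y] b_commute by simp

definition tr :: "('e \<Rightarrow> 'e) \<Rightarrow> real" where
  "tr F = (\<Sum>e\<in>E. b (F e) e)"

lemma tr_commute:
  assumes F: "linear F" and G: "linear G"
  shows "tr (\<lambda>x. F (G x)) = tr (\<lambda>x. G (F x))"
proof -
  have *: "b (L y) e = (\<Sum>f\<in>E. b y f * b (L f) e)" if "linear L" for L y e
    by (rule frame_functional[symmetric, OF linear_compose[OF that linear_b_left, unfolded comp_def]])
  have "tr (\<lambda>x. F (G x)) = (\<Sum>e\<in>E. \<Sum>f\<in>E. b (G e) f * b (F f) e)"
    unfolding tr_def by (intro sum.cong refl *[OF F])
  also have "\<dots> = (\<Sum>f\<in>E. \<Sum>e\<in>E. b (F f) e * b (G e) f)"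
    by (subst sum.swap) (simp add: mult.commute)
  also have "\<dots> = tr (\<lambda>x. G (F x))"
    unfolding tr_def by (intro sum.cong refl *[OF G, symmetric])
  finally show ?thesis .
qed

lemma card_frame: "tr (\<lambda>x. x) = real (card E)"
  unfolding tr_def using orthonormal_E by simp

end


subsection \<open>Curvature of a parallel torsion form\<close>

text \<open>
  The unit vector \<open>v\<close> spans, together with \<open>w = J v\<close>, the two-dimensional summand \<open>\<V>\<close> of the
  tangent space; \<open>P\<close> is the projection to the other summand \<open>\<H>\<close>, and \<open>a\<close> and \<open>J a\<close> are the
  contractions of the torsion with \<open>v\<close> and \<open>w\<close>.
\<close>

locale torsion_point = framed_space b E
  for b :: "'e::euclidean_space \<Rightarrow> 'e \<Rightarrow> real" and E +
  fixes J :: "'e \<Rightarrow> 'e" and T :: "'e \<Rightarrow> 'e \<Rightarrow> 'e" and R :: "'e \<Rightarrow> 'e \<Rightarrow> 'e \<Rightarrow> 'e"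
    and v :: 'e and m :: nat and w :: 'e and P a :: "'e \<Rightarrow> 'e"
  defines "w \<equiv> J v" and "P \<equiv> \<lambda>x. x - b x v *\<^sub>R v - b x w *\<^sub>R w" and "a \<equiv> T v"
  assumes card_E: "card E = 2 * m + 2"
    and linear_J: "linear J" and JJ [simp]: "J (J x) = - x" and JbJ: "b (J x) (J y) = b x y"
    and b_v [simp]: "b v v = 1"
    and linear_T_left: "linear (\<lambda>x. T x y)" and linear_T_right: "linear (T x)"
    and T_skew: "T x y = - T y x" and T_skew_b: "b (T x y) z = - b (T x z) y"
    and PT [simp]: "P (T (P x) (P y)) = 0" and T_vw [simp]: "T v w = 0"
    and T_J: "T v (J (P x)) = - J (T v (P x))" and T_w: "T w (P x) = J (T v (P x))"
    and nondegenerate: "x \<noteq> 0 \<Longrightarrow> \<exists>y. T x y \<noteq> 0"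
    and linear_R: "linear (\<lambda>x. R x y z)" "linear (\<lambda>y. R x y z)" "linear (R x y)"
    and R_skew: "R y x z = - R x y z" and R_skew_b: "b (R x y z) u = - b (R x y u) z"
    and RJ: "R x y (J z) = J (R x y z)" and RP: "R x y (P z) = P (R x y z)"
    and bianchi: "b (R x y z) u + b (R y z x) u + b (R z x y) u =
      b (T x y) (T z u) + b (T y z) (T x u) + b (T z x) (T y u)"
    and R_T: "R x y (T z u) = T (R x y z) u + T z (R x y u)"
begin

section \<open>Elementary rules at one point: J, the projection P and the contraction a\<close>

lemmas J_simps = linear_add[OF linear_J] linear_scale[OF linear_J] linear_diff[OF linear_J]
  linear_neg[OF linear_J] linear_0[OF linear_J]
lemmas T_simps = linear_add[OF linear_T_left] linear_add[OF linear_T_right]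
  linear_scale[OF linear_T_left] linear_scale[OF linear_T_right]
  linear_diff[OF linear_T_left] linear_diff[OF linear_T_right]
  linear_neg[OF linear_T_left] linear_neg[OF linear_T_right]
  linear_0[OF linear_T_left] linear_0[OF linear_T_right]
lemmas R_simps = linear_add[OF linear_R(1)] linear_add[OF linear_R(2)] linear_add[OF linear_R(3)]
  linear_scale[OF linear_R(1)] linear_scale[OF linear_R(2)] linear_scale[OF linear_R(3)]
  linear_diff[OF linear_R(1)] linear_diff[OF linear_R(2)] linear_diff[OF linear_R(3)]
  linear_neg[OF linear_R(1)] linear_neg[OF linear_R(2)] linear_neg[OF linear_R(3)]
  linear_0[OF linear_R(1)] linear_0[OF linear_R(2)] linear_0[OF linear_R(3)]

lemma J_skew: "b (J x) y = - b x (J y)"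
  using JbJ[of x "J y"] by (simp add: b_simps)

lemma J_skew0 [simp]: "b (J x) x = 0" "b x (J x) = 0"
  using J_skew[of x x] b_commute[of "J x" x] by linarith+

lemma b_w [simp]: "b w w = 1" "b v w = 0" "b w v = 0"
  by (simp_all add: w_def JbJ)

lemma Jv [simp]: "J v = w" and Jw [simp]: "J w = - v"
  by (simp_all add: w_def)

lemma P_eq: "P x = x - b x v *\<^sub>R v - b x w *\<^sub>R w"
  by (simp add: P_def)

lemma decompose: "x = P x + b x v *\<^sub>R v + b x w *\<^sub>R w"
  by (simp add: P_eq)

lemma linear_P: "linear P"
  by (rule linearI) (simp_all add: P_eq b_simps algebra_simps)

lemmas P_simps = linear_add[OF linear_P] linear_scale[OF linear_P] linear_diff[OF linear_P]
  linear_neg[OF linear_P] linear_0[OF linear_P]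

lemma P_v [simp]: "P v = 0" "P w = 0"
  by (simp_all add: P_eq)

lemma b_P_v [simp]: "b (P x) v = 0" "b (P x) w = 0"
  by (simp_all add: P_eq b_simps)

lemma b_v_P [simp]: "b v (P x) = 0" "b w (P x) = 0"
  by (simp_all add: b_commute[of _ "P x"])

lemma PP [simp]: "P (P x) = P x"
  using P_eq[of "P x"] by simp

lemma P_sym: "b (P x) y = b x (P y)"
  by (simp add: P_eq b_simps b_commute[of v y] b_commute[of w y])

lemma b_J_vw: "b (J x) v = - b x w" "b (J x) w = b x v"
  using J_skew[of x v] J_skew[of x w] by (simp_all add: b_simps)

lemma PJ: "P (J x) = J (P x)"
  by (simp add: P_eq J_simps b_J_vw)

lemma T_self [simp]: "T x x = 0"
proof -
  have "2 *\<^sub>R T x x = 0"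
    using T_skew[of x x] by (simp only: scaleR_2 eq_neg_iff_add_eq_0)
  then show ?thesis by simp
qed

lemma linear_a: "linear a"
  unfolding a_def by (rule linear_T_right)

lemmas a_simps = linear_add[OF linear_a] linear_scale[OF linear_a] linear_diff[OF linear_a]
  linear_neg[OF linear_a] linear_0[OF linear_a]

lemma Tv: "T v x = a x"
  by (simp add: a_def)

lemma a_vw [simp]: "a v = 0" "a w = 0"
  by (simp_all add: a_def)

lemma aP [simp]: "a (P x) = a x"
  by (simp add: P_eq a_simps)

lemma a_skew: "b (a x) y = - b x (a y)"
  unfolding a_def using T_skew_b[of v x y] b_commute[of x "T v y"] by simp

lemma a_skew0 [simp]: "b (a x) x = 0" "b x (a x) = 0"
  using a_skew[of x x] b_commute[of "a x" x] by linarith+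

lemma b_a_v [simp]: "b (a x) v = 0" "b (a x) w = 0" "b v (a x) = 0" "b w (a x) = 0"
  using a_skew[of x v] a_skew[of x w] b_commute[of v "a x"] b_commute[of w "a x"] by (simp_all add: b_simps)

lemma Pa [simp]: "P (a x) = a x"
  by (simp add: P_eq)

lemma aJ: "a (J x) = - J (a x)"
  using T_J[of x] unfolding a_def[symmetric] PJ[symmetric] by simp

lemma b_Ja_v [simp]: "b (J (a x)) v = 0" "b (J (a x)) w = 0" "b v (J (a x)) = 0" "b w (J (a x)) = 0"
  using b_commute[of v "J (a x)"] b_commute[of w "J (a x)"] by (simp_all add: b_J_vw)

lemma PJa [simp]: "P (J (a x)) = J (a x)"
  by (simp add: P_eq)

lemma Ja_skew: "b (J (a x)) y = - b x (J (a y))"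
  using J_skew[of "a x" y] a_skew[of x "J y"] by (simp add: aJ b_simps)

lemma Ja_skew0 [simp]: "b (J (a x)) x = 0" "b x (J (a x)) = 0"
  using Ja_skew[of x x] b_commute[of "J (a x)" x] by linarith+

lemma Tw: "T w x = J (a x)"
proof -
  have "T w v = 0" using T_skew[of w v] by simp
  moreover have "T w (P x) = J (a x)" using T_w[of x] unfolding a_def[symmetric] by simp
  ultimately show ?thesis by (simp add: P_eq T_simps)
qed

text \<open>The value is vertical by the type of T. By total skew-symmetry its component along a
  vertical vector is the contraction with that vector, namely \<open>a\<close> for \<open>v\<close>
  and \<open>J a\<close> for \<open>w\<close>.\<close>

lemma T_horizontal: "T (P x) (P y) = b (a x) y *\<^sub>R v + b (J (a x)) y *\<^sub>R w"
proof -
  have *: "b (T (P x) (P y)) z = b (T z (P x)) (P y)" for z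
    using T_skew_b[of z "P x" "P y"] T_skew[of z "P y"] T_skew_b[of "P y" z "P x"] T_skew[of "P x" "P y"]
      T_skew_b[of "P x" "P y" z] T_skew[of "P x" z] by (simp add: b_simps)
  have "b (T (P x) (P y)) v = b (a x) y"
    unfolding * a_def[symmetric] aP P_sym[symmetric] by simp
  moreover have "b (T (P x) (P y)) w = b (J (a x)) y"
    unfolding * Tw aP P_sym[symmetric] by simp
  ultimately show ?thesis
    using decompose[of "T (P x) (P y)"] by simp
qed

text \<open>The whole torsion is encoded in the single endomorphism \<open>a\<close>; all later
  quadratic expressions in T are evaluated through this expansion.\<close>

lemma T_eq: "T x y = b (a x) y *\<^sub>R v + b (J (a x)) y *\<^sub>R w + b x v *\<^sub>R a y + b x w *\<^sub>R J (a y)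
    - b y v *\<^sub>R a x - b y w *\<^sub>R J (a x)"
proof -
  have Tv': "T x v = - a x" "T x w = - J (a x)" for x
    using T_skew[of x v] T_skew[of x w] by (simp_all add: Tv Tw)
  have "T x y = T (P x + b x v *\<^sub>R v + b x w *\<^sub>R w) (P y + b y v *\<^sub>R v + b y w *\<^sub>R w)"
    by (rule arg_cong2[where f = T, OF decompose decompose])
  also have "\<dots> = T (P x) (P y) + b x v *\<^sub>R a y + b x w *\<^sub>R J (a y) - b y v *\<^sub>R a x - b y w *\<^sub>R J (a x)"
    by (simp add: T_simps a_simps J_simps Tv Tw Tv' algebra_simps)
  finally show ?thesis by (simp add: T_horizontal)
qed


subsubsection \<open>The curvature acting on the vertical summand\<close>

lemma pair_symmetry: "b (R x y z) u = b (R z u x) y"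
proof (rule curvature_pair_symmetry[where R = "\<lambda>x y z u. b (R x y z) u" and G = "\<lambda>x y z u. b (T x y) (T z u)"])
  show "b (R y x z) u = - b (R x y z) u" for x y z u
    using R_skew[of y x z] by (simp add: b_simps)
  show "b (T y x) (T z u) = - b (T x y) (T z u)" for x y z u
    using T_skew[of y x] by (simp add: b_simps)
  show "b (R x y u) z = - b (R x y z) u" for x y z u
    by (rule R_skew_b)
  show "b (T z u) (T x y) = b (T x y) (T z u)" for x y z u
    by (rule b_commute)
qed (rule bianchi)

text \<open>Pair symmetry carries the commutation of the curvature operators with \<open>J\<close>
  over to the first two slots; the next lemma does the same with the splitting.\<close>

lemma R_J_J: "R (J x) (J y) z = R x y z"
proof (rule b_eqI)
  fix u
  have "b (R (J x) (J y) z) u = b (R z u (J x)) (J y)" by (rule pair_symmetry)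
  also have "\<dots> = b (R x y z) u" by (simp add: RJ JbJ pair_symmetry[of x y])
  finally show "b (R (J x) (J y) z) u = b (R x y z) u" .
qed

lemma R_mixed: "P u = 0 \<Longrightarrow> R (P x) u z = 0"
  by (rule b_eqI) (simp add: pair_symmetry[of "P x"] RP P_sym b_simps)

text \<open>\<open>R x y\<close> is skew and preserves the plane of \<open>v\<close> and
  \<open>w\<close>, hence acts there as \<open>rho x y\<close> times \<open>J\<close>. Up to the
  factor i this is the curvature form of \<V> as a complex line bundle.\<close>

definition rho :: "'e \<Rightarrow> 'e \<Rightarrow> real" where
  "rho x y = b (R x y v) w"

lemma R_v: "R x y v = rho x y *\<^sub>R w" "R x y w = - rho x y *\<^sub>R v"
proof -
  have "P (R x y v) = 0" using RP[of x y v] by (simp add: R_simps)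
  moreover have "b (R x y v) v = 0" using R_skew_b[of x y v v] by simp
  ultimately show v: "R x y v = rho x y *\<^sub>R w"
    using decompose[of "R x y v"] by (simp add: rho_def)
  show "R x y w = - rho x y *\<^sub>R v" using RJ[of x y v] by (simp add: v J_simps)
qed

text \<open>In the Bianchi identity for x, y, v, w with x and y horizontal, two curvature terms
  vanish as curvature preserves the splitting and one torsion term vanishes as T(v,w) = 0. The other
  two torsion terms are equal, which is the origin of the factor 2.\<close>

lemma rho_horizontal: "rho (P x) (P y) = 2 * b (J (a (a x))) y"
proof -
  have "b (R (P y) v (P x)) w = 0" "b (R v (P x) (P y)) w = 0"
    by (simp_all add: RP)
  then show ?thesis
    using bianchi[of "P x" "P y" v w] b_commute[of "J (a y)" "a x"]  b_commute[of "a y" "J (a x)"] Ja_skew[of "a x" y]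
      Ja_skew[of y "a x"] a_skew[of y "J (a x)"] b_commute[of "a y" "J (a x)"] b_commute[of y "J (a (a x))"]
    by (simp add: rho_def T_eq b_simps J_simps aJ P_sym)
qed

text \<open>
  Applying the curvature operator \<open>R v w\<close>, which acts on \<open>\<H>\<close> as \<open>2 J a\<^sup>2\<close>, to the parallel torsion
  shows that \<open>a\<^sup>3\<close> is a multiple of \<open>a\<close>.
\<close>

definition lam :: real where
  "lam = - rho v w / 4"

lemma R_vw_horizontal: "R v w (P x) = 2 *\<^sub>R J (a (a x))"
proof (rule b_eqI)
  fix y
  have "b (R v w (P x)) y = b (R v w (P x)) (P y)"
    by (simp add: RP flip: P_sym)
  also have "\<dots> = rho (P x) (P y)"
    by (simp add: pair_symmetry[of v w] rho_def)
  finally show "b (R v w (P x)) y = b (2 *\<^sub>R J (a (a x))) y"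
    by (simp add: rho_horizontal b_simps)
qed

text \<open>T(P x, .) is built from \<open>a x\<close> alone, so non-degeneracy of T on horizontal
  vectors is injectivity of \<open>a\<close> there.\<close>

lemma a_injective: "a x = 0 \<Longrightarrow> P x = 0"
proof (rule ccontr)
  assume "a x = 0" "P x \<noteq> 0"
  then obtain y where "T (P x) y \<noteq> 0" using nondegenerate by blast
  moreover have "T (P x) y = 0"
    using \<open>a x = 0\<close> by (simp add: T_eq J_simps b_simps)
  ultimately show False by simp
qed

text \<open>The derivation property applied to T(v,z): the curvature rotates \<open>v\<close> into a
  multiple of \<open>w\<close>, whose contraction is \<open>J a\<close>.\<close>

lemma R_a: "R x y (a z) = rho x y *\<^sub>R J (a z) + a (R x y z)"
  using R_T[of x y v z] by (simp add: Tv R_v T_simps Tw)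

lemma a_a: "a (a x) = - lam *\<^sub>R P x"
proof -
  have "2 *\<^sub>R J (a (a (a x))) = rho v w *\<^sub>R J (a x) + a (2 *\<^sub>R J (a (a x)))"
    using R_a[of v w "P x"] R_vw_horizontal[of "a x"] R_vw_horizontal[of x] by simp
  moreover have "4 *\<^sub>R J (a (a (a x))) = 2 *\<^sub>R J (a (a (a x))) + 2 *\<^sub>R J (a (a (a x)))"
    by (simp flip: scaleR_add_left)
  ultimately have "4 *\<^sub>R J (a (a (a x))) = rho v w *\<^sub>R J (a x)"
    by (simp add: a_simps aJ eq_diff_eq)
  then have "J (4 *\<^sub>R J (a (a (a x)))) = J (rho v w *\<^sub>R J (a x))" by simp
  then have "4 *\<^sub>R a (a (a x)) = rho v w *\<^sub>R a x" by (simp add: J_simps)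
  then have "(1 / 4) *\<^sub>R (4 *\<^sub>R a (a (a x))) = (1 / 4) *\<^sub>R (rho v w *\<^sub>R a x)" by simp
  then have "a (a (a x)) = (rho v w / 4) *\<^sub>R a x" by simp
  \<comment> \<open>Injectivity of \<open>a\<close> on \<H> removes one factor; the projection
    accounts for the vertical part, which \<open>a\<close> does not see.\<close>
  then have "a (a (a x) + lam *\<^sub>R x) = 0" by (simp add: a_simps lam_def)
  then have "P (a (a x) + lam *\<^sub>R x) = 0" by (rule a_injective)
  then show ?thesis by (simp add: P_simps eq_neg_iff_add_eq_0)
qed

lemma b_a_a: "b (a x) (a y) = lam * b (P x) (P y)"
  using a_skew[of x "a y"] P_sym[of x "P y"] by (simp add: a_a b_simps)

text \<open>By skewness |a y|^2 = lam |P y|^2, and non-degeneracy at \<open>v\<close> supplies some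
  y with \<open>a y\<close> nonzero.\<close>

lemma lam_pos: "lam > 0"
proof -
  have "v \<noteq> 0" using b_v linear_0[OF linear_b_right, of v] by force
  then obtain y where "a y \<noteq> 0" using nondegenerate[of v] by (auto simp: a_def)
  then have "0 < lam * b (P y) (P y)" using b_pos b_a_a by metis
  then show ?thesis using b_nonneg[of "P y"] by (simp add: zero_less_mult_iff)
qed

lemma b_Ja_Ja: "b (J (a x)) (J (a y)) = lam * b (P x) (P y)"
  by (simp add: JbJ b_a_a)

lemma tr_P: "tr P = 2 * m"
proof -
  have *: "b (P e) e = b e e - b v e * b v e - b w e * b w e" for e
    by (simp add: P_eq b_simps b_commute[of v e] b_commute[of w e])
  have "tr P = tr (\<lambda>x. x) - b v v - b w w"
    unfolding tr_def * sum_subtractf parseval ..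
  then show ?thesis by (simp add: card_frame card_E)
qed

lemma sum_b_P_P: "(\<Sum>e\<in>E. b (P e) (P e)) = 2 * m"
  unfolding tr_P[symmetric] tr_def by (simp flip: P_sym)

text \<open>The metric on \<V> extended by zero, written in the basis \<open>v\<close>,
  \<open>w\<close>; \<open>Q_form_eq\<close> gives the form without a basis.\<close>

definition Q_form :: "'e \<Rightarrow> 'e \<Rightarrow> real" where
  "Q_form x y = b x v * b y v + b x w * b y w"

lemma sum_Q_form: "(\<Sum>e\<in>E. Q_form e e) = 2"
proof -
  have "Q_form e e = b v e * b v e + b w e * b w e" for e
    by (simp add: Q_form_def b_commute[of v e] b_commute[of w e])
  then show ?thesis by (simp add: sum.distrib parseval)
qed

text \<open>The mixed terms are arranged as \<open>b v e\<close> or \<open>b w e\<close> times a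
  functional of \<open>e\<close>; summation evaluates it at \<open>v\<close> or \<open>w\<close>,
  where \<open>P\<close> and \<open>a\<close> vanish. The factor 4 collects the Parseval sums for
  \<open>a\<close>, \<open>J a\<close>, \<open>v\<close> and \<open>w\<close>, and 2m is the trace
  of \<open>P\<close>.\<close>

lemma b_T_T: "(\<Sum>e\<in>E. b (T x e) (T y e)) = 4 * lam * b (P x) (P y) + 2 * m * lam * Q_form x y"
proof -
  have *: "b (T x e) (T y e) = b (a x) e * b (a y) e + b (J (a x)) e * b (J (a y)) e
      + lam * Q_form x y * b (P e) (P e) + lam * b (P x) (P y) * (b v e * b v e + b w e * b w e)
      - b v e * (b x v * lam * b (P e) (P y) + b x w * b (J (a e)) (a y)
          + b y v * lam * b (P e) (P x) + b y w * b (J (a e)) (a x))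
      - b w e * (b x v * b (a e) (J (a y)) + b x w * lam * b (P e) (P y)
          + b y v * b (a e) (J (a x)) + b y w * lam * b (P e) (P x))" for e
    unfolding T_eq[of x e] T_eq[of y e]
    by (simp add: b_simps b_a_a b_Ja_Ja Q_form_def b_commute[of "a x" "J (a e)"] b_commute[of "J (a x)" "a e"]
        b_commute[of "P x" "P e"] J_skew[of "a x" "a y"] b_commute[of v e] b_commute[of w e] algebra_simps)
  have lin: "linear (\<lambda>e. b x v * lam * b (P e) (P y) + b x w * b (J (a e)) (a y)
          + b y v * lam * b (P e) (P x) + b y w * b (J (a e)) (a x))"
    "linear (\<lambda>e. b x v * b (a e) (J (a y)) + b x w * lam * b (P e) (P y)
          + b y v * b (a e) (J (a x)) + b y w * lam * b (P e) (P x))"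
    by (rule linearI; simp add: a_simps J_simps b_simps P_simps algebra_simps)+
  show ?thesis
    unfolding * sum_subtractf frame_functional[OF lin(1)] frame_functional[OF lin(2)] sum.distrib
      sum_distrib_left[symmetric] parseval sum_b_P_P
    by (simp add: b_a_a b_Ja_Ja b_simps J_simps)
qed

text \<open>The trace of the previous formula: 4 lam times 2m from \<H> plus 2 m lam times 2 from
  \<V>.\<close>

lemma norm_sq_T: "(\<Sum>x\<in>E. \<Sum>y\<in>E. \<Sum>z\<in>E. (b (T x y) z)\<^sup>2) = 12 * m * lam"
proof -
  have "(\<Sum>x\<in>E. \<Sum>y\<in>E. \<Sum>z\<in>E. (b (T x y) z)\<^sup>2) = (\<Sum>x\<in>E. \<Sum>y\<in>E. b (T x y) (T x y))"
    by (simp only: power2_eq_square parseval)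
  also have "\<dots> = 4 * lam * (\<Sum>x\<in>E. b (P x) (P x)) + 2 * m * lam * (\<Sum>x\<in>E. Q_form x x)"
    by (simp add: b_T_T sum.distrib sum_distrib_left)
  finally show ?thesis by (simp add: sum_b_P_P sum_Q_form)
qed


subsubsection \<open>The Ricci tensor\<close>

definition ric :: "'e \<Rightarrow> 'e \<Rightarrow> real" where
  "ric y z = (\<Sum>e\<in>E. b (R e y z) e)"

lemma rho_eq: "rho (P x) (P y) = 2 * lam * b (P x) (J (P y))"
  unfolding rho_horizontal by (simp add: a_a J_simps b_simps J_skew P_sym PJ)

lemma R_decompose: "R x y z = R (P x) (P y) z + (b x v * b y w - b x w * b y v) *\<^sub>R R v w z"
proof -
  have vx: "R v (P x) z = 0" "R w (P x) z = 0" for x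
    using R_mixed[of v x z] R_mixed[of w x z] R_skew[of v "P x" z] R_skew[of w "P x" z] by simp_all
  have self: "R x x z = 0" for x
  proof -
    have "2 *\<^sub>R R x x z = 0" using R_skew[of x x z] by (simp only: scaleR_2 eq_neg_iff_add_eq_0)
    then show ?thesis by simp
  qed
  have "R x y z = R (P x + b x v *\<^sub>R v + b x w *\<^sub>R w) (P y + b y v *\<^sub>R v + b y w *\<^sub>R w) z"
    by (rule arg_cong2[where f = "\<lambda>x y. R x y z", OF decompose decompose])
  also have "\<dots> = R (P x) (P y) z + (b x v * b y w - b x w * b y v) *\<^sub>R R v w z"
    by (simp add: R_simps R_mixed vx self R_skew[of v w] algebra_simps)
  finally show ?thesis .
qed

lemma R_vw: "R v w z = - (2 * lam) *\<^sub>R J (P z) + (4 * lam) *\<^sub>R (b z w *\<^sub>R v - b z v *\<^sub>R w)"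
proof -
  have "R v w z = R v w (P z + b z v *\<^sub>R v + b z w *\<^sub>R w)"
    using decompose[of z] by simp
  also have "\<dots> = 2 *\<^sub>R J (a (a z)) + (b z v * rho v w) *\<^sub>R w - (b z w * rho v w) *\<^sub>R v"
    by (simp add: R_simps R_vw_horizontal R_v)
  finally show ?thesis
    by (simp add: a_a J_simps lam_def algebra_simps)
qed

definition hric :: "'e \<Rightarrow> 'e \<Rightarrow> real" where
  "hric y z = (\<Sum>e\<in>E. b (R (P e) y z) (P e))"

text \<open>Curvature has no part with one horizontal and one vertical direction, so the trace
  splits. The vertical part sees only \<open>R v w\<close>, with \<open>rho v w = - 4 * lam\<close>;
  the terms with \<open>rho (P e) (P y)\<close> sum to values at \<open>P v\<close> and
  \<open>P w\<close>, that is, to zero.\<close>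

lemma ric_split: "ric y z = hric (P y) (P z) + 4 * lam * Q_form y z"
proof -
  have *: "b (R e y z) e = b (R (P e) (P y) (P z)) (P e)
      + (b v e * (b y w * b (R v w z) e) - b w e * (b y v * b (R v w z) e))
      + (b w e * (b z v * rho (P e) (P y)) - b v e * (b z w * rho (P e) (P y)))" for e
  proof -
    have "R (P e) (P y) z = R (P e) (P y) (P z + b z v *\<^sub>R v + b z w *\<^sub>R w)"
      using decompose[of z] by simp
    also have "\<dots> = R (P e) (P y) (P z) + (b z v * rho (P e) (P y)) *\<^sub>R w - (b z w * rho (P e) (P y)) *\<^sub>R v"
      by (simp add: R_simps R_v)
    finally have eq: "R (P e) (P y) z = \<dots>" .
    show ?thesis
      unfolding R_decompose[of e y z] eq
      by (simp add: b_simps RP P_sym b_commute[of v e] b_commute[of w e] algebra_simps)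
  qed
  have lin: "linear (\<lambda>e. b y w * b (R v w z) e)" "linear (\<lambda>e. b y v * b (R v w z) e)"
    "linear (\<lambda>e. b z v * rho (P e) (P y))" "linear (\<lambda>e. b z w * rho (P e) (P y))"
    by (rule linearI; simp add: rho_def R_simps b_simps P_simps algebra_simps)+
  have rho0: "rho 0 u = 0" for u by (simp add: rho_def R_simps b_simps)
  show ?thesis
    unfolding ric_def hric_def * sum_subtractf sum.distrib frame_functional[OF lin(1)] frame_functional[OF lin(2)]
      frame_functional[OF lin(3)] frame_functional[OF lin(4)]
    by (simp add: R_vw b_simps b_J_vw rho0 Q_form_def algebra_simps)
qed

lemma hric_symmetric: "hric y z = hric z y"
proof -
  have "b (R (P e) y z) (P e) = b (R (P e) z y) (P e)" for e
    using pair_symmetry[of "P e" y z "P e"] R_skew[of z "P e" "P e"] R_skew_b[of "P e" z "P e" y]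
    by (simp add: b_simps)
  then show ?thesis by (simp add: hric_def)
qed

text \<open>The invariance of R under \<open>J\<close> in either pair reduces the claim to the
  cyclicity of the trace, with J J = -1.\<close>

lemma hric_J: "hric (J y) (J z) = hric y z"
proof -
  define F where "F x = P (R (P x) y z)" for x
  have F: "linear F"
    by (rule linearI) (simp_all add: F_def P_simps R_simps)
  have FJ: "linear (\<lambda>x. J (F x))"
    by (rule linearI) (simp_all add: linear_add[OF F] linear_scale[OF F] J_simps)
  have "b (R (P e) (J y) (J z)) (P e) = - b (J (F (J e))) e" for e
  proof -
    have "R (P e) (J y) z = - R (P (J e)) y z"
      using R_J_J[of "P e" "J y" z] by (simp add: R_simps PJ)
    then show ?thesis
      by (simp add: RJ J_simps b_simps F_def PJ P_sym flip: PJ)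
  qed
  then have "hric (J y) (J z) = - tr (\<lambda>x. J (F (J x)))"
    by (simp add: hric_def tr_def sum_negf)
  also have "\<dots> = - tr (\<lambda>x. J (J (F x)))"
    by (simp add: tr_commute[OF FJ linear_J])
  also have "\<dots> = hric y z"
    by (simp add: hric_def tr_def b_simps sum_negf F_def P_sym)
  finally show ?thesis .
qed

text \<open>The trace of \<open>J a R a\<close> is computed in two ways, using \<open>a R = R a - \<rho> J a\<close>.\<close>

lemma tr_J_R: "tr (\<lambda>x. J (R y z (P x))) = - m * rho y z"
proof -
  have lin: "linear (\<lambda>x. J (a (R y z x)))"
    by (rule linearI) (simp_all add: J_simps a_simps R_simps)
  have "tr (\<lambda>x. J (a (R y z (a x)))) = - lam * tr (\<lambda>x. J (R y z (P x))) - lam * rho y z * tr P"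
  proof -
    have "J (a (R y z (a x))) = - lam *\<^sub>R J (R y z (P x)) - (lam * rho y z) *\<^sub>R P x" for x
      by (simp add: R_a a_simps aJ J_simps a_a RP)
    then show ?thesis
      by (simp add: tr_def b_simps sum.distrib sum_subtractf sum_negf sum_distrib_left)
  qed
  moreover have "tr (\<lambda>x. J (a (R y z (a x)))) = lam * tr (\<lambda>x. J (R y z (P x)))"
  proof -
    have "a (J (a (R y z x))) = lam *\<^sub>R J (R y z (P x))" for x
      by (simp add: aJ a_a J_simps RP)
    then show ?thesis
      unfolding tr_commute[OF lin linear_a] by (simp add: tr_def b_simps sum_distrib_left)
  qed
  ultimately have "- lam * tr (\<lambda>x. J (R y z (P x))) - lam * rho y z * tr P = lam * tr (\<lambda>x. J (R y z (P x)))"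
    by (rule trans[OF sym])
  then have "lam * (tr (\<lambda>x. J (R y z (P x))) + m * rho y z) = 0"
    unfolding tr_P by (simp add: algebra_simps)
  then show ?thesis using lam_pos by simp
qed

text \<open>The Bianchi identity for x, y, P e with fourth argument J P e is summed over e. Its
  curvature part consists of tr(J R(x,y)), known from \<open>tr_J_R\<close> to be a multiple of rho
  and so of the metric, and of two equal copies of \<open>hric\<close>; its torsion part is a
  Parseval sum.\<close>

lemma hric_eq: "hric (P x) (P z) = (m + 2) * lam * b (P x) (P z)"
proof -
  \<comment> \<open>The contraction yields \<open>hric\<close> at x and J y; this choice of y turns
    J y into z.\<close>
  define y where "y = - J z"
  have JPy: "J (P y) = P z" by (simp add: y_def PJ J_simps P_simps)
  let ?X = "P x" and ?Y = "P y"
  have "J (a y) = - a (P z)" unfolding JPy[symmetric] by (simp add: aJ)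
  then have Jay: "J (a y) = - a z" by simp
  have *: "- b (J (R ?X ?Y (P e))) e + b (R (P e) ?Y (J ?X)) (P e) - b (R (P e) ?X (J ?Y)) (P e) =
      b (J (a y)) e * b (a x) e - b (a y) e * b (J (a x)) e
      + b (a x) e * b (J (a y)) e - b (J (a x)) e * b (a y) e" for e
  proof -
    have J1: "b (a u) (J e) = - b (J (a u)) e" "b (J (a u)) (J e) = b (a u) e" for u
      using J_skew[of "a u" e] by (simp_all add: JbJ)
    have T0: "T (P e) (P (J e)) = 0"
      unfolding T_horizontal J1 by simp
    have 1: "b (R ?X ?Y (P e)) (J (P e)) = - b (J (R ?X ?Y (P e))) e"
    proof -
      have u: "J (R ?X ?Y (P e)) = P (J (R ?X ?Y e))" by (simp only: RP PJ)
      have "b (J (R ?X ?Y (P e))) (P e) = b (J (R ?X ?Y (P e))) e"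
        unfolding u P_sym[of "P (J (R ?X ?Y e))" e, symmetric] PP ..
      then show ?thesis using J_skew[of "R ?X ?Y (P e)" "P e"] by linarith
    qed
    have 2: "b (R ?Y (P e) ?X) (J (P e)) = b (R (P e) ?Y (J ?X)) (P e)"
      using J_skew[of "R (P e) ?Y ?X" "P e"] R_skew[of ?Y "P e"] by (simp only: RJ b_simps) 
    have 3: "b (R (P e) ?X ?Y) (J (P e)) = - b (R (P e) ?X (J ?Y)) (P e)"
      using J_skew[of "R (P e) ?X ?Y" "P e"] by (simp only: RJ)
    have "b (R ?X ?Y (P e)) (J (P e)) + b (R ?Y (P e) ?X) (J (P e)) + b (R (P e) ?X ?Y) (J (P e)) =
      b (T ?Y (P e)) (T ?X (P (J e))) - b (T ?X (P e)) (T ?Y (P (J e)))"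
      using bianchi[of ?X ?Y "P e" "J (P e)"] T_skew[of "P e" ?X] unfolding PJ[symmetric] T0
      by (simp add: b_simps)
    then show ?thesis
      unfolding 1 2 3 T_horizontal by (simp add: b_simps J1)
  qed
  have "- tr (\<lambda>e. J (R ?X ?Y (P e))) + hric ?Y (J ?X) - hric ?X (J ?Y) =
      (\<Sum>e\<in>E. - b (J (R ?X ?Y (P e))) e + b (R (P e) ?Y (J ?X)) (P e) - b (R (P e) ?X (J ?Y)) (P e))"
    by (simp add: tr_def hric_def sum.distrib sum_subtractf sum_negf)
  also have "\<dots> = b (J (a y)) (a x) - b (a y) (J (a x)) + b (a x) (J (a y)) - b (J (a x)) (a y)"
    unfolding * sum.distrib sum_subtractf parseval ..
  also have "\<dots> = - 4 * lam * b (P x) (P z)"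
    using b_commute[of "a y" "J (a x)"] b_commute[of "J (a y)" "a x"] J_skew[of "a x" "a y"]
      b_commute[of "P z" "P x"]
    unfolding Jay by (simp add: b_simps b_a_a)
  finally have "m * rho ?X ?Y + hric ?Y (J ?X) - hric ?X (J ?Y) = - 4 * lam * b (P x) (P z)"
    by (simp add: tr_J_R)
  moreover have "hric ?Y (J ?X) = - hric ?X (J ?Y)"
    using hric_J[of ?Y "J ?X"] hric_symmetric[of ?X "J ?Y"]
    by (simp add: hric_def R_simps b_simps sum_negf)
  ultimately show ?thesis
    unfolding rho_eq JPy by (simp add: algebra_simps)
qed

lemma ric_eq: "ric y z = (m + 2) * lam * b (P y) (P z) + 4 * lam * Q_form y z"
  by (simp add: ric_split hric_eq)

text \<open>Under the trace T(T(e,y),z) contributes 1/2 and the commutator of torsions -1/4 of the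
  sum in \<open>b_T_T\<close>, so a quarter of that sum is added to \<open>ric\<close>.\<close>

lemma levi_civita_ric_eq:
  "(\<Sum>e\<in>E. b (R e y z - (1 / 2) *\<^sub>R T (T e y) z + (1 / 4) *\<^sub>R (T e (T y z) - T y (T e z))) e) =
    (m + 3) * lam * b (P y) (P z) + (4 + m / 2) * lam * Q_form y z"
proof -
  have *: "b (R e y z - (1 / 2) *\<^sub>R T (T e y) z + (1 / 4) *\<^sub>R (T e (T y z) - T y (T e z))) e =
      b (R e y z) e + (1 / 4) * b (T y e) (T z e)" for e
  proof -
    have "b (T (T e y) z) e = - b (T y e) (T z e)"
      using T_skew[of "T e y" z] T_skew_b[of z "T e y" e] T_skew[of e y] b_commute[of "T z e" "T y e"]
      by (simp add: b_simps)
    moreover have "b (T e (T y z)) e = 0"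
      using T_skew_b[of e "T y z" e] by (simp add: b_simps)
    moreover have "b (T y (T e z)) e = b (T y e) (T z e)"
      using T_skew_b[of y "T e z" e] T_skew[of e z] by (simp add: b_simps)
    ultimately show ?thesis by (simp add: b_simps)
  qed
  show ?thesis
    unfolding * sum.distrib sum_distrib_left[symmetric] b_T_T
    using ric_eq[of y z] by (simp add: ric_def algebra_simps)
qed

text \<open>This relates \<open>lam\<close> to arbitrary vertical and horizontal vectors, which
  allows it to be differentiated along fields. Only one slot varies at a time: the full polarization
  has a further term that is skew in both pairs.\<close>

lemma b_T_T_vertical:
  assumes "P u = 0" "P u' = 0"
  shows "b (T u x) (T u y) = lam * b u u * b (P x) (P y)"
    and "b (T u x) (T u' x) = lam * b u u' * b (P x) (P x)"
proof -
  have u: "u = b u v *\<^sub>R v + b u w *\<^sub>R w" and u': "u' = b u' v *\<^sub>R v + b u' w *\<^sub>R w"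
    using decompose[of u] decompose[of u'] assms by simp_all
  have T: "T u x = b u v *\<^sub>R a x + b u w *\<^sub>R J (a x)" "T u' x = b u' v *\<^sub>R a x + b u' w *\<^sub>R J (a x)" for x
    by (subst u, simp add: T_simps Tv Tw) (subst u', simp add: T_simps Tv Tw)
  have b: "b u u' = b u v * b u' v + b u w * b u' w" "b u u = b u v * b u v + b u w * b u w"
    using arg_cong[OF u', of "b u"] arg_cong[OF u, of "b u"] by (simp_all add: b_simps)
  show "b (T u x) (T u y) = lam * b u u * b (P x) (P y)"
    unfolding T b by (simp add: b_simps b_a_a b_Ja_Ja J_skew[of "a x" "a y"] algebra_simps)
  show "b (T u x) (T u' x) = lam * b u u' * b (P x) (P x)"
    unfolding T b by (simp add: b_simps b_a_a b_Ja_Ja algebra_simps)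
qed


subsubsection \<open>The dimension of the horizontal summand\<close>

lemma quaternionic_dim_horizontal: "4 dvd dim (range P)"
proof (rule quaternionic_dim[OF _ linear_J linear_a JJ aJ])
  show "subspace (range P)" by (rule linear_subspace_image[OF linear_P subspace_UNIV])
  show "a (a x) = - lam *\<^sub>R x" if "x \<in> range P" for x using that by (auto simp: a_a)
  show "J x \<in> range P" if "x \<in> range P" for x using that by (auto simp flip: PJ)
  show "a x \<in> range P" for x by (rule range_eqI[of _ _ "a x"]) simp
qed (rule lam_pos)

text \<open>Without horizontal vectors \<open>a\<close> would vanish, its values being horizontal,
  and \<open>v\<close> would be in the kernel of the torsion.\<close>

lemma m_pos: "m > 0"
proof (rule ccontr)
  assume "\<not> m > 0"
  then have "(\<Sum>e\<in>E. b (P e) (P e)) = 0" by (simp add: sum_b_P_P)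
  then have "\<forall>e\<in>E. b (P e) (P e) = 0"
    by (subst (asm) sum_nonneg_eq_0_iff) (auto simp: finite_E b_nonneg)
  then have "\<And>e. e \<in> E \<Longrightarrow> P e = 0" using b_pos by force
  then have "P x = 0" for x
    using linear_eq_0_on_span[OF linear_P, of E x] by (simp add: span_E)
  then have "a x = 0" for x by (metis Pa)
  moreover have "v \<noteq> 0" using b_v linear_0[OF linear_b_right, of v] by force
  ultimately show False using nondegenerate[of v] by (simp add: Tv)
qed

lemma Q_form_eq: "Q_form x y = b (x - P x) (y - P y)"
  by (simp add: P_eq Q_form_def b_simps b_commute[of v x] b_commute[of w x] b_commute[of v y] b_commute[of w y])

end


section \<open>The type of the torsion\<close>

lemma ext_square_eigen:
  assumes "h \<in> ext_square K" and K: "\<forall>a\<in>K. linear a \<and> (\<forall>v\<in>S'. a v = 0) \<and> (\<forall>u. a (f u) = z * a u)"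
  shows "h (f u) v = z * h u v" "h u (f v) = z * h u v"
    "u \<in> S' \<Longrightarrow> h u v = 0" "v \<in> S' \<Longrightarrow> h u v = 0"
proof -
  obtain N :: nat and a b where ab: "\<And>i. i < N \<Longrightarrow> a i \<in> K \<and> b i \<in> K"
    and h: "h = (\<lambda>u v. \<Sum>i<N. wedge11 (a i) (b i) u v)"
    using assms(1) unfolding ext_square_def by blast
  have a: "a i (f u) = z * a i u" "b i (f u) = z * b i u" if "i < N" for i u
    using K ab[OF that] by blast+
  have 0: "a i u = 0" "b i u = 0" if "i < N" "u \<in> S'" for i u
    using K ab[OF that(1)] that(2) by blast+
  show "h (f u) v = z * h u v" "h u (f v) = z * h u v"
    unfolding h wedge11_def sum_distrib_left by (rule sum.cong; simp add: a algebra_simps)+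
  show "h u v = 0" if "u \<in> S'"
    unfolding h wedge11_def by (rule sum.neutral) (simp add: 0 that)
  show "h u v = 0" if "v \<in> S'"
    unfolding h wedge11_def by (rule sum.neutral) (simp add: 0 that)
qed

text \<open>If all factors are eigenvectors for composition with \<open>f\<close> and one eigenvalue
  \<open>z\<close>, the wedge product has this eigenvalue in every slot. It takes two slots from the
  factor vanishing on \<open>S'\<close> and one from the factor vanishing on \<open>S\<close>, which
  gives the last two claims.\<close>

lemma wedge_tensor_eigen:
  assumes t: "t \<in> wedge_tensor (ext_square K2) K1"
    and K2: "\<forall>a\<in>K2. linear a \<and> (\<forall>v\<in>S'. a v = 0) \<and> (\<forall>u. a (f u) = z * a u)"
    and K1: "\<forall>a\<in>K1. (\<forall>v\<in>S. a v = 0) \<and> (\<forall>u. a (f u) = z * a u)"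
  shows "t (f u) v w = z * t u v w" "t u (f v) w = z * t u v w" "t u v (f w) = z * t u v w"
    "u \<in> S \<Longrightarrow> v \<in> S \<Longrightarrow> w \<in> S \<Longrightarrow> t u v w = 0"
    "u \<in> S' \<Longrightarrow> v \<in> S' \<Longrightarrow> t u v w = 0"
proof -
  obtain N :: nat and h c where hc: "\<And>i. i < N \<Longrightarrow> h i \<in> ext_square K2 \<and> c i \<in> K1"
    and t: "t = (\<lambda>u v w. \<Sum>i<N. wedge21 (h i) (c i) u v w)"
    using t unfolding wedge_tensor_def by blast
  note h = ext_square_eigen[OF hc[THEN conjunct1] K2]
  have c: "c i (f u) = z * c i u" "u \<in> S \<Longrightarrow> c i u = 0" if "i < N" for i u
    using K1 hc[OF that] by blast+
  show "t (f u) v w = z * t u v w" "t u (f v) w = z * t u v w" "t u v (f w) = z * t u v w"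
    unfolding t wedge21_def sum_distrib_left by (rule sum.cong; simp add: h c algebra_simps)+
  show "t u v w = 0" if "u \<in> S" "v \<in> S" "w \<in> S"
    unfolding t wedge21_def by (rule sum.neutral) (simp add: c that)
  show "t u v w = 0" if "u \<in> S'" "v \<in> S'"
    unfolding t wedge21_def by (rule sum.neutral) (simp add: h that)
qed

text \<open>\<open>f\<close> is \<open>j\<close> on \<open>S\<close> and \<open>- j\<close> on
  \<open>S'\<close>, so the first summand has eigenvalue i in all three slots and the second has -i.
  The eigenvalues differ, but in each summand they do not depend on the slot; thus \<open>f\<close>
  may be moved between slots, and this survives for the real sum.\<close>

lemma forms_type:
  assumes t: "(\<lambda>u v w. complex_of_real (t u v w)) \<in> forms_20_01_02_10 j S S'"
    and j: "linear j" "\<And>x. x \<in> S \<Longrightarrow> j x \<in> S" "\<And>x. x \<in> S' \<Longrightarrow> j x \<in> S'"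
    and p: "\<And>x. p x \<in> S" "\<And>x. x - p x \<in> S'"
  defines "f \<equiv> \<lambda>x. j (p x) - j (x - p x)"
  shows "t (f u) v w = t u (f v) w" "t u (f v) w = t u v (f w)"
    "u \<in> S \<Longrightarrow> v \<in> S \<Longrightarrow> w \<in> S \<Longrightarrow> t u v w = 0"
    "u \<in> S' \<Longrightarrow> v \<in> S' \<Longrightarrow> t u v w = 0"
proof -
  \<comment> \<open>One computation for all four spaces of 1-forms: forms on \<open>S'\<close> get
    eigenvalue \<open>z\<close> when their type with respect to \<open>j\<close> is
    \<open>- z\<close>, because \<open>f\<close> carries a sign there.\<close>
  have split: "a (j (p u) - j (u - p u)) = z * a u"
    if a: "linear a" "\<forall>v\<in>U'. a v = 0" "\<forall>v\<in>U. a (j v) = y * a v" and U: "U = S \<and> U' = S' \<and> y = z \<or> U = S' \<and> U' = S \<and> y = - z"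
    for a :: "'a \<Rightarrow> complex" and z y U U' u
  proof -
    have "a u = a (p u) + a (u - p u)"
      using linear_add[OF a(1), of "p u" "u - p u"] by simp
    moreover have "a (j (p u) - j (u - p u)) = a (j (p u)) - a (j (u - p u))"
      by (rule linear_diff[OF a(1)])
    ultimately show ?thesis using U a j p by auto
  qed
  obtain r s where r: "r \<in> wedge_tensor (ext_square (forms10 j S S')) (forms01 j S' S)"
    and s: "s \<in> wedge_tensor (ext_square (forms01 j S S')) (forms10 j S' S)"
    and t: "(\<lambda>u v w. complex_of_real (t u v w)) = (\<lambda>u v w. r u v w + s u v w)"
    using t unfolding forms_20_01_02_10_def by blast
  have t: "complex_of_real (t u v w) = r u v w + s u v w" for u v w
    using fun_cong[OF fun_cong[OF fun_cong[OF t]]] .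
  have K: "\<forall>a\<in>forms10 j S S'. linear a \<and> (\<forall>v\<in>S'. a v = 0) \<and> (\<forall>u. a (f u) = \<i> * a u)"
    unfolding forms10_def f_def by (intro ballI conjI allI split[of _ S' S \<i> \<i>]) auto
  have K': "\<forall>a\<in>forms01 j S' S. (\<forall>v\<in>S. a v = 0) \<and> (\<forall>u. a (f u) = \<i> * a u)"
    unfolding forms01_def f_def by (intro ballI conjI allI split[of _ S S' "- \<i>" \<i>]) auto
  have L: "\<forall>a\<in>forms01 j S S'. linear a \<and> (\<forall>v\<in>S'. a v = 0) \<and> (\<forall>u. a (f u) = - \<i> * a u)"
    unfolding forms01_def f_def by (intro ballI conjI allI split[of _ S' S "- \<i>" "- \<i>"]) auto
  have L': "\<forall>a\<in>forms10 j S' S. (\<forall>v\<in>S. a v = 0) \<and> (\<forall>u. a (f u) = - \<i> * a u)"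
    unfolding forms10_def f_def by (intro ballI conjI allI split[of _ S S' \<i> "- \<i>"]) auto
  note r = wedge_tensor_eigen[where f = f and z = \<i>, OF r K K'] and s = wedge_tensor_eigen[where f = f and z = "- \<i>", OF s L L']
  have "complex_of_real (t (f u) v w) = complex_of_real (t u (f v) w)"
    "complex_of_real (t u (f v) w) = complex_of_real (t u v (f w))"
    unfolding t r s by (rule refl)+
  then show "t (f u) v w = t u (f v) w" "t u (f v) w = t u v (f w)"
    by (simp_all only: of_real_eq_iff)
  show "t u v w = 0" if "u \<in> S" "v \<in> S" "w \<in> S"
    using t[of u v w] r(4) s(4) that by simp
  show "t u v w = 0" if "u \<in> S'" "v \<in> S'"
    using t[of u v w] r(5) s(5) that by simp
qed


section \<open>The curvature of a Hermitian manifold with split torsion\<close>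

locale hermitian_splitting =
  fixes A :: "('a::{t2_space,second_countable_topology}, 'e::euclidean_space) chart set"
    and g :: "'a \<Rightarrow> 'e \<Rightarrow> 'e \<Rightarrow> real" and J :: "'a \<Rightarrow> 'e \<Rightarrow> 'e"
    and D Da :: "('a, 'e) conn" and H V :: "'a \<Rightarrow> 'e set" and m :: nat
  assumes hermitian: "hermitian_manifold A g J"
    and dimension: "DIM('e) = 2 * m + 2"
    and levi_civita: "levi_civita A g D"
    and characteristic: "characteristic_connection A g J Da"
    and splitting: "parallel_unitary_splitting A g J Da m H V"
    and torsion_type: "\<And>p. (\<lambda>u v w. complex_of_real (torsion_form A g Da p u v w))
               \<in> forms_20_01_02_10 (J p) (H p) (V p)"
    and nondegenerate: "nondegenerate_torsion A Da"

sublocale hermitian_splitting \<subseteq> skew_torsion_connection A Da g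
  by unfold_locales
    (use hermitian characteristic in \<open>auto simp: hermitian_manifold_def smooth_manifold_def characteristic_connection_def\<close>)

context hermitian_splitting
begin

section \<open>The parallel splitting, the modified complex structure and parallel torsion\<close>

abbreviation pH :: "'a \<Rightarrow> 'e \<Rightarrow> 'e" where "pH p \<equiv> proj_along (H p) (V p)"
abbreviation pV :: "'a \<Rightarrow> 'e \<Rightarrow> 'e" where "pV p \<equiv> proj_along (V p) (H p)"
abbreviation \<tau> :: "'a \<Rightarrow> 'e \<Rightarrow> 'e \<Rightarrow> 'e" where "\<tau> \<equiv> torsion A Da"

lemma linear_J: "linear (J p)" and JJ: "J p (J p x) = - x" and g_J_J: "g p (J p x) (J p y) = g p x y"
  using hermitian by (auto simp: hermitian_manifold_def almost_complex_structure_def)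

lemma parallel_J: "parallel_endo J"
  using hermitian characteristic
  unfolding parallel_endo_def hermitian_manifold_def almost_complex_structure_def characteristic_connection_def
  by simp

lemma subspace_H: "subspace (H p)" and subspace_V: "subspace (V p)"
  and ex1_H: "\<exists>!x. x \<in> H p \<and> v - x \<in> V p"
  using splitting by (auto simp: parallel_unitary_splitting_def smooth_splitting_def)

lemma g_H_V: "u \<in> H p \<Longrightarrow> v \<in> V p \<Longrightarrow> g p u v = 0" "u \<in> H p \<Longrightarrow> v \<in> V p \<Longrightarrow> g p v u = 0"
  and dim_H: "dim (H p) = 2 * m" and dim_V: "dim (V p) = 2"
  using splitting metric_commute[of p v u] by (auto simp: parallel_unitary_splitting_def)

lemma J_H: "u \<in> H p \<Longrightarrow> J p u \<in> H p" and J_V: "v \<in> V p \<Longrightarrow> J p v \<in> V p"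
  using splitting unfolding parallel_unitary_splitting_def by blast+

lemma pH_in: "pH p x \<in> H p" and diff_pH_in: "x - pH p x \<in> V p"
  using theI'[OF ex1_H[of p x]] unfolding proj_along_def by blast+

lemma pH_unique: "y \<in> H p \<Longrightarrow> x - y \<in> V p \<Longrightarrow> pH p x = y"
  using ex1_H[of p x] pH_in[of p x] diff_pH_in[of x p] by blast

lemma pV_eq: "pV p x = x - pH p x"
  unfolding proj_along_def[of "V p"]
proof (rule the_equality)
  show "x - pH p x \<in> V p \<and> x - (x - pH p x) \<in> H p" using pH_in[of p x] diff_pH_in[of x p] by simp
  fix y assume "y \<in> V p \<and> x - y \<in> H p"
  then have "pH p x = x - y" by (intro pH_unique) auto
  then show "y = x - pH p x" by simp
qed

lemma pH_H: "x \<in> H p \<Longrightarrow> pH p x = x" and pH_V: "x \<in> V p \<Longrightarrow> pH p x = 0"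
  by (rule pH_unique; simp add: subspace_0 subspace_H subspace_V)+

lemma linear_pH: "linear (pH p)"
proof (rule linearI)
  show "pH p (x + y) = pH p x + pH p y" for x y
    using subspace_add[OF subspace_V diff_pH_in[of x p] diff_pH_in[of y p]]
    by (intro pH_unique subspace_add[OF subspace_H] pH_in) (simp add: algebra_simps)
  show "pH p (c *\<^sub>R x) = c *\<^sub>R pH p x" for c x
    using subspace_scale[OF subspace_V diff_pH_in[of x p], of c]
    by (intro pH_unique subspace_scale[OF subspace_H] pH_in) (simp add: algebra_simps)
qed

lemma pH_J: "pH p (J p x) = J p (pH p x)"
  using J_V[OF diff_pH_in[of x p]] by (intro pH_unique J_H pH_in) (simp add: linear_diff[OF linear_J])

lemma g_pH: "g p (pH p x) y = g p (pH p x) (pH p y)" "g p x (pH p y) = g p (pH p x) (pH p y)"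
  using g_H_V[OF pH_in[of p x] diff_pH_in[of y p]] g_H_V[OF pH_in[of p y] diff_pH_in[of x p]]
  by (simp_all add: metric_simps)

text \<open>The derivatives of the two components of X lie in \<H> and \<V> respectively, so they
  are the components of the derivative of X by uniqueness of the decomposition.\<close>

lemma parallel_pH: "parallel_endo pH"
  unfolding parallel_endo_def
proof (intro conjI allI impI)
  show "linear (pH p)" for p by (rule linear_pH)
next
  fix W X assume "open W \<and> smooth_vf A W X"
  then show "smooth_vf A W (\<lambda>q. pH q (X q))"
    using splitting by (auto simp: parallel_unitary_splitting_def smooth_splitting_def)
next
  fix W X p v assume W: "open W \<and> p \<in> W \<and> smooth_vf A W X"
  have s: "smooth_vf A W (\<lambda>q. pH q (X q))" "smooth_vf A W (\<lambda>q. pV q (X q))"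
    using splitting W by (auto simp: parallel_unitary_splitting_def smooth_splitting_def)
  have par: "parallel_subbundle A Da H" "parallel_subbundle A Da V"
    using splitting by (auto simp: parallel_unitary_splitting_def)
  have h: "Da p v (\<lambda>q. pH q (X q)) \<in> H p"
    using par(1)[unfolded parallel_subbundle_def, rule_format, of W p "\<lambda>q. pH q (X q)"] W s pH_in by auto
  have "Da p v (\<lambda>q. pV q (X q)) \<in> V p"
    using par(2)[unfolded parallel_subbundle_def, rule_format, of W p "\<lambda>q. pV q (X q)"] W s diff_pH_in
    by (auto simp: pV_eq)
  moreover have "Da p v (\<lambda>q. pV q (X q)) = Da p v X - Da p v (\<lambda>q. pH q (X q))"
    unfolding pV_eq by (rule conn_diff) (use W s in auto)
  ultimately show "Da p v (\<lambda>q. pH q (X q)) = pH p (Da p v X)"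
    using pH_unique[OF h] by simp
qed

definition I :: "'a \<Rightarrow> 'e \<Rightarrow> 'e" where
  "I p x = J p (pH p x) - J p (x - pH p x)"

lemma I_eq: "I p x = 2 *\<^sub>R J p (pH p x) - J p x"
  by (simp add: I_def linear_diff[OF linear_J] scaleR_2)

lemma linear_I: "linear (I p)"
  unfolding I_eq by (rule linearI)
    (simp_all add: linear_add[OF linear_J] linear_add[OF linear_pH] linear_scale[OF linear_J]
      linear_scale[OF linear_pH] algebra_simps)

lemma I_I: "I p (I p x) = - x"
  by (simp add: I_eq linear_add[OF linear_J] linear_add[OF linear_pH] linear_diff[OF linear_J] linear_diff[OF linear_pH] linear_scale[OF linear_J]
      linear_scale[OF linear_pH] pH_J JJ pH_H pH_in linear_neg[OF linear_pH] linear_neg[OF linear_J] scaleR_2 algebra_simps)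

lemma parallel_I: "parallel_endo I"
  unfolding parallel_endo_def
proof (intro conjI allI impI)
  show "linear (I p)" for p by (rule linear_I)
next
  fix W X assume W: "open W \<and> smooth_vf A W X"
  then show "smooth_vf A W (\<lambda>q. I q (X q))"
    unfolding I_eq
    by (intro smooth_vf_diff smooth_vf_const_scale smooth_vf_parallel_endo[OF parallel_J]
        smooth_vf_parallel_endo[OF parallel_pH]) auto
next
  fix W X p v assume W: "open W \<and> p \<in> W \<and> smooth_vf A W X"
  have s: "smooth_vf A W (\<lambda>q. pH q (X q))" "smooth_vf A W (\<lambda>q. J q (pH q (X q)))" "smooth_vf A W (\<lambda>q. J q (X q))"
    using W by (auto intro!: smooth_vf_parallel_endo[OF parallel_J] smooth_vf_parallel_endo[OF parallel_pH])
  have "Da p v (\<lambda>q. 2 *\<^sub>R J q (pH q (X q)) - J q (X q)) =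
      2 *\<^sub>R Da p v (\<lambda>q. J q (pH q (X q))) - Da p v (\<lambda>q. J q (X q))"
    using conn_diff[OF _ _ smooth_vf_const_scale[OF _ s(2)] s(3)] conn_const_scale[OF _ _ s(2)] W by simp
  then show "Da p v (\<lambda>q. I q (X q)) = I p (Da p v X)"
    using conn_parallel_endo[OF parallel_J _ _ s(1)] conn_parallel_endo[OF parallel_J, of W p X v]
      conn_parallel_endo[OF parallel_pH, of W p X v] W by (simp add: I_eq)
qed

lemma g_J_skew: "g p (J p x) y = - g p x (J p y)"
  using g_J_J[of p x "J p y"] by (simp add: JJ metric_simps)

lemma g_I_skew: "g p (I p x) y = - g p x (I p y)"
  using g_J_skew[of p "pH p x" y] g_J_skew[of p x y] g_pH[of p x "J p y"]
  by (simp add: I_eq metric_simps pH_J)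

lemma torsion_type_I:
  "g p (\<tau> p (I p u) v) w = g p (\<tau> p u (I p v)) w" "g p (\<tau> p u (I p v)) w = g p (\<tau> p u v) (I p w)"
  and torsion_H_H_H: "u \<in> H p \<Longrightarrow> v \<in> H p \<Longrightarrow> w \<in> H p \<Longrightarrow> g p (\<tau> p u v) w = 0"
  and torsion_V_V: "u \<in> V p \<Longrightarrow> v \<in> V p \<Longrightarrow> g p (\<tau> p u v) w = 0"
  using forms_type[OF torsion_type[of p] linear_J J_H J_V pH_in diff_pH_in]
  unfolding torsion_form_def I_def by blast+

lemma torsion_I: "\<tau> p (I p u) v = \<tau> p u (I p v)" "\<tau> p u (I p v) = - I p (\<tau> p u v)"
  by (rule metric_eqI[of p]; simp add: torsion_type_I g_I_skew metric_simps)+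

text \<open>Cyclic symmetry of the torsion form rewrites g(T(T(x,y),z),w) as g(T(x,y),T(z,w)), which
  brings the Bianchi identity into the shape of the type argument for \<open>I\<close>.\<close>

lemma nabla_torsion_zero: "nabla_torsion p x y z = 0"
proof (rule metric_eqI[of p])
  fix w
  have "g p (nabla_torsion p x y z) w = 0"
  proof (rule nearly_kaehler_parallel_torsion[where I = "I p" and N = "\<lambda>x y z w. g p (nabla_torsion p x y z) w"
        and R = "\<lambda>x y z w. g p (curvature A Da p x y z) w" and G = "\<lambda>x y z w. g p (\<tau> p x y) (\<tau> p z w)"])
    fix x y z w
    show "g p (curvature A Da p x y w) z = - g p (curvature A Da p x y z) w"
      by (rule curvature_metric_skew)
    show "g p (curvature A Da p x y (I p z)) w = - g p (curvature A Da p x y z) (I p w)"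
      by (simp add: parallel_endo_curvature[OF parallel_I] g_I_skew)
    show "g p (nabla_torsion p x z y) w = - g p (nabla_torsion p x y z) w"
      using nabla_torsion_skew[of p x z y] by (simp add: metric_simps)
    show "g p (nabla_torsion p x y w) z = - g p (nabla_torsion p x y z) w"
      by (rule nabla_torsion_metric_skew)
    show 1: "g p (nabla_torsion p x y (I p z)) w = g p (nabla_torsion p x y z) (I p w)"
      by (simp add: nabla_torsion_endo_neg[OF parallel_I torsion_I(2)] metric_simps g_I_skew)
    show "g p (nabla_torsion p x (I p y) z) w = g p (nabla_torsion p x y z) (I p w)"
      unfolding nabla_torsion_endo[OF parallel_I torsion_I(1)] by (rule 1)
    show "g p (\<tau> p (I p x) y) (\<tau> p z w) = - g p (\<tau> p x y) (\<tau> p z (I p w))"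
      "g p (\<tau> p x (I p y)) (\<tau> p z w) = - g p (\<tau> p x y) (\<tau> p z (I p w))"
      "g p (\<tau> p x y) (\<tau> p (I p z) w) = g p (\<tau> p x y) (\<tau> p z (I p w))"
      by (simp_all add: torsion_I metric_simps g_I_skew)
    show "g p (curvature A Da p x y z) (I p (I p w)) = - g p (curvature A Da p x y z) w"
      "g p (nabla_torsion p x y z) (I p (I p w)) = - g p (nabla_torsion p x y z) w"
      "g p (\<tau> p x y) (\<tau> p z (I p (I p w))) = - g p (\<tau> p x y) (\<tau> p z w)"
      by (simp_all add: I_I metric_simps torsion_simps)
    show "g p (curvature A Da p x y z) w + g p (curvature A Da p y z x) w + g p (curvature A Da p z x y) w =
       g p (\<tau> p x y) (\<tau> p z w) + g p (\<tau> p y z) (\<tau> p x w) + g p (\<tau> p z x) (\<tau> p y w)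
       + g p (nabla_torsion p x y z) w + g p (nabla_torsion p y z x) w + g p (nabla_torsion p z x y) w"
      using arg_cong[OF first_bianchi[of p x y z], of "\<lambda>u. g p u w"]
        torsion_form_cyclic[of p "\<tau> p x y" z w] torsion_form_cyclic[of p "\<tau> p y z" x w]
        torsion_form_cyclic[of p "\<tau> p z x" y w] metric_commute[of p "\<tau> p z w"]
        metric_commute[of p "\<tau> p x w"] metric_commute[of p "\<tau> p y w"]
      by (simp add: metric_simps)
  qed
  then show "g p (nabla_torsion p x y z) w = g p 0 w" by (simp add: metric_simps)
qed

section \<open>Passage to a single tangent space\<close>

lemma vertical_unit_exists: "\<exists>v\<in>V p. g p v v = 1"
proof -
  have "\<not> V p \<subseteq> {0}" using dim_V[of p] dim_eq_0[of "V p"] by linarith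
  then obtain x where x: "x \<in> V p" "x \<noteq> 0" by blast
  have "g p x x > 0" by (rule metric_pos[OF x(2)])
  then have "g p ((1 / sqrt (g p x x)) *\<^sub>R x) ((1 / sqrt (g p x x)) *\<^sub>R x) = 1"
    by (simp add: metric_simps field_simps)
  then show ?thesis using subspace_scale[OF subspace_V x(1), of "1 / sqrt (g p x x)"] by blast
qed

lemma g_J_self: "g p x (J p x) = 0" "g p (J p x) x = 0"
  using g_J_skew[of p x x] metric_commute[of p x "J p x"] by linarith+

text \<open>A unit vector v and J v form an orthonormal basis of the plane \<V>. The formula
  identifies the projection built into \<open>torsion_point\<close> with \<open>pH\<close>, so the
  conditions there become properties of the splitting.\<close>

lemma pH_eq:
  assumes v: "v \<in> V p" "g p v v = 1"
  shows "x - g p x v *\<^sub>R v - g p x (J p v) *\<^sub>R J p v = pH p x"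
proof (rule pH_unique[symmetric])
  have on: "g p x y = (if x = y then 1 else 0)" if "x \<in> {v, J p v}" "y \<in> {v, J p v}" for x y
    using that v g_J_self[of p v] g_J_J[of p v v] by auto
  have "v \<noteq> J p v" using g_J_self[of p v] v by auto
  then have "card {v, J p v} = 2" by simp
  moreover have "independent {v, J p v}"
    by (rule orthonormal_independent[OF _ on]) (use riemannian_metric in \<open>auto simp: riemannian_metric_def\<close>)
  ultimately have "V p \<subseteq> span {v, J p v}"
    using v J_V dim_V[of p] by (intro card_ge_dim_independent) auto
  then have "x - pH p x \<in> span {v, J p v}" using diff_pH_in by blast
  then obtain \<alpha> \<beta> where "x - pH p x - \<alpha> *\<^sub>R v = \<beta> *\<^sub>R J p v"
    by (auto simp: span_breakdown_eq)
  then have ab: "x - pH p x = \<alpha> *\<^sub>R v + \<beta> *\<^sub>R J p v" by (simp add: algebra_simps)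
  have x: "x = pH p x + (\<alpha> *\<^sub>R v + \<beta> *\<^sub>R J p v)" using ab by (simp add: algebra_simps)
  have "g p x v = \<alpha>" "g p x (J p v) = \<beta>"
    using arg_cong[OF x, of "\<lambda>u. g p u v"] arg_cong[OF x, of "\<lambda>u. g p u (J p v)"]
      g_H_V(1)[OF pH_in v(1)] g_H_V(1)[OF pH_in J_V[OF v(1)]] g_J_self[of p v] g_J_J[of p v v] v
    by (simp_all add: metric_simps)
  then have "x - g p x v *\<^sub>R v - g p x (J p v) *\<^sub>R J p v = pH p x"
    using ab by (simp add: algebra_simps)
  then show "x - g p x v *\<^sub>R v - g p x (J p v) *\<^sub>R J p v \<in> H p"
    "x - (x - g p x v *\<^sub>R v - g p x (J p v) *\<^sub>R J p v) \<in> V p"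
    using pH_in diff_pH_in by simp_all
qed

text \<open>By skewness a vertical component of T(u,x) would be a value of T on two vertical
  vectors, and those vanish.\<close>

lemma torsion_V_H: "u \<in> V p \<Longrightarrow> x \<in> H p \<Longrightarrow> \<tau> p u x \<in> H p"
proof -
  assume u: "u \<in> V p" and x: "x \<in> H p"
  have "g p (\<tau> p u x - pH p (\<tau> p u x)) z = 0" for z
  proof -
    have "g p (\<tau> p u x - pH p (\<tau> p u x)) z = g p (\<tau> p u x) (z - pH p z)"
      using g_pH[of p "\<tau> p u x" z] by (simp add: metric_simps)
    also have "\<dots> = - g p (\<tau> p u (z - pH p z)) x" by (rule torsion_form_skew_right)
    also have "\<dots> = 0" using torsion_V_V[OF u diff_pH_in] by simp
    finally show ?thesis .
  qed
  then have "\<tau> p u x - pH p (\<tau> p u x) = 0" by (intro metric_eqI[of p]) (simp add: metric_simps)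
  then show ?thesis using pH_in by (metis eq_iff_diff_eq_0)
qed

lemma torsion_point:
  assumes E: "orthonormal_frame (g p) E" and v: "v \<in> V p" "g p v v = 1"
  shows "torsion_point (g p) E (J p) (\<tau> p) (curvature A Da p) v m"
proof (intro torsion_point.intro framed_space.intro torsion_point_axioms.intro)
  note P = pH_eq[OF v]
  have IH: "I p x = J p x" if "x \<in> H p" for x using that by (simp add: I_eq pH_H scaleR_2)
  have IV: "I p x = - J p x" if "x \<in> V p" for x
    using that by (simp add: I_eq pH_V linear_0[OF linear_J])
  show pd: "positive_definite (g p)" using riemannian_metric by (simp add: riemannian_metric_def)
  show "orthonormal_frame (g p) E" by (rule E)
  have "independent E" by (rule orthonormal_independent[OF pd]) (use E in \<open>auto simp: orthonormal_frame_def\<close>)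
  then show "card E = 2 * m + 2"
    using dim_eq_card[of E UNIV] E by (simp add: orthonormal_frame_def dimension)
  show "linear (J p)" by (rule linear_J)
  show "J p (J p x) = - x" for x by (rule JJ)
  show "g p (J p x) (J p y) = g p x y" for x y by (rule g_J_J)
  show "g p v v = 1" by (rule v)
  show "linear (\<lambda>x. \<tau> p x y)" for y by (rule linear_torsion_left)
  show "linear (\<tau> p x)" for x by (rule linear_torsion_right)
  show "\<tau> p x y = - \<tau> p y x" for x y by (rule torsion_skew)
  show "g p (\<tau> p x y) z = - g p (\<tau> p x z) y" for x y z by (rule torsion_form_skew_right)
  show "\<tau> p (x - g p x v *\<^sub>R v - g p x (J p v) *\<^sub>R J p v) (y - g p y v *\<^sub>R v - g p y (J p v) *\<^sub>R J p v)
      - g p (\<tau> p (x - g p x v *\<^sub>R v - g p x (J p v) *\<^sub>R J p v)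
          (y - g p y v *\<^sub>R v - g p y (J p v) *\<^sub>R J p v)) v *\<^sub>R v
      - g p (\<tau> p (x - g p x v *\<^sub>R v - g p x (J p v) *\<^sub>R J p v)
          (y - g p y v *\<^sub>R v - g p y (J p v) *\<^sub>R J p v)) (J p v) *\<^sub>R J p v = 0" for x y
    unfolding P
  proof (rule metric_eqI[of p])
    fix z
    have "g p (pH p (\<tau> p (pH p x) (pH p y))) z = g p (\<tau> p (pH p x) (pH p y)) (pH p z)"
      using g_pH[of p "\<tau> p (pH p x) (pH p y)" z] by linarith
    then show "g p (pH p (\<tau> p (pH p x) (pH p y))) z = g p 0 z"
      by (simp add: torsion_H_H_H pH_in metric_simps)
  qed
  show "\<tau> p v (J p v) = 0"
    by (rule metric_eqI[of p]) (simp add: torsion_V_V v J_V metric_simps)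
  \<comment> \<open>As \<open>I\<close> is \<open>J\<close> on \<H> and \<open>- J\<close> on \<V>,
    the rules for \<open>I\<close> give T(v, J x) = - J T(v,x) here and T(J v, x) = J T(v,x) in the
    next step.\<close>
  show TJ: "\<tau> p v (J p (x - g p x v *\<^sub>R v - g p x (J p v) *\<^sub>R J p v)) =
      - J p (\<tau> p v (x - g p x v *\<^sub>R v - g p x (J p v) *\<^sub>R J p v))" for x
    unfolding P using torsion_I(2)[of p v "pH p x"] IH[OF pH_in] IH[OF torsion_V_H[OF v(1) pH_in]] by simp
  show "\<tau> p (J p v) (x - g p x v *\<^sub>R v - g p x (J p v) *\<^sub>R J p v) =
      J p (\<tau> p v (x - g p x v *\<^sub>R v - g p x (J p v) *\<^sub>R J p v))" for x
    using torsion_I(1)[of p v "pH p x"] IH[OF pH_in] IV[OF v(1)] TJ[of x]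
    unfolding P by (simp add: torsion_simps)
  show "\<exists>y. \<tau> p x y \<noteq> 0" if "x \<noteq> 0" for x
    using nondegenerate that by (simp add: nondegenerate_torsion_def)
  show "linear (\<lambda>x. curvature A Da p x y z)" for y z by (rule linear_curvature_left)
  show "linear (\<lambda>y. curvature A Da p x y z)" for x z by (rule linear_curvature_middle)
  show "linear (curvature A Da p x y)" for x y by (rule linear_curvature)
  show "curvature A Da p y x z = - curvature A Da p x y z" for x y z by (rule curvature_skew)
  show "g p (curvature A Da p x y z) u = - g p (curvature A Da p x y u) z" for x y z u
    by (rule curvature_metric_skew)
  show "curvature A Da p x y (J p z) = J p (curvature A Da p x y z)" for x y z
    by (rule parallel_endo_curvature[OF parallel_J])
  show "curvature A Da p x y (z - g p z v *\<^sub>R v - g p z (J p v) *\<^sub>R J p v) =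
      curvature A Da p x y z - g p (curvature A Da p x y z) v *\<^sub>R v
      - g p (curvature A Da p x y z) (J p v) *\<^sub>R J p v" for x y z
    unfolding P by (rule parallel_endo_curvature[OF parallel_pH])
  show "g p (curvature A Da p x y z) u + g p (curvature A Da p y z x) u + g p (curvature A Da p z x y) u =
      g p (\<tau> p x y) (\<tau> p z u) + g p (\<tau> p y z) (\<tau> p x u) + g p (\<tau> p z x) (\<tau> p y u)" for x y z u
    using arg_cong[OF first_bianchi[of p x y z], of "\<lambda>w. g p w u"]
      torsion_form_cyclic[of p "\<tau> p x y" z u] torsion_form_cyclic[of p "\<tau> p y z" x u]
      torsion_form_cyclic[of p "\<tau> p z x" y u] metric_commute[of p "\<tau> p z u"]
      metric_commute[of p "\<tau> p x u"] metric_commute[of p "\<tau> p y u"]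
    by (simp add: metric_simps nabla_torsion_zero)
  show "curvature A Da p x y (\<tau> p z u) =
      \<tau> p (curvature A Da p x y z) u + \<tau> p z (curvature A Da p x y u)" for x y z u
    by (rule curvature_torsion[OF nabla_torsion_zero])
qed

text \<open>The unit vector v enters only the proof. The conclusions use the projections and |T|^2
  instead, so they can be compared between different points.\<close>

lemma pointwise_curvature:
  fixes p and l :: real
  defines "T2 \<equiv> norm_sq3 (g p) (torsion_form A g Da p)"
  defines "l \<equiv> T2 / (12 * real m)"
  shows "m > 0" "even m" "l > 0"
    and "Ricci A g Da p y z = (real m + 2) * l * g p (pH p y) (pH p z) + 4 * l * g p (pV p y) (pV p z)"
    and "scalar_curvature A g Da p = (real m + 2) * l * (2 * real m) + 8 * l"
    and "Ricci A g D p y z = (real m + 3) * l * g p (pH p y) (pH p z) + (4 + real m / 2) * l * g p (pV p y) (pV p z)"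
    and "scalar_curvature A g D p = (real m + 3) * l * (2 * real m) + (8 + real m) * l"
    and "u \<in> V p \<Longrightarrow> x \<in> H p \<Longrightarrow> x' \<in> H p \<Longrightarrow> g p (\<tau> p u x) (\<tau> p u x') = l * g p u u * g p x x'"
    and "u \<in> V p \<Longrightarrow> u' \<in> V p \<Longrightarrow> x \<in> H p \<Longrightarrow> g p (\<tau> p u x) (\<tau> p u' x) = l * g p u u' * g p x x"
proof -
  obtain v where v: "v \<in> V p" "g p v v = 1" using vertical_unit_exists by blast
  let ?E = "frame (g p)"
  have "positive_definite (g p)" using riemannian_metric by (simp add: riemannian_metric_def)
  from someI_ex[OF orthonormal_frame_exists[OF this]] have E: "orthonormal_frame (g p) ?E"
    unfolding frame_def .
  interpret tp: torsion_point "g p" ?E "J p" "\<tau> p" "curvature A Da p" v m "J p v"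
    "\<lambda>x. x - g p x v *\<^sub>R v - g p x (J p v) *\<^sub>R J p v" "\<tau> p v"
    by (rule torsion_point[OF E v])
  note P = pH_eq[OF v]
  show m: "m > 0" by (rule tp.m_pos)
  have l: "l = tp.lam"
    using tp.norm_sq_T m by (simp add: l_def T2_def norm_sq3_def torsion_form_def)
  show "l > 0" unfolding l by (rule tp.lam_pos)
  have "range (pH p) = H p" using pH_in pH_H by (metis image_subsetI rangeI subsetI subset_antisym)
  then show "even m"
    using tp.quaternionic_dim_horizontal unfolding P by (simp add: dim_H)
  have Q: "tp.Q_form y z = g p (pV p y) (pV p z)" for y z
    unfolding tp.Q_form_eq P pV_eq ..
  show R: "Ricci A g Da p y z = (real m + 2) * l * g p (pH p y) (pH p z) + 4 * l * g p (pV p y) (pV p z)" for y z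
    using tp.ric_eq[of y z] unfolding P Q l tp.ric_def Ricci_def curvature4_def
    by (simp only: of_nat_add of_nat_numeral)
  show R': "Ricci A g D p y z = (real m + 3) * l * g p (pH p y) (pH p z) + (4 + real m / 2) * l * g p (pV p y) (pV p z)" for y z
    using tp.levi_civita_ric_eq[of y z] unfolding P Q l Ricci_def curvature4_def
      levi_civita_curvature[OF levi_civita nabla_torsion_zero] by (simp only: of_nat_add of_nat_numeral)
  have s: "(\<Sum>e\<in>?E. g p (pH p e) (pH p e)) = 2 * real m" "(\<Sum>e\<in>?E. g p (pV p e) (pV p e)) = 2"
    using tp.sum_b_P_P tp.sum_Q_form unfolding P Q by simp_all
  show "scalar_curvature A g Da p = (real m + 2) * l * (2 * real m) + 8 * l"
    "scalar_curvature A g D p = (real m + 3) * l * (2 * real m) + (8 + real m) * l"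
    unfolding scalar_curvature_def R R' sum.distrib sum_distrib_left[symmetric] s by (simp_all add: algebra_simps)
  show "g p (\<tau> p u x) (\<tau> p u x') = l * g p u u * g p x x'" if "u \<in> V p" "x \<in> H p" "x' \<in> H p"
    using tp.b_T_T_vertical(1)[of u u x x'] that unfolding P l by (simp add: pH_V pH_H)
  show "g p (\<tau> p u x) (\<tau> p u' x) = l * g p u u' * g p x x" if "u \<in> V p" "u' \<in> V p" "x \<in> H p"
    using tp.b_T_T_vertical(2)[of u u' x] that unfolding P l by (simp add: pH_V pH_H)
qed

section \<open>From pointwise formulas to parallel tensors\<close>

definition lam :: "'a \<Rightarrow> real" where
  "lam p = norm_sq3 (g p) (torsion_form A g Da p) / (12 * real m)"

lemmas pointwise = pointwise_curvature[folded lam_def]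

text \<open>For local sections Y of \<V> and X of \<H> the function F = |T(Y,X)|^2 equals
  \<open>lam\<close> times h = |Y|^2 |X|^2, so \<open>lam\<close> is a quotient of smooth functions
  where h does not vanish. Parallelism of T and g gives dF = lam dh, and comparison with the product
  rule leaves h d(lam) = 0.\<close>

lemma lam_smooth_parallel:
  "\<exists>W. open W \<and> p \<in> W \<and> smooth_fun A W lam" "dir_deriv A p u lam = 0"
proof -
  obtain v0 where v0: "v0 \<in> V p" "g p v0 v0 = 1" using vertical_unit_exists by blast
  have "\<not> H p \<subseteq> {0}" using dim_H[of p] pointwise(1) dim_eq_0[of "H p"] by linarith
  then obtain x0 where x0: "x0 \<in> H p" "x0 \<noteq> 0" by blast
  let ?W = "dom_of (chart_at A p)"
  note W = extend_nbhd[of p]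
  \<comment> \<open>Constant extensions need not stay in the summands, so they are projected back.
    At \<open>p\<close> this changes nothing, and the derivatives of \<open>X\<close> and
    \<open>Y\<close> stay in \<H> and \<V> as the projections are parallel.\<close>
  define Y where "Y q = extend A p v0 q - pH q (extend A p v0 q)" for q
  define X where "X q = pH q (extend A p x0 q)" for q
  define F where "F q = g q (\<tau> q (Y q) (X q)) (\<tau> q (Y q) (X q))" for q
  define h where "h q = g q (Y q) (Y q) * g q (X q) (X q)" for q
  have sX: "smooth_vf A ?W X" and sY: "smooth_vf A ?W Y"
    unfolding X_def Y_def
    by (intro smooth_vf_diff smooth_vf_parallel_endo[OF parallel_pH] W smooth_vf_extend)+
  have XH: "X q \<in> H q" and YV: "Y q \<in> V q" for q
    by (simp_all add: X_def Y_def pH_in diff_pH_in)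
  have DX: "Da p u X \<in> H p"
    using conn_parallel_endo[OF parallel_pH W smooth_vf_extend] pH_in unfolding X_def by simp
  have DY: "Da p u Y \<in> V p"
  proof -
    have "Da p u Y = Da p u (extend A p v0) - pH p (Da p u (extend A p v0))"
      unfolding Y_def
      using conn_diff[OF W smooth_vf_extend smooth_vf_parallel_endo[OF parallel_pH W(1) smooth_vf_extend]]
        conn_parallel_endo[OF parallel_pH W smooth_vf_extend] by simp
    then show ?thesis by (simp add: diff_pH_in)
  qed
  have F_eq: "F q = lam q * h q" for q
    unfolding F_def h_def using pointwise(8)[OF YV XH XH] by simp
  have Yp: "Y p = v0" and Xp: "X p = x0"
    using v0 x0 by (simp_all add: X_def Y_def pH_H pH_V)
  have hp: "h p > 0" using v0 metric_pos[OF x0(2)] by (simp add: h_def Xp Yp)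
  have sF: "smooth_fun A ?W F" and sh: "smooth_fun A ?W h"
    unfolding F_def h_def by (intro smooth_fun_mult smooth_fun_metric smooth_vf_torsion W sX sY)+
  let ?U = "{q \<in> ?W. h q \<noteq> 0}"
  have "open (?W \<inter> h -` (- {0}))"
    by (rule continuous_open_preimage[OF continuous_on_smooth_fun[OF W(1) order_refl chart_at(1) sh] W(1)]) auto
  moreover have "?W \<inter> h -` (- {0}) = ?U" by auto
  ultimately have U: "open ?U" by simp
  have pU: "p \<in> ?U" using W hp by simp
  have sl: "smooth_fun A ?U lam"
  proof (rule smooth_fun_cong[OF U])
    show "smooth_fun A ?U (\<lambda>q. F q / h q)"
      by (rule smooth_fun_divide[OF U smooth_fun_subset[OF sF] smooth_fun_subset[OF sh]]) auto
  qed (simp add: F_eq)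
  then show "\<exists>W. open W \<and> p \<in> W \<and> smooth_fun A W lam" using U pU by blast
  have "dir_deriv A p u F = dir_deriv A p u lam * h p + lam p * dir_deriv A p u h"
    unfolding F_eq[abs_def] by (rule dir_deriv_mult[OF U pU sl smooth_fun_subset[OF sh]]) auto
  moreover have "dir_deriv A p u h = 2 * g p (Da p u Y) (Y p) * g p (X p) (X p)
      + 2 * g p (Y p) (Y p) * g p (Da p u X) (X p)"
    unfolding h_def dir_deriv_mult[OF W smooth_fun_metric[OF W(1) sY sY] smooth_fun_metric[OF W(1) sX sX]]
      dir_deriv_metric[OF W sY sY] dir_deriv_metric[OF W sX sX]
    by (simp add: metric_commute[of p "Y p" "Da p u Y"] metric_commute[of p "X p" "Da p u X"])
  \<comment> \<open>The derivative of T(Y,X) has one term with Y differentiated and one with X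
    differentiated; the two polarized formulas for \<open>lam\<close> evaluate its product with
    T(Y,X).\<close>
  moreover have "dir_deriv A p u F = lam p * (2 * g p (Da p u Y) (Y p) * g p (X p) (X p)
      + 2 * g p (Y p) (Y p) * g p (Da p u X) (X p))"
  proof -
    have sT: "smooth_vf A ?W (\<lambda>q. \<tau> q (Y q) (X q))" by (rule smooth_vf_torsion[OF W(1) sY sX])
    have DT: "Da p u (\<lambda>q. \<tau> q (Y q) (X q)) = \<tau> p (Da p u Y) (X p) + \<tau> p (Y p) (Da p u X)"
      using torsion_deriv_eq_nabla[OF W sY sX, of u] by (simp add: nabla_torsion_zero torsion_deriv_def algebra_simps)
    have "dir_deriv A p u F = 2 * g p (Da p u (\<lambda>q. \<tau> q (Y q) (X q))) (\<tau> p (Y p) (X p))"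
      unfolding F_def dir_deriv_metric[OF W sT sT] by (simp add: metric_commute[of p "\<tau> p (Y p) (X p)"])
    then show ?thesis
      unfolding DT metric_simps pointwise(9)[OF DY YV XH] pointwise(8)[OF YV DX XH] by (simp add: algebra_simps)
  qed
  ultimately show "dir_deriv A p u lam = 0" using hp by simp
qed

text \<open>The projections and g are parallel and \<open>lam\<close> has zero derivative, so each
  summand obeys the product rule of a parallel form. Both Ricci tensors are of this shape.\<close>

lemma parallel_split_form:
  "parallel_form2 A Da (\<lambda>p y z. c * lam p * g p (pH p y) (pH p z) + d * lam p * g p (pV p y) (pV p z))"
    (is "parallel_form2 A Da ?B")
proof -
  have sl: "smooth_fun A W lam" if "open W" for W
    by (rule smooth_fun_local[OF that]) (rule lam_smooth_parallel)
  have sV: "smooth_vf A W (\<lambda>q. pV q (X q))" if "open W" "smooth_vf A W X" for W X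
    unfolding pV_eq by (intro smooth_vf_diff smooth_vf_parallel_endo[OF parallel_pH] that)
  note sH = smooth_vf_parallel_endo[OF parallel_pH]
  have DH: "Da p v (\<lambda>q. pH q (X q)) = pH p (Da p v X)" and DV: "Da p v (\<lambda>q. pV q (X q)) = pV p (Da p v X)"
    if "open W" "p \<in> W" "smooth_vf A W X" for W X p v
    using conn_parallel_endo[OF parallel_pH that] conn_diff[OF that sH[OF that(1,3)]]
    by (simp_all add: pV_eq)
  have dl: "dir_deriv A p u (\<lambda>q. k * lam q * f q) = k * lam p * dir_deriv A p u f"
    if "open W" "p \<in> W" "smooth_fun A W f" for W k f p u
    using dir_deriv_mult[OF that(1,2) smooth_fun_mult[OF that(1) smooth_fun_const sl[OF that(1)]] that(3)]
      dir_deriv_mult[OF that(1,2) smooth_fun_const sl[OF that(1)]] lam_smooth_parallel(2) by simp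
  have sB: "smooth_fun A W (\<lambda>q. k * lam q * g q (X q) (Y q))"
    if "open W" "smooth_vf A W X" "smooth_vf A W Y" for W k X Y
    by (intro smooth_fun_mult smooth_fun_const sl smooth_fun_metric that)
  show ?thesis
    unfolding parallel_form2_def smooth_form2_def
  proof (intro conjI allI impI)
    fix W X Y assume "open W \<and> smooth_vf A W X \<and> smooth_vf A W Y"
    then show "smooth_fun A W (\<lambda>p. ?B p (X p) (Y p))"
      by (intro smooth_fun_add sB sH sV) auto
  next
    fix W Y Z p v assume "open W \<and> p \<in> W \<and> smooth_vf A W Y \<and> smooth_vf A W Z"
    then have W: "open W" "p \<in> W" and Y: "smooth_vf A W Y" and Z: "smooth_vf A W Z" by auto
    note s = sH[OF W(1) Y] sH[OF W(1) Z] sV[OF W(1) Y] sV[OF W(1) Z]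
    note m = smooth_fun_metric[OF W(1) s(1,2)] smooth_fun_metric[OF W(1) s(3,4)]
    show "dir_deriv A p v (\<lambda>q. ?B q (Y q) (Z q)) = ?B p (Da p v Y) (Z p) + ?B p (Y p) (Da p v Z)"
      unfolding dir_deriv_add[OF W sB[OF W(1) s(1,2)] sB[OF W(1) s(3,4)]] dl[OF W m(1)] dl[OF W m(2)]
        dir_deriv_metric[OF W s(1,2)] dir_deriv_metric[OF W s(3,4)] DH[OF W Y] DH[OF W Z] DV[OF W Y] DV[OF W Z]
      by (simp add: algebra_simps)
  qed
qed

lemma positive_definite_split_form:
  assumes "c > 0" "d > 0"
  shows "positive_definite (\<lambda>y z. c * g p (pH p y) (pH p z) + d * g p (pV p y) (pV p z))"
  unfolding positive_definite_def
proof (intro conjI allI impI)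
  have linV: "linear (pV p)"
    unfolding pV_eq by (rule linear_compose_sub[OF linear_ident linear_pH])
  show "linear (\<lambda>z. c * g p (pH p u) (pH p z) + d * g p (pV p u) (pV p z))" for u
    by (rule linearI) (simp_all add: linear_add[OF linear_pH] linear_add[OF linV]
        linear_scale[OF linear_pH] linear_scale[OF linV] metric_simps algebra_simps)
  show "c * g p (pH p u) (pH p z) + d * g p (pV p u) (pV p z) = c * g p (pH p z) (pH p u) + d * g p (pV p z) (pV p u)" for u z
    using metric_commute[of p "pH p u"] metric_commute[of p "pV p u"] by simp
  fix v :: 'e assume "v \<noteq> 0"
  have nn: "g p x x \<ge> 0" for x using metric_pos[of x p] by (cases "x = 0") (auto simp: metric_simps)
  have "pH p v \<noteq> 0 \<or> pV p v \<noteq> 0" using \<open>v \<noteq> 0\<close> by (auto simp: pV_eq)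
  then have "g p (pH p v) (pH p v) > 0 \<or> g p (pV p v) (pV p v) > 0" using metric_pos by blast
  then show "c * g p (pH p v) (pH p v) + d * g p (pV p v) (pV p v) > 0"
    using assms nn by (auto intro: add_pos_nonneg add_nonneg_pos)
qed

text \<open>Evaluating on a unit vertical and on a nonzero horizontal vector equates the two
  eigenvalues of Ric: 4 + m/2 = m + 3 after division by the positive \<open>lam\<close>.\<close>

lemma einstein_dimension:
  assumes "einstein A g D"
  shows "m = 2"
proof -
  obtain k where k: "\<And>p u v. Ricci A g D p u v = k * g p u v"
    using assms unfolding einstein_def by blast
  fix p :: 'a
  obtain v where v: "v \<in> V p" "g p v v = 1" using vertical_unit_exists by blast
  have "\<not> H p \<subseteq> {0}" using dim_H[of p] pointwise(1) dim_eq_0[of "H p"] by linarith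
  then obtain x where x: "x \<in> H p" "x \<noteq> 0" by blast
  have "(4 + real m / 2) * lam p = k"
    using k[of p v v] pointwise(6)[of p v v] v by (simp add: pV_eq pH_V metric_simps)
  moreover have "(real m + 3) * lam p = k"
    using k[of p x x] pointwise(6)[of p x x] x metric_pos[OF x(2), of p] by (simp add: pV_eq pH_H metric_simps)
  ultimately have "(4 + real m / 2) * lam p = (real m + 3) * lam p" by simp
  then have "4 + real m / 2 = m + 3" using pointwise(3)[of p] by simp
  then show ?thesis by simp
qed

lemma curvature_identities:
  "\<exists>n. m = 2 * n \<and>
    (\<forall>p u v. Ricci A g Da p u v =
       norm_sq3 (g p) (torsion_form A g Da p) / (12 * real n) *
         ((real n + 1) * restrict_form (g p) (H p) (V p) u v
          + 2 * restrict_form (g p) (V p) (H p) u v)) \<and>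
    (\<forall>p. scalar_curvature A g Da p =
       (real n ^ 2 + real n + 1) * norm_sq3 (g p) (torsion_form A g Da p) / (3 * real n)) \<and>
    (\<forall>p u v. Ricci A g D p u v =
       norm_sq3 (g p) (torsion_form A g Da p) / (24 * real n) *
         ((2 * real n + 3) * restrict_form (g p) (H p) (V p) u v
          + (real n + 4) * restrict_form (g p) (V p) (H p) u v)) \<and>
    (\<forall>p. scalar_curvature A g D p =
       (4 * real n ^ 2 + 7 * real n + 4) * norm_sq3 (g p) (torsion_form A g Da p)
         / (12 * real n)) \<and>
    (\<forall>p. positive_definite (Ricci A g Da p)) \<and>
    (\<forall>p. positive_definite (Ricci A g D p)) \<and>
    parallel_form2 A Da (Ricci A g Da) \<and>
    parallel_form2 A Da (Ricci A g D) \<and>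
    (einstein A g D \<longrightarrow> n = 1)"
proof -
  fix p0 :: 'a
  obtain n where n: "m = 2 * n" using pointwise(2) by (elim evenE)
  have n0: "n > 0" using pointwise(1) n by simp
  \<comment> \<open>The factor is 12 m with m = 2 n; this converts all formulas in
    \<open>lam\<close> into those in |T|^2.\<close>
  have T2: "norm_sq3 (g p) (torsion_form A g Da p) = 24 * real n * lam p" for p
    unfolding lam_def using n0 by (simp add: n)
  have Ra: "Ricci A g Da = (\<lambda>p y z. (real m + 2) * lam p * g p (pH p y) (pH p z) + 4 * lam p * g p (pV p y) (pV p z))"
    by (intro ext pointwise(4))
  have Rl: "Ricci A g D = (\<lambda>p y z. (real m + 3) * lam p * g p (pH p y) (pH p z) + (4 + real m / 2) * lam p * g p (pV p y) (pV p z))"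
    by (intro ext pointwise(6))
  show ?thesis
  proof (intro exI[of _ n] conjI allI impI)
    show "m = 2 * n" by (rule n)
    show "Ricci A g Da p u v = norm_sq3 (g p) (torsion_form A g Da p) / (12 * real n) *
         ((real n + 1) * restrict_form (g p) (H p) (V p) u v + 2 * restrict_form (g p) (V p) (H p) u v)" for p u v
      unfolding Ra T2 restrict_form_def using n0 by (simp add: n algebra_simps)
    show "scalar_curvature A g Da p =
       (real n ^ 2 + real n + 1) * norm_sq3 (g p) (torsion_form A g Da p) / (3 * real n)" for p
      unfolding pointwise(5) T2 using n0 by (simp add: n field_simps power2_eq_square)
    show "Ricci A g D p u v = norm_sq3 (g p) (torsion_form A g Da p) / (24 * real n) *
         ((2 * real n + 3) * restrict_form (g p) (H p) (V p) u v
          + (real n + 4) * restrict_form (g p) (V p) (H p) u v)" for p u v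
      unfolding Rl T2 restrict_form_def using n0 by (simp add: n algebra_simps)
    show "scalar_curvature A g D p =
       (4 * real n ^ 2 + 7 * real n + 4) * norm_sq3 (g p) (torsion_form A g Da p) / (12 * real n)" for p
      unfolding pointwise(7) T2 using n0 by (simp add: n field_simps power2_eq_square)
    show "positive_definite (Ricci A g Da p)" "positive_definite (Ricci A g D p)" for p
      unfolding Ra Rl by (rule positive_definite_split_form; simp add: pointwise(3) add_pos_nonneg)+
    show "parallel_form2 A Da (Ricci A g Da)" "parallel_form2 A Da (Ricci A g D)"
      unfolding Ra Rl by (rule parallel_split_form)+
    show "n = 1" if "einstein A g D" using einstein_dimension[OF that] n by simp
  qed
qed

end

theorem corollary3p5:
  fixes A :: "('a::{t2_space,second_countable_topology}, 'e::euclidean_space) chart set"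
    and g :: "'a \<Rightarrow> 'e \<Rightarrow> 'e \<Rightarrow> real"
    and J :: "'a \<Rightarrow> 'e \<Rightarrow> 'e"
    and D Da :: "('a, 'e) conn"
    and H V :: "'a \<Rightarrow> 'e set"
    and m :: nat
  assumes "hermitian_manifold A g J"
    and "DIM('e) = 2 * m + 2"
    and "levi_civita A g D"
    and "characteristic_connection A g J Da"
    and "parallel_unitary_splitting A g J Da m H V"
    and "\<And>p. (\<lambda>u v w. complex_of_real (torsion_form A g Da p u v w))
               \<in> forms_20_01_02_10 (J p) (H p) (V p)"
    and "nondegenerate_torsion A Da"
  shows "\<exists>n. m = 2 * n \<and>
    (\<forall>p u v. Ricci A g Da p u v =
       norm_sq3 (g p) (torsion_form A g Da p) / (12 * real n) *
         ((real n + 1) * restrict_form (g p) (H p) (V p) u v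
          + 2 * restrict_form (g p) (V p) (H p) u v)) \<and>
    (\<forall>p. scalar_curvature A g Da p =
       (real n ^ 2 + real n + 1) * norm_sq3 (g p) (torsion_form A g Da p) / (3 * real n)) \<and>
    (\<forall>p u v. Ricci A g D p u v =
       norm_sq3 (g p) (torsion_form A g Da p) / (24 * real n) *
         ((2 * real n + 3) * restrict_form (g p) (H p) (V p) u v
          + (real n + 4) * restrict_form (g p) (V p) (H p) u v)) \<and>
    (\<forall>p. scalar_curvature A g D p =
       (4 * real n ^ 2 + 7 * real n + 4) * norm_sq3 (g p) (torsion_form A g Da p)
         / (12 * real n)) \<and>
    (\<forall>p. positive_definite (Ricci A g Da p)) \<and>
    (\<forall>p. positive_definite (Ricci A g D p)) \<and>
    parallel_form2 A Da (Ricci A g Da) \<and>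
    parallel_form2 A Da (Ricci A g D) \<and>
    (einstein A g D \<longrightarrow> n = 1)"
proof -
  interpret hermitian_splitting A g J D Da H V m
    by (rule hermitian_splitting.intro) (fact assms)+
  show ?thesis by (rule curvature_identities)
qed

end
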